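(* The correspondence $(\Lambda,p)\mapsto\widetilde{\xi}(\Lambda,p)$, which sends a multifoliate structure $(\Lambda,p)$ on a set $\{1,\dots,n\}$ to the completion $\widetilde\xi(\Lambda,p)$ of the projective system $\xi(\Lambda,p)$, induces a bijection between the equivalence classes of multifoliate structures $(\Lambda,p)$ and the equivalence classes of finite complete projective systems of vector space epimorphisms.
   Context: **Projective systems.** Let $(\Lambda,\le)$ be a partially ordered set. A projective system of vector space epimorphisms $\xi=(L_\alpha,\xi_\alpha^\beta,\Lambda,L)$ over $\Lambda$ consists of finite-dimensional real vector spaces $L_\alpha$ ($\alpha\in\Lambda$) and linear maps $\xi^\beta_\alpha:L_\beta\to L_\alpha$ for $\alpha\le\beta$, with $\xi^\alpha_\alpha=\mathrm{id}$ and $\xi^\beta_\alpha\circ\xi^\gamma_\beta=\xi^\gamma_\alpha$ for $\alpha\le\beta\le\gamma$; $L=\varprojlim L_\alpha=\{(x_\alpha)\in\prod_\alpha L_\alpha : \xi^\beta_\alpha(x_\beta)=x_\alpha \text{ for all } \alpha\le\beta\}$ is its projective limit and $\xi_\alpha:L\to L_\alpha$, $(x_\gamma)\mapsto x_\alpha$, are the canonical projections. It is always assumed that $L$ is finite-dimensional and that all $\xi_\alpha^\beta$ and $\xi_\alpha$ are linear epimorphisms. The system is finite if $\Lambda$ is finite. $GL(\xi)$ denotes the group of all linear automorphisms of $L$ of the form $f=\varprojlim f_\alpha$, where $f_\alpha:L_\alpha\to L_\alpha$ are linear isomorphisms with $\xi^\beta_\alpha\circ f_\beta=f_\alpha\circ\xi^\beta_\alpha$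 for all $\alpha\le\beta$. A vector subspace $K\subset L$ is invariant if every $f\in GL(\xi)$ maps $K$ into itself. The system $\xi$ is complete if every finite-codimensional invariant subspace of $L$ is of the form $\ker\xi_\alpha$ for some $\alpha\in\Lambda$. Completion: let $\{K_a\}_{a\in\widetilde\Lambda}$ be the set of all finite-codimensional invariant subspaces of $L$, with $\widetilde\Lambda$ ordered by $a\le b\iff K_a\supseteq K_b$. The completion of $\xi$ is $\widetilde\xi=(L_a,\xi_a^b,\widetilde\Lambda,\widetilde L)$, where $L_a=L/K_a$, $\xi^b_a:L/K_b\to L/K_a$ is the canonical epimorphism, and $\widetilde L=\varprojlim L_a$. Two projective systems $\xi,\xi'$ (with limits $L,L'$, possibly over different index sets) are equivalent if there is a linear isomorphism $\varphi:L\to L'$ such that $\varphi\circ f\circ\varphi^{-1}\in GL(\xi')$ for all $f\in GL(\xi)$ and $f\mapsto\varphi\circ f\circ\varphi^{-1}$ is a group isomorphism $GL(\xi)\to GL(\xi')$. **Multifoliate structures.** For a natural number $n$, a multifoliate structure on $\{1,\dots,n\}$ is a pair $(\Lambda,p)$ with $\Lambda$ a finite partially ordered set and $p:\{1,\dots,n\}\to\Lambda$ a surjective map. $GL(\Lambda,p)$ is the group of all linear isomorphisms $f:\mathbb R^n\to\mathbb R^n$, $(x^i)\mapsto(\sum_j f^i_jx^j)$, with $f^i_j=0$ whenever $p(i)\not\ge p(j)$. Two multifoliate structures $(\Lambda,p)$, $(\Lambda',p')$ on the same set $\{1,\dots,n\}$ are equivalent if there is a linear automorphism $\varphi$ of $\mathbb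 R^n$ such that $\varphi\circ f\circ\varphi^{-1}\in GL(\Lambda',p')$ for all $f\in GL(\Lambda,p)$ and $f\mapsto\varphi\circ f\circ\varphi^{-1}$ is a group isomorphism $GL(\Lambda,p)\to GL(\Lambda',p')$. **The system $\xi(\Lambda,p)$.** For $\alpha\in\Lambda$ let $H_\alpha=\{i : p(i)\le\alpha\}$ and $L_\alpha=\mathbb R^{H_\alpha}$ (coordinates indexed by $H_\alpha$). For $\alpha\le\beta$ let $\mathrm{pr}^\beta_\alpha:L_\beta\to L_\alpha$ be the natural coordinate projection. These form a projective system over $\Lambda$, denoted $\xi(\Lambda,p)$, whose limit is naturally identified with $\mathbb R^n$. Its completion is denoted $\widetilde\xi(\Lambda,p)$. *)

theory Defs
  imports "Jordan_Normal_Form.VS_Connect" "HOL-Algebra.AbelCoset" "HOL-Algebra.Bij"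
begin

section \<open>Real vector spaces\<close>

text \<open>
  A real vector space is a carrier-based \<^locale>\<open>vectorspace\<close> over the field of real numbers, so that
  products, limits and quotients of vector spaces can be formed freely.  The ring components
  \<open>mult\<close> and \<open>one\<close> of the record type \<open>module\<close> play no role.
\<close>

abbreviation real_ring :: "real ring" where
  "real_ring \<equiv> class_ring"

definition lin_iso :: "(real, 'v) module \<Rightarrow> (real, 'w) module \<Rightarrow> ('v \<Rightarrow> 'w) \<Rightarrow> bool" where
  "lin_iso V W f \<longleftrightarrow> linear_map real_ring V W f \<and> bij_betw f (carrier V) (carrier W)"

definition lin_epi :: "(real, 'v) module \<Rightarrow> (real, 'w) module \<Rightarrow> ('v \<Rightarrow> 'w) \<Rightarrow> bool" where
  "lin_epi V W f \<longleftrightarrow> linear_map real_ring V W f \<and> f ` carrier V = carrier W"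

text \<open>The quotient \<open>V / K\<close>; its elements are the cosets of \<open>K\<close>, and \<open>c (K + x) = K + c x\<close>.\<close>

definition quot_space :: "(real, 'v) module \<Rightarrow> 'v set \<Rightarrow> (real, 'v set) module" where
  "quot_space V K =
    \<lparr>carrier = a_rcosets\<^bsub>V\<^esub> K,
     mult = (\<lambda>_ _. K),
     one = K,
     zero = K,
     add = (\<lambda>A B. A <+>\<^bsub>V\<^esub> B),
     smult = (\<lambda>c A. K <+>\<^bsub>V\<^esub> ((\<lambda>x. c \<odot>\<^bsub>V\<^esub> x) ` A))\<rparr>"

text \<open>
  A set \<open>G\<close> of linear automorphisms of \<open>V\<close> regarded as a group under composition.  As in
  \<^const>\<open>BijGroup\<close>, the maps are extensional on the carrier of \<open>V\<close>.
\<close>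

definition aut_group :: "(real, 'v) module \<Rightarrow> ('v \<Rightarrow> 'v) set \<Rightarrow> ('v \<Rightarrow> 'v) monoid" where
  "aut_group V G = (BijGroup (carrier V))\<lparr>carrier := G\<rparr>"

definition conj_by ::
  "(real, 'v) module \<Rightarrow> (real, 'w) module \<Rightarrow> ('v \<Rightarrow> 'w) \<Rightarrow> ('v \<Rightarrow> 'v) \<Rightarrow> ('w \<Rightarrow> 'w)" where
  "conj_by V W \<phi> f = (\<lambda>y\<in>carrier W. \<phi> (f (inv_into (carrier V) \<phi> y)))"

text \<open>
  There is a linear isomorphism \<open>\<phi>\<close> such that \<open>f \<mapsto> \<phi> \<circ> f \<circ> \<phi>\<^sup>-\<^sup>1\<close> is a group isomorphism from \<open>G\<close>
  onto \<open>G'\<close>; in particular it maps \<open>G\<close> into \<open>G'\<close>.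
\<close>

definition lin_conjugate ::
  "(real, 'v) module \<Rightarrow> ('v \<Rightarrow> 'v) set \<Rightarrow> (real, 'w) module \<Rightarrow> ('w \<Rightarrow> 'w) set \<Rightarrow> bool" where
  "lin_conjugate V G W G' \<longleftrightarrow>
    (\<exists>\<phi>. lin_iso V W \<phi> \<and> conj_by V W \<phi> \<in> iso (aut_group V G) (aut_group W G'))"


section \<open>Projective systems\<close>

text \<open>
  \<open>ps_bond X \<alpha> \<beta>\<close> is the connecting map from \<open>L\<^sub>\<beta>\<close> to \<open>L\<^sub>\<alpha>\<close>, meaningful only for \<open>(\<alpha>, \<beta>) \<in> ps_le X\<close>,
  that is, \<open>\<alpha> \<le> \<beta>\<close>.
\<close>

record ('i, 'v) proj_system =
  ps_idx :: "'i set"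
  ps_le :: "'i rel"
  ps_space :: "'i \<Rightarrow> (real, 'v) module"
  ps_bond :: "'i \<Rightarrow> 'i \<Rightarrow> 'v \<Rightarrow> 'v"

definition proj_limit :: "('i, 'v) proj_system \<Rightarrow> (real, 'i \<Rightarrow> 'v) module" where
  "proj_limit X =
    \<lparr>carrier = {x \<in> (\<Pi>\<^sub>E \<alpha>\<in>ps_idx X. carrier (ps_space X \<alpha>)).
                  \<forall>(\<alpha>, \<beta>)\<in>ps_le X. ps_bond X \<alpha> \<beta> (x \<beta>) = x \<alpha>},
     mult = (\<lambda>_ _. \<lambda>\<alpha>\<in>ps_idx X. \<zero>\<^bsub>ps_space X \<alpha>\<^esub>),
     one = (\<lambda>\<alpha>\<in>ps_idx X. \<zero>\<^bsub>ps_space X \<alpha>\<^esub>),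
     zero = (\<lambda>\<alpha>\<in>ps_idx X. \<zero>\<^bsub>ps_space X \<alpha>\<^esub>),
     add = (\<lambda>x y. \<lambda>\<alpha>\<in>ps_idx X. x \<alpha> \<oplus>\<^bsub>ps_space X \<alpha>\<^esub> y \<alpha>),
     smult = (\<lambda>c x. \<lambda>\<alpha>\<in>ps_idx X. c \<odot>\<^bsub>ps_space X \<alpha>\<^esub> x \<alpha>)\<rparr>"

definition ps_proj :: "'i \<Rightarrow> ('i \<Rightarrow> 'v) \<Rightarrow> 'v" where
  "ps_proj \<alpha> x = x \<alpha>"

definition is_proj_system :: "('i, 'v) proj_system \<Rightarrow> bool" where
  "is_proj_system X \<longleftrightarrow>
    partial_order_on (ps_idx X) (ps_le X) \<and>
    (\<forall>\<alpha>\<in>ps_idx X. vectorspace real_ring (ps_space X \<alpha>) \<and>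
                    vectorspace.fin_dim real_ring (ps_space X \<alpha>)) \<and>
    (\<forall>(\<alpha>, \<beta>)\<in>ps_le X. lin_epi (ps_space X \<beta>) (ps_space X \<alpha>) (ps_bond X \<alpha> \<beta>)) \<and>
    (\<forall>\<alpha>\<in>ps_idx X. \<forall>x\<in>carrier (ps_space X \<alpha>). ps_bond X \<alpha> \<alpha> x = x) \<and>
    (\<forall>\<alpha> \<beta> \<gamma>. (\<alpha>, \<beta>) \<in> ps_le X \<longrightarrow> (\<beta>, \<gamma>) \<in> ps_le X \<longrightarrow>
       (\<forall>x\<in>carrier (ps_space X \<gamma>). ps_bond X \<alpha> \<beta> (ps_bond X \<beta> \<gamma> x) = ps_bond X \<alpha> \<gamma> x)) \<and>
    vectorspace.fin_dim real_ring (proj_limit X) \<and>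
    (\<forall>\<alpha>\<in>ps_idx X. lin_epi (proj_limit X) (ps_space X \<alpha>) (ps_proj \<alpha>))"

definition GL_ps :: "('i, 'v) proj_system \<Rightarrow> (('i \<Rightarrow> 'v) \<Rightarrow> ('i \<Rightarrow> 'v)) set" where
  "GL_ps X =
    {f \<in> extensional (carrier (proj_limit X)).
       lin_iso (proj_limit X) (proj_limit X) f \<and>
       (\<exists>h. (\<forall>\<alpha>\<in>ps_idx X. lin_iso (ps_space X \<alpha>) (ps_space X \<alpha>) (h \<alpha>)) \<and>
            (\<forall>(\<alpha>, \<beta>)\<in>ps_le X. \<forall>x\<in>carrier (ps_space X \<beta>).
               ps_bond X \<alpha> \<beta> (h \<beta> x) = h \<alpha> (ps_bond X \<alpha> \<beta> x)) \<and>
            (\<forall>x\<in>carrier (proj_limit X). f x = (\<lambda>\<alpha>\<in>ps_idx X. h \<alpha> (x \<alpha>))))}"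

definition fincodim_invariant_subspaces :: "('i, 'v) proj_system \<Rightarrow> ('i \<Rightarrow> 'v) set set" where
  "fincodim_invariant_subspaces X =
    {K. VectorSpace.subspace real_ring K (proj_limit X) \<and>
        (\<forall>f\<in>GL_ps X. f ` K \<subseteq> K) \<and>
        vectorspace.fin_dim real_ring (quot_space (proj_limit X) K)}"

definition complete_ps :: "('i, 'v) proj_system \<Rightarrow> bool" where
  "complete_ps X \<longleftrightarrow>
    (\<forall>K\<in>fincodim_invariant_subspaces X.
       \<exists>\<alpha>\<in>ps_idx X. K = mod_hom.ker (proj_limit X) (ps_space X \<alpha>) (ps_proj \<alpha>))"

text \<open>
  The completion is indexed by the invariant subspaces themselves.  For \<open>B \<subseteq> A\<close> the canonical
  epimorphism \<open>L / B \<rightarrow> L / A\<close> sends a coset \<open>C = B + x\<close> to \<open>A + C = A + x\<close>.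
\<close>

definition completion ::
  "('i, 'v) proj_system \<Rightarrow> (('i \<Rightarrow> 'v) set, ('i \<Rightarrow> 'v) set) proj_system" where
  "completion X =
    \<lparr>ps_idx = fincodim_invariant_subspaces X,
     ps_le = {(A, B). A \<in> fincodim_invariant_subspaces X \<and>
                      B \<in> fincodim_invariant_subspaces X \<and> A \<supseteq> B},
     ps_space = (\<lambda>K. quot_space (proj_limit X) K),
     ps_bond = (\<lambda>A B C. A <+>\<^bsub>proj_limit X\<^esub> C)\<rparr>"

definition ps_equivalent :: "('i, 'v) proj_system \<Rightarrow> ('j, 'w) proj_system \<Rightarrow> bool" where
  "ps_equivalent X Y \<longleftrightarrow> lin_conjugate (proj_limit X) (GL_ps X) (proj_limit Y) (GL_ps Y)"

definition finite_complete_systems :: "('i, 'v) proj_system set" where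
  "finite_complete_systems = {X. is_proj_system X \<and> finite (ps_idx X) \<and> complete_ps X}"

definition fc_equiv :: "('i, 'v) proj_system rel" where
  "fc_equiv = {(X, Y). X \<in> finite_complete_systems \<and> Y \<in> finite_complete_systems \<and>
                       ps_equivalent X Y}"


section \<open>Multifoliate structures\<close>

text \<open>
  The number \<open>n\<close> is part of the structure; only the values of \<open>mf_map\<close> on \<open>{1..n}\<close> are ever used.
  If \<open>'l\<close> is infinite, every finite partially ordered set is isomorphic to one carried by a subset of \<open>'l\<close>.
\<close>

record 'l multifol =
  mf_n :: nat
  mf_idx :: "'l set"
  mf_le :: "'l rel"
  mf_map :: "nat \<Rightarrow> 'l"

definition multifoliate_structures :: "'l multifol set" where
  "multifoliate_structures =
    {M. finite (mf_idx M) \<and> partial_order_on (mf_idx M) (mf_le M) \<and>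
        mf_map M ` {1..mf_n M} = mf_idx M}"

text \<open>The coordinate space with coordinates indexed by \<open>H\<close>: extensional functions from \<open>H\<close> to the reals.\<close>

abbreviation coord_space :: "nat set \<Rightarrow> (real, nat \<Rightarrow> real) module" where
  "coord_space H \<equiv> ring.func_space real_ring H"

definition GL_mf :: "'l multifol \<Rightarrow> ((nat \<Rightarrow> real) \<Rightarrow> (nat \<Rightarrow> real)) set" where
  "GL_mf M =
    {f \<in> extensional (carrier (coord_space {1..mf_n M})).
       lin_iso (coord_space {1..mf_n M}) (coord_space {1..mf_n M}) f \<and>
       (\<exists>a :: nat \<Rightarrow> nat \<Rightarrow> real.
          (\<forall>x\<in>carrier (coord_space {1..mf_n M}).
             f x = (\<lambda>i\<in>{1..mf_n M}. \<Sum>j\<in>{1..mf_n M}. a i j * x j)) \<and>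
          (\<forall>i\<in>{1..mf_n M}. \<forall>j\<in>{1..mf_n M}.
             (mf_map M j, mf_map M i) \<notin> mf_le M \<longrightarrow> a i j = 0))}"

definition mf_equiv :: "'l multifol rel" where
  "mf_equiv =
    {(M, N). M \<in> multifoliate_structures \<and> N \<in> multifoliate_structures \<and> mf_n M = mf_n N \<and>
             lin_conjugate (coord_space {1..mf_n M}) (GL_mf M)
                           (coord_space {1..mf_n N}) (GL_mf N)}"

definition mf_coords :: "'l multifol \<Rightarrow> 'l \<Rightarrow> nat set" where
  "mf_coords M \<alpha> = {i \<in> {1..mf_n M}. (mf_map M i, \<alpha>) \<in> mf_le M}"

definition mf_system :: "'l multifol \<Rightarrow> ('l, nat \<Rightarrow> real) proj_system" where
  "mf_system M =
    \<lparr>ps_idx = mf_idx M,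
     ps_le = mf_le M,
     ps_space = (\<lambda>\<alpha>. coord_space (mf_coords M \<alpha>)),
     ps_bond = (\<lambda>\<alpha> \<beta> x. restrict x (mf_coords M \<alpha>))\<rparr>"

text \<open>
  Equivalence classes are formed inside one type of projective systems, which has to contain the
  completions of the systems attached to multifoliate structures; this is the smallest choice.
\<close>

type_synonym 'l mf_completion_system =
  "(('l \<Rightarrow> nat \<Rightarrow> real) set, ('l \<Rightarrow> nat \<Rightarrow> real) set) proj_system"

end

theory Submission
  imports Defs
begin

text \<open>
  The proof replaces every structure by a finite-dimensional space together with the stabiliser of a
  family of its subspaces (\<open>stabilizer\<close>), and the equivalences by conjugacy of such stabilisers.

  For a projective system with limit \<open>L\<close>, the group \<open>GL(\<xi>)\<close> is the stabiliser of the kernels of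
  the projections \<open>\<xi>\<^sub>\<alpha>\<close> (\<open>GL_ps_eq_stabilizer\<close>): an automorphism preserving these kernels descends to
  all \<open>L\<^sub>\<alpha>\<close>.  These kernels are themselves invariant, so \<open>GL(\<xi>)\<close> is also the stabiliser of all
  invariant subspaces.  The latter are the kernels of the completion, whose limit is
  isomorphic to \<open>L\<close> because the zero subspace is one of its indices.  Hence completing a system changes
  neither the group nor the invariant subspaces, and the result is complete.  The group
  \<open>GL(\<Lambda>, p)\<close> is the stabiliser of the coordinate subspaces \<open>{x. x\<^sub>i = 0 whenever p i \<le> \<alpha>}\<close>, which are the
  kernels of \<open>\<xi>(\<Lambda>, p)\<close>.  So two multifoliate structures are equivalent iff the completions of their
  systems are; this makes the correspondence well defined and injective on classes.  The completion
  is finite since doubling a single coordinate belongs to \<open>GL(\<Lambda>, p)\<close>, which forces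
  invariant subspaces to be coordinate subspaces (\<open>invariant_subspace_vanishing\<close>).

  Surjectivity is the substantial part.  In a finite complete system the group has only finitely many
  invariant subspaces.  As the field of real numbers is infinite, this makes their lattice distributive
  (\<open>distributive\<close>): a failure of distributivity would produce a one-parameter family of
  invariant subspaces.  A finite distributive lattice of subspaces has an adapted basis, that is, a basis
  of which a part spans each member of the lattice (\<open>exists_adapted\<close>).  In the
  corresponding coordinates \<open>GL(\<xi>)\<close> is the stabiliser of a family of coordinate subspaces.  Every such
  stabiliser is the group of a multifoliate structure: sort the coordinates by the members of the family
  in which they occur (\<open>exists_multifoliate_structure\<close>).
\<close>

section \<open>Linear isomorphisms and conjugation\<close>

lemma linear_map_realI:
  assumes "vectorspace real_ring V" "vectorspace real_ring W"
    and "\<And>x. x \<in> carrier V \<Longrightarrow> T x \<in> carrier W"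
    and "\<And>x y. x \<in> carrier V \<Longrightarrow> y \<in> carrier V \<Longrightarrow> T (x \<oplus>\<^bsub>V\<^esub> y) = T x \<oplus>\<^bsub>W\<^esub> T y"
    and "\<And>c x. x \<in> carrier V \<Longrightarrow> T (c \<odot>\<^bsub>V\<^esub> x) = c \<odot>\<^bsub>W\<^esub> T x"
  shows "linear_map real_ring V W T"
  using assms
  by (auto simp: linear_map_def mod_hom_def mod_hom_axioms_def LinearCombinations.module_hom_def vectorspace_def)

lemma linear_map_realD:
  assumes "linear_map real_ring V W T"
  shows "vectorspace real_ring V" "vectorspace real_ring W"
    and "x \<in> carrier V \<Longrightarrow> T x \<in> carrier W"
    and "x \<in> carrier V \<Longrightarrow> y \<in> carrier V \<Longrightarrow> T (x \<oplus>\<^bsub>V\<^esub> y) = T x \<oplus>\<^bsub>W\<^esub> T y"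
    and "x \<in> carrier V \<Longrightarrow> T (c \<odot>\<^bsub>V\<^esub> x) = c \<odot>\<^bsub>W\<^esub> T x"
    and "T \<zero>\<^bsub>V\<^esub> = \<zero>\<^bsub>W\<^esub>"
proof -
  interpret T: linear_map real_ring V W T by fact
  show "vectorspace real_ring V" "vectorspace real_ring W" by unfold_locales
  show "x \<in> carrier V \<Longrightarrow> T x \<in> carrier W" by simp
  show "x \<in> carrier V \<Longrightarrow> y \<in> carrier V \<Longrightarrow> T (x \<oplus>\<^bsub>V\<^esub> y) = T x \<oplus>\<^bsub>W\<^esub> T y" by simp
  show "x \<in> carrier V \<Longrightarrow> T (c \<odot>\<^bsub>V\<^esub> x) = c \<odot>\<^bsub>W\<^esub> T x" by simp
  show "T \<zero>\<^bsub>V\<^esub> = \<zero>\<^bsub>W\<^esub>" by simp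
qed

lemma lin_isoD:
  assumes "lin_iso V W T"
  shows "linear_map real_ring V W T" "bij_betw T (carrier V) (carrier W)"
    and "inj_on T (carrier V)" "T ` carrier V = carrier W"
  using assms by (auto simp: lin_iso_def bij_betw_def)

lemma lin_isoI:
  assumes "linear_map real_ring V W T" "inj_on T (carrier V)" "T ` carrier V = carrier W"
  shows "lin_iso V W T"
  using assms by (auto simp: lin_iso_def bij_betw_def)

lemma lin_iso_cong:
  assumes "lin_iso V W f" "\<And>x. x \<in> carrier V \<Longrightarrow> g x = f x"
  shows "lin_iso V W g"
proof -
  note f = lin_isoD[OF assms(1)] and lin = linear_map_realD[OF lin_isoD(1)[OF assms(1)]]
  interpret V: vectorspace real_ring V by (rule lin(1))
  show ?thesis
  proof (rule lin_isoI)
    show "linear_map real_ring V W g"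
      using lin by (intro linear_map_realI) (auto simp: assms(2))
    show "inj_on g (carrier V)" using f(3) assms(2) by (auto simp: inj_on_def)
    show "g ` carrier V = carrier W" using f(4) assms(2) by auto
  qed
qed

lemma lin_iso_id:
  assumes "vectorspace real_ring V" shows "lin_iso V V (\<lambda>x. x)"
  using assms by (intro lin_isoI linear_map_realI) auto

lemma lin_iso_comp:
  assumes "lin_iso U V f" "lin_iso V W g"
  shows "lin_iso U W (\<lambda>x. g (f x))"
proof -
  note f = lin_isoD[OF assms(1)] linear_map_realD[OF lin_isoD(1)[OF assms(1)]]
  note g = lin_isoD[OF assms(2)] linear_map_realD[OF lin_isoD(1)[OF assms(2)]]
  show ?thesis
    unfolding lin_iso_def using f g bij_betw_trans[OF f(2) g(2)]
    by (auto intro!: linear_map_realI simp: comp_def)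
qed

lemma lin_iso_inv:
  assumes "lin_iso V W f"
  shows "lin_iso W V (inv_into (carrier V) f)"
proof -
  note f = lin_isoD[OF assms] linear_map_realD[OF lin_isoD(1)[OF assms]]
  let ?g = "inv_into (carrier V) f"
  interpret V: vectorspace real_ring V by (rule f(5))
  have g: "?g y \<in> carrier V" "f (?g y) = y" if "y \<in> carrier W" for y
    using that f(4) by (auto simp: inv_into_into f_inv_into_f)
  have eq: "?g y = x" if "x \<in> carrier V" "f x = y" for x y
    using that f(3) by auto
  show ?thesis
    unfolding lin_iso_def
  proof (intro conjI linear_map_realI bij_betw_inv_into f(2,5,6))
    show "?g (x \<oplus>\<^bsub>W\<^esub> y) = ?g x \<oplus>\<^bsub>V\<^esub> ?g y" if "x \<in> carrier W" "y \<in> carrier W" for x y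
      using that by (intro eq) (simp_all add: g f)
    show "?g (c \<odot>\<^bsub>W\<^esub> x) = c \<odot>\<^bsub>V\<^esub> ?g x" if "x \<in> carrier W" for x c
      using that by (intro eq) (simp_all add: g f)
  qed (simp add: g)
qed

text \<open>
  The common normal form of \<^const>\<open>GL_ps\<close> and \<^const>\<open>GL_mf\<close>.  As there, the maps are extensional, so
  that the stabiliser is a set of elements of \<^const>\<open>BijGroup\<close>.
\<close>

definition stabilizer :: "(real, 'v) module \<Rightarrow> 'v set set \<Rightarrow> ('v \<Rightarrow> 'v) set" where
  "stabilizer V \<K> = {f \<in> extensional (carrier V). lin_iso V V f \<and> (\<forall>K\<in>\<K>. f ` K \<subseteq> K)}"

lemma stabilizer_subset_Bij: "stabilizer V \<K> \<subseteq> Bij (carrier V)"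
  by (auto simp: stabilizer_def Bij_def lin_iso_def)

lemma conj_by_apply:
  assumes "inj_on \<phi> (carrier V)" "\<phi> ` carrier V = carrier W" "x \<in> carrier V"
  shows "conj_by V W \<phi> f (\<phi> x) = \<phi> (f x)"
  using assms by (auto simp: conj_by_def)

lemma conj_by_inverse:
  assumes \<phi>: "lin_iso V W \<phi>" and f: "f \<in> Bij (carrier V)"
  shows "conj_by W V (inv_into (carrier V) \<phi>) (conj_by V W \<phi> f) = f"
proof
  note \<phi>D = lin_isoD[OF \<phi>]
  let ?\<psi> = "inv_into (carrier V) \<phi>"
  have fc: "f x \<in> carrier V" if "x \<in> carrier V" for x
    using f that by (auto simp: Bij_def bij_betw_def)
  fix x
  show "conj_by W V ?\<psi> (conj_by V W \<phi> f) x = f x"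
  proof (cases "x \<in> carrier V")
    case True
    note \<psi> = lin_isoD[OF lin_iso_inv[OF \<phi>]]
    have px: "\<phi> x \<in> carrier W" using True \<phi>D by auto
    have "conj_by W V ?\<psi> (conj_by V W \<phi> f) (?\<psi> (\<phi> x)) = ?\<psi> (conj_by V W \<phi> f (\<phi> x))"
      by (rule conj_by_apply[OF \<psi>(3,4) px])
    also have "\<dots> = ?\<psi> (\<phi> (f x))"
      by (simp add: conj_by_apply[OF \<phi>D(3,4) True])
    finally show ?thesis using True fc \<phi>D(3) by simp
  next
    case False
    then show ?thesis using f by (auto simp: conj_by_def Bij_def extensional_def)
  qed
qed

lemma conj_by_comp:
  assumes \<phi>: "lin_iso U V \<phi>" and \<psi>: "lin_iso V W \<psi>" and f: "f \<in> Bij (carrier U)"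
  shows "conj_by U W (\<lambda>x. \<psi> (\<phi> x)) f = conj_by V W \<psi> (conj_by U V \<phi> f)"
proof
  note \<phi>D = lin_isoD[OF \<phi>] and \<psi>D = lin_isoD[OF \<psi>] and cD = lin_isoD[OF lin_iso_comp[OF \<phi> \<psi>]]
  fix y
  show "conj_by U W (\<lambda>x. \<psi> (\<phi> x)) f y = conj_by V W \<psi> (conj_by U V \<phi> f) y"
  proof (cases "y \<in> carrier W")
    case True
    then obtain x where x: "x \<in> carrier U" "y = \<psi> (\<phi> x)" using cD(4) by (metis imageE)
    have px: "\<phi> x \<in> carrier V" using \<phi>D(4) x(1) by auto
    show ?thesis
      using conj_by_apply[OF cD(3,4) x(1)] conj_by_apply[OF \<phi>D(3,4) x(1)]
        conj_by_apply[OF \<psi>D(3,4) px] x(2) by simp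
  qed (simp add: conj_by_def)
qed

lemma conj_by_identity:
  assumes \<iota>: "\<And>x. x \<in> carrier V \<Longrightarrow> \<iota> x = x" and f: "f \<in> Bij (carrier V)"
  shows "conj_by V V \<iota> f = f"
proof
  fix x
  have inj: "inj_on \<iota> (carrier V)" using \<iota> by (simp add: inj_on_def)
  show "conj_by V V \<iota> f x = f x"
  proof (cases "x \<in> carrier V")
    case True
    then have "f x \<in> carrier V" using f by (auto simp: Bij_def bij_betw_def)
    then show ?thesis using inv_into_f_f[OF inj True] \<iota> True by (simp add: conj_by_def)
  next
    case False
    then show ?thesis using f by (simp add: conj_by_def Bij_def extensional_def)
  qed
qed

text \<open>
  Conjugation is always multiplicative and injective, so the group isomorphism demanded by
  \<^const>\<open>lin_conjugate\<close> amounts to an equality of sets.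
\<close>

lemma lin_conjugate_iff:
  assumes G: "G \<subseteq> Bij (carrier V)" and G': "G' \<subseteq> Bij (carrier W)"
  shows "lin_conjugate V G W G' \<longleftrightarrow> (\<exists>\<phi>. lin_iso V W \<phi> \<and> conj_by V W \<phi> ` G = G')"
proof -
  have "conj_by V W \<phi> \<in> iso (aut_group V G) (aut_group W G') \<longleftrightarrow> conj_by V W \<phi> ` G = G'"
    if \<phi>: "lin_iso V W \<phi>" for \<phi>
  proof
    assume "conj_by V W \<phi> \<in> iso (aut_group V G) (aut_group W G')"
    then show "conj_by V W \<phi> ` G = G'" by (simp add: iso_def bij_betw_def aut_group_def)
  next
    assume im: "conj_by V W \<phi> ` G = G'"
    note \<phi>D = lin_isoD[OF \<phi>]
    have inj: "inj_on (conj_by V W \<phi>) G"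
      by (rule inj_on_inverseI) (rule conj_by_inverse[OF \<phi> subsetD[OF G]])
    have comp: "conj_by V W \<phi> (compose (carrier V) f g)
        = compose (carrier W) (conj_by V W \<phi> f) (conj_by V W \<phi> g)"
      if "f \<in> G" "g \<in> G" for f g
    proof
      fix y
      show "conj_by V W \<phi> (compose (carrier V) f g) y
          = compose (carrier W) (conj_by V W \<phi> f) (conj_by V W \<phi> g) y"
      proof (cases "y \<in> carrier W")
        case True
        then obtain x where x: "x \<in> carrier V" "y = \<phi> x" using \<phi>D(4) by auto
        have gx: "g x \<in> carrier V" using that(2) G x(1) by (auto simp: Bij_def bij_betw_def)
        show ?thesis
          using x True conj_by_apply[OF \<phi>D(3,4) x(1)] conj_by_apply[OF \<phi>D(3,4) gx]
          by (simp add: compose_def)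
      qed (simp add: conj_by_def compose_def)
    qed
    have "conj_by V W \<phi> (f \<otimes>\<^bsub>aut_group V G\<^esub> g)
        = conj_by V W \<phi> f \<otimes>\<^bsub>aut_group W G'\<^esub> conj_by V W \<phi> g"
      if "f \<in> G" "g \<in> G" for f g
    proof -
      have "f \<in> Bij (carrier V)" "g \<in> Bij (carrier V)" using that G by blast+
      moreover have "conj_by V W \<phi> f \<in> Bij (carrier W)" "conj_by V W \<phi> g \<in> Bij (carrier W)"
        using that G' im by blast+
      ultimately show ?thesis
        using comp[OF that] by (simp add: aut_group_def BijGroup_def)
    qed
    moreover have "bij_betw (conj_by V W \<phi>) G G'"
      using inj im by (simp add: bij_betw_def)
    ultimately show "conj_by V W \<phi> \<in> iso (aut_group V G) (aut_group W G')"
      using im unfolding iso_def hom_def by (auto simp: aut_group_def)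
  qed
  then show ?thesis by (auto simp: lin_conjugate_def)
qed

lemma lin_conjugate_refl:
  assumes "vectorspace real_ring V" "G \<subseteq> Bij (carrier V)"
  shows "lin_conjugate V G V G"
proof -
  have "conj_by V V (\<lambda>x. x) ` G = G"
    using conj_by_identity[of V "\<lambda>x. x"] assms(2) by (force simp: image_iff subset_iff)
  then show ?thesis
    using lin_conjugate_iff[OF assms(2,2)] lin_iso_id[OF assms(1)] by blast
qed

lemma lin_conjugate_sym:
  assumes "G \<subseteq> Bij (carrier V)" "G' \<subseteq> Bij (carrier W)" "lin_conjugate V G W G'"
  shows "lin_conjugate W G' V G"
proof -
  obtain \<phi> where \<phi>: "lin_iso V W \<phi>" "conj_by V W \<phi> ` G = G'"
    using assms lin_conjugate_iff[OF assms(1,2)] by auto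
  have "conj_by W V (inv_into (carrier V) \<phi>) ` G' = G"
    unfolding \<phi>(2)[symmetric] image_image
    using conj_by_inverse[OF \<phi>(1)] assms(1) by (force simp: image_iff subset_iff)
  then show ?thesis
    using lin_conjugate_iff[OF assms(2,1)] lin_iso_inv[OF \<phi>(1)] by auto
qed

lemma lin_conjugate_trans:
  assumes G: "F \<subseteq> Bij (carrier U)" "G \<subseteq> Bij (carrier V)" "H \<subseteq> Bij (carrier W)"
    and 1: "lin_conjugate U F V G" and 2: "lin_conjugate V G W H"
  shows "lin_conjugate U F W H"
proof -
  obtain \<phi> where \<phi>: "lin_iso U V \<phi>" "conj_by U V \<phi> ` F = G"
    using 1 lin_conjugate_iff[OF G(1,2)] by auto
  obtain \<psi> where \<psi>: "lin_iso V W \<psi>" "conj_by V W \<psi> ` G = H"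
    using 2 lin_conjugate_iff[OF G(2,3)] by auto
  have "conj_by U W (\<lambda>x. \<psi> (\<phi> x)) ` F = (\<lambda>f. conj_by V W \<psi> (conj_by U V \<phi> f)) ` F"
    using conj_by_comp[OF \<phi>(1) \<psi>(1)] G(1) by (intro image_cong) auto
  also have "\<dots> = H" using \<phi>(2) \<psi>(2) by (metis image_image)
  finally have "conj_by U W (\<lambda>x. \<psi> (\<phi> x)) ` F = H" .
  then show ?thesis
    using lin_conjugate_iff[OF G(1,3)] lin_iso_comp[OF \<phi>(1) \<psi>(1)] by blast
qed

lemma conj_by_stabilizer_subset:
  assumes \<phi>: "lin_iso V W \<phi>" and \<K>: "\<And>K. K \<in> \<K> \<Longrightarrow> K \<subseteq> carrier V"
    and f: "f \<in> stabilizer V \<K>"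
  shows "conj_by V W \<phi> f \<in> stabilizer W ((`) \<phi> ` \<K>)"
proof -
  note \<phi>D = lin_isoD[OF \<phi>]
  have fi: "lin_iso V V f" using f by (simp add: stabilizer_def)
  have "lin_iso W W (\<lambda>y. \<phi> (f (inv_into (carrier V) \<phi> y)))"
    by (intro lin_iso_comp[OF _ \<phi>] lin_iso_comp[OF _ fi] lin_iso_inv[OF \<phi>])
  then have "lin_iso W W (conj_by V W \<phi> f)"
    by (rule lin_iso_cong) (simp add: conj_by_def)
  moreover have "conj_by V W \<phi> f ` \<phi> ` K \<subseteq> \<phi> ` K" if K: "K \<in> \<K>" for K
  proof -
    have "conj_by V W \<phi> f (\<phi> x) = \<phi> (f x)" if "x \<in> K" for x
      using that \<K>[OF K] by (intro conj_by_apply[OF \<phi>D(3,4)]) auto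
    moreover have "f ` K \<subseteq> K" using K f by (simp add: stabilizer_def)
    ultimately show ?thesis by auto
  qed
  ultimately show ?thesis by (auto simp: stabilizer_def conj_by_def)
qed

text \<open>
  Transport of structure for stabilisers: the inclusion from left to right, applied to the inverse of
  \<open>\<phi>\<close>, gives the other one.
\<close>

lemma conj_by_stabilizer:
  assumes \<phi>: "lin_iso V W \<phi>" and \<K>: "\<And>K. K \<in> \<K> \<Longrightarrow> K \<subseteq> carrier V"
  shows "conj_by V W \<phi> ` stabilizer V \<K> = stabilizer W ((`) \<phi> ` \<K>)"
proof
  show "conj_by V W \<phi> ` stabilizer V \<K> \<subseteq> stabilizer W ((`) \<phi> ` \<K>)"
    using conj_by_stabilizer_subset[OF assms] by blast
next
  note \<phi>D = lin_isoD[OF \<phi>]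
  let ?\<psi> = "inv_into (carrier V) \<phi>"
  have \<psi>: "lin_iso W V ?\<psi>" by (rule lin_iso_inv[OF \<phi>])
  have sub: "K' \<subseteq> carrier W" if "K' \<in> (`) \<phi> ` \<K>" for K'
    using that \<K> \<phi>D(4) by blast
  have pre: "(`) ?\<psi> ` (`) \<phi> ` \<K> = \<K>"
  proof -
    have "?\<psi> ` \<phi> ` K = K" if "K \<in> \<K>" for K
      using \<K>[OF that] \<phi>D(3) by simp
    then show ?thesis by (force simp: image_iff)
  qed
  show "stabilizer W ((`) \<phi> ` \<K>) \<subseteq> conj_by V W \<phi> ` stabilizer V \<K>"
  proof
    fix g assume g: "g \<in> stabilizer W ((`) \<phi> ` \<K>)"
    let ?f = "conj_by W V ?\<psi> g"
    have f: "?f \<in> stabilizer V \<K>"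
      using conj_by_stabilizer_subset[OF \<psi> sub g] by (simp add: pre)
    have gB: "g \<in> Bij (carrier W)" using g stabilizer_subset_Bij by blast
    have "conj_by V W \<phi> ?f = conj_by W W (\<lambda>y. \<phi> (?\<psi> y)) g"
      using conj_by_comp[OF \<psi> \<phi> gB] by simp
    also have "\<dots> = g"
      using \<phi>D(4) by (intro conj_by_identity gB) (simp add: f_inv_into_f)
    finally show "g \<in> conj_by V W \<phi> ` stabilizer V \<K>"
      using f by (metis imageI)
  qed
qed

lemma lin_conjugate_stabilizer:
  assumes "lin_iso V W \<phi>" "\<And>K. K \<in> \<K> \<Longrightarrow> K \<subseteq> carrier V"
  shows "lin_conjugate V (stabilizer V \<K>) W (stabilizer W ((`) \<phi> ` \<K>))"
  using lin_conjugate_iff[OF stabilizer_subset_Bij stabilizer_subset_Bij]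
    conj_by_stabilizer[OF assms] assms(1) by blast

section \<open>Images, subspaces and invariant subspaces\<close>

lemma vectorspace_real_rules:
  assumes "vectorspace real_ring V"
  shows "\<zero>\<^bsub>V\<^esub> \<in> carrier V"
    and "x \<in> carrier V \<Longrightarrow> y \<in> carrier V \<Longrightarrow> x \<oplus>\<^bsub>V\<^esub> y \<in> carrier V"
    and "x \<in> carrier V \<Longrightarrow> c \<odot>\<^bsub>V\<^esub> x \<in> carrier V"
    and "x \<in> carrier V \<Longrightarrow> x \<oplus>\<^bsub>V\<^esub> \<zero>\<^bsub>V\<^esub> = x"
    and "x \<in> carrier V \<Longrightarrow> \<zero>\<^bsub>V\<^esub> \<oplus>\<^bsub>V\<^esub> x = x"
    and "x \<in> carrier V \<Longrightarrow> x \<oplus>\<^bsub>V\<^esub> (-1) \<odot>\<^bsub>V\<^esub> x = \<zero>\<^bsub>V\<^esub>"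
    and "x \<in> carrier V \<Longrightarrow> y \<in> carrier V \<Longrightarrow> x \<oplus>\<^bsub>V\<^esub> y = y \<oplus>\<^bsub>V\<^esub> x"
    and "x \<in> carrier V \<Longrightarrow> y \<in> carrier V \<Longrightarrow> z \<in> carrier V \<Longrightarrow>
           (x \<oplus>\<^bsub>V\<^esub> y) \<oplus>\<^bsub>V\<^esub> z = x \<oplus>\<^bsub>V\<^esub> (y \<oplus>\<^bsub>V\<^esub> z)"
    and "x \<in> carrier V \<Longrightarrow> (a * b) \<odot>\<^bsub>V\<^esub> x = a \<odot>\<^bsub>V\<^esub> (b \<odot>\<^bsub>V\<^esub> x)"
    and "x \<in> carrier V \<Longrightarrow> 1 \<odot>\<^bsub>V\<^esub> x = x"
    and "x \<in> carrier V \<Longrightarrow> (a + b) \<odot>\<^bsub>V\<^esub> x = a \<odot>\<^bsub>V\<^esub> x \<oplus>\<^bsub>V\<^esub> b \<odot>\<^bsub>V\<^esub> x"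
    and "x \<in> carrier V \<Longrightarrow> y \<in> carrier V \<Longrightarrow> a \<odot>\<^bsub>V\<^esub> (x \<oplus>\<^bsub>V\<^esub> y) = a \<odot>\<^bsub>V\<^esub> x \<oplus>\<^bsub>V\<^esub> a \<odot>\<^bsub>V\<^esub> y"
    and "c \<odot>\<^bsub>V\<^esub> \<zero>\<^bsub>V\<^esub> = \<zero>\<^bsub>V\<^esub>"
    and "x \<in> carrier V \<Longrightarrow> 0 \<odot>\<^bsub>V\<^esub> x = \<zero>\<^bsub>V\<^esub>"
proof -
  interpret V: vectorspace real_ring V by fact
  show one: "1 \<odot>\<^bsub>V\<^esub> x = x" if "x \<in> carrier V" for x using V.smult_one[of x] that by simp
  show distr: "(a + b) \<odot>\<^bsub>V\<^esub> x = a \<odot>\<^bsub>V\<^esub> x \<oplus>\<^bsub>V\<^esub> b \<odot>\<^bsub>V\<^esub> x" if "x \<in> carrier V" for a b x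
    using V.smult_l_distr[of a b x] that by simp
  show lz: "0 \<odot>\<^bsub>V\<^esub> x = \<zero>\<^bsub>V\<^esub>" if "x \<in> carrier V" for x using V.lmult_0[OF that] by simp
  show "x \<oplus>\<^bsub>V\<^esub> (-1) \<odot>\<^bsub>V\<^esub> x = \<zero>\<^bsub>V\<^esub>" if "x \<in> carrier V" for x
    using distr[of x 1 "-1"] that by (simp add: one lz)
  show "c \<odot>\<^bsub>V\<^esub> \<zero>\<^bsub>V\<^esub> = \<zero>\<^bsub>V\<^esub>" using V.rmult_0[of c] by simp
  show "(a * b) \<odot>\<^bsub>V\<^esub> x = a \<odot>\<^bsub>V\<^esub> (b \<odot>\<^bsub>V\<^esub> x)" if "x \<in> carrier V" for a b x
    using V.smult_assoc1[of a b x] that by simp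
  show "a \<odot>\<^bsub>V\<^esub> (x \<oplus>\<^bsub>V\<^esub> y) = a \<odot>\<^bsub>V\<^esub> x \<oplus>\<^bsub>V\<^esub> a \<odot>\<^bsub>V\<^esub> y" if "x \<in> carrier V" "y \<in> carrier V" for a x y
    using V.smult_r_distr[of a x y] that by simp
  show "x \<oplus>\<^bsub>V\<^esub> y = y \<oplus>\<^bsub>V\<^esub> x" if "x \<in> carrier V" "y \<in> carrier V" for x y
    using that by (rule V.M.a_comm)
  show "(x \<oplus>\<^bsub>V\<^esub> y) \<oplus>\<^bsub>V\<^esub> z = x \<oplus>\<^bsub>V\<^esub> (y \<oplus>\<^bsub>V\<^esub> z)"
    if "x \<in> carrier V" "y \<in> carrier V" "z \<in> carrier V" for x y z
    using that by (rule V.M.a_assoc)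
  show "c \<odot>\<^bsub>V\<^esub> x \<in> carrier V" if "x \<in> carrier V" for c x using V.smult_closed[of c x] that by simp
  show "\<zero>\<^bsub>V\<^esub> \<in> carrier V" by (rule V.M.zero_closed)
  show "x \<oplus>\<^bsub>V\<^esub> y \<in> carrier V" if "x \<in> carrier V" "y \<in> carrier V" for x y
    using that by (rule V.M.add.m_closed)
  show "x \<oplus>\<^bsub>V\<^esub> \<zero>\<^bsub>V\<^esub> = x" if "x \<in> carrier V" for x using that by (rule V.M.r_zero)
  show "\<zero>\<^bsub>V\<^esub> \<oplus>\<^bsub>V\<^esub> x = x" if "x \<in> carrier V" for x using that by (rule V.M.l_zero)
qed

text \<open>
  A surjection that respects the operations transfers the vector space axioms.  The map \<open>T\<close> is not
  yet known to be linear here, since that presupposes the conclusion; quotients and limits become vector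
  spaces in this way.
\<close>

lemma vectorspace_image:
  assumes V: "vectorspace real_ring V"
    and car: "carrier W = T ` carrier V" and zero: "\<zero>\<^bsub>W\<^esub> = T \<zero>\<^bsub>V\<^esub>"
    and add: "\<And>x y. x \<in> carrier V \<Longrightarrow> y \<in> carrier V \<Longrightarrow> T x \<oplus>\<^bsub>W\<^esub> T y = T (x \<oplus>\<^bsub>V\<^esub> y)"
    and smult: "\<And>c x. x \<in> carrier V \<Longrightarrow> c \<odot>\<^bsub>W\<^esub> T x = T (c \<odot>\<^bsub>V\<^esub> x)"
  shows "vectorspace real_ring W"
proof -
  note rules = vectorspace_real_rules[OF V]
  have neg: "\<exists>w\<in>carrier W. v \<oplus>\<^bsub>W\<^esub> w = \<zero>\<^bsub>W\<^esub>" if "v \<in> carrier W" for v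
  proof -
    from that obtain x where x: "x \<in> carrier V" "v = T x" by (auto simp: car)
    then have "v \<oplus>\<^bsub>W\<^esub> T ((-1) \<odot>\<^bsub>V\<^esub> x) = \<zero>\<^bsub>W\<^esub>" by (simp add: add zero rules)
    then show ?thesis using rules(3)[OF x(1)] by (auto simp: car)
  qed
  show ?thesis
  proof (rule vs_criteria)
    show "\<forall>v\<in>carrier W. \<exists>w\<in>carrier W. v \<oplus>\<^bsub>W\<^esub> w = \<zero>\<^bsub>W\<^esub>" using neg by blast
    show "\<forall>v w. v \<in> carrier W \<and> w \<in> carrier W \<longrightarrow> v \<oplus>\<^bsub>W\<^esub> w = w \<oplus>\<^bsub>W\<^esub> v"
      using rules(7) by (auto simp: car add)
  qed (auto simp: car zero add smult rules(1-6,8-) class_field.field_axioms)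
qed

lemma (in vectorspace) fin_dim_subspace:
  assumes fin_dim and W: "subspace K W V"
  shows "vectorspace.fin_dim K (vs W)"
proof -
  interpret W: vectorspace K "vs W" by (rule subspace_is_vs[OF W])
  have sub: "submodule K W V" using W by (rule is_module)
  have WV: "W \<subseteq> carrier V" using sub by (simp add: LinearCombinations.submodule_def)
  have li: "W.lin_dep A = lin_dep A" if "A \<subseteq> W" for A
    using span_li_not_depend(2)[OF that sub] .
  let ?P = "\<lambda>A. A \<subseteq> W \<and> lin_indpt A"
  have "\<exists>A. finite A \<and> maximal A ?P"
  proof (rule maximal_exists)
    show "finite A \<and> card A \<le> dim" if "?P A" for A
      using li_le_dim[OF \<open>fin_dim\<close>] that WV by auto
    show "?P {}" by (simp add: lin_dep_def)
  qed
  then obtain A where A: "finite A" "maximal A ?P" by blast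
  have "maximal A (\<lambda>S. S \<subseteq> carrier (vs W) \<and> W.lin_indpt S)"
    using A(2) li unfolding maximal_def by auto
  then have "W.gen_set A" by (rule W.max_li_is_gen)
  moreover have "A \<subseteq> carrier (vs W)" using A(2) by (simp add: maximal_def)
  ultimately show ?thesis using A(1) unfolding W.fin_dim_def by blast
qed

lemma surj_endomorphism_inj:
  assumes T: "linear_map real_ring V V T" and fd: "vectorspace.fin_dim real_ring V"
    and surj: "T ` carrier V = carrier V"
  shows "inj_on T (carrier V)"
proof -
  interpret T: linear_map real_ring V V T by fact
  interpret ker: vectorspace real_ring "V\<lparr>carrier := T.ker\<rparr>"
    by (rule T.V.subspace_is_vs[OF T.kerT_is_subspace])
  have "T.im = carrier V" using surj by (simp add: T.im_def)
  then have dim: "ker.dim = 0"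
    using T.rank_nullity[OF fd] by simp
  have "ker.fin_dim" by (rule T.V.fin_dim_subspace[OF fd T.kerT_is_subspace])
  then obtain B where B: "finite B" "ker.basis B" using ker.finite_basis_exists by blast
  then have "B = {}" using ker.dim_basis[OF B] dim by simp
  then have "carrier (V\<lparr>carrier := T.ker\<rparr>) = {\<zero>\<^bsub>V\<^esub>}"
    using B(2) ker.span_empty by (simp add: ker.basis_def)
  then show ?thesis by (rule T.Ke0_imp_inj)
qed

lemma subspace_real_iff:
  "VectorSpace.subspace real_ring K V \<longleftrightarrow> vectorspace real_ring V \<and> K \<subseteq> carrier V \<and> \<zero>\<^bsub>V\<^esub> \<in> K \<and>
     (\<forall>x\<in>K. \<forall>y\<in>K. x \<oplus>\<^bsub>V\<^esub> y \<in> K) \<and> (\<forall>c. \<forall>x\<in>K. c \<odot>\<^bsub>V\<^esub> x \<in> K)"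
  by (auto simp: VectorSpace.subspace_def LinearCombinations.submodule_def vectorspace_def)

definition invariant_subspaces :: "(real, 'v) module \<Rightarrow> ('v \<Rightarrow> 'v) set \<Rightarrow> 'v set set" where
  "invariant_subspaces V G = {K. VectorSpace.subspace real_ring K V \<and> (\<forall>f\<in>G. f ` K \<subseteq> K)}"

text \<open>
  The Galois connection between families of subspaces and groups: adding all invariant subspaces to
  the family does not shrink the stabiliser.
\<close>

lemma stabilizer_invariant_subspaces:
  assumes "\<And>K. K \<in> \<K> \<Longrightarrow> VectorSpace.subspace real_ring K V"
  shows "stabilizer V (invariant_subspaces V (stabilizer V \<K>)) = stabilizer V \<K>"
proof
  show "stabilizer V (invariant_subspaces V (stabilizer V \<K>)) \<subseteq> stabilizer V \<K>"
    using assms unfolding stabilizer_def invariant_subspaces_def by blast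
  show "stabilizer V \<K> \<subseteq> stabilizer V (invariant_subspaces V (stabilizer V \<K>))"
    by (auto simp: stabilizer_def[of V "invariant_subspaces _ _"] invariant_subspaces_def)
      (auto simp: stabilizer_def)
qed

lemma subspace_lin_iso_image:
  assumes \<phi>: "lin_iso V W \<phi>" and K: "VectorSpace.subspace real_ring K V"
  shows "VectorSpace.subspace real_ring (\<phi> ` K) W"
proof -
  note lin = linear_map_realD[OF lin_isoD(1)[OF \<phi>]]
  have K': "K \<subseteq> carrier V" "\<zero>\<^bsub>V\<^esub> \<in> K" "\<And>x y. x \<in> K \<Longrightarrow> y \<in> K \<Longrightarrow> x \<oplus>\<^bsub>V\<^esub> y \<in> K"
    "\<And>c x. x \<in> K \<Longrightarrow> c \<odot>\<^bsub>V\<^esub> x \<in> K"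
    using K by (auto simp: subspace_real_iff)
  show ?thesis
    unfolding subspace_real_iff
  proof (intro conjI ballI allI)
    show "\<phi> ` K \<subseteq> carrier W" using lin(3) K'(1) by auto
    show "\<zero>\<^bsub>W\<^esub> \<in> \<phi> ` K" using K'(2) lin(6) by (metis imageI)
    fix c x assume "x \<in> \<phi> ` K"
    then obtain u where u: "u \<in> K" "x = \<phi> u" by auto
    have "c \<odot>\<^bsub>W\<^esub> x = \<phi> (c \<odot>\<^bsub>V\<^esub> u)" 
      unfolding u(2) by (rule lin(5)[symmetric]) (use u K' in blast)
    then show "c \<odot>\<^bsub>W\<^esub> x \<in> \<phi> ` K" using K'(4) u(1) by blast
    fix y assume "y \<in> \<phi> ` K"
    then obtain v where v: "v \<in> K" "y = \<phi> v" by auto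
    have "x \<oplus>\<^bsub>W\<^esub> y = \<phi> (u \<oplus>\<^bsub>V\<^esub> v)" 
      unfolding u(2) v(2) by (rule lin(4)[symmetric]) (use u v K' in blast)+
    then show "x \<oplus>\<^bsub>W\<^esub> y \<in> \<phi> ` K" using K'(3) u(1) v(1) by blast
  qed (rule lin(2))
qed

lemma invariant_subspaces_lin_iso_subset:
  assumes \<phi>: "lin_iso V W \<phi>" and \<K>: "\<And>K. K \<in> \<K> \<Longrightarrow> K \<subseteq> carrier V"
    and K: "K \<in> invariant_subspaces V (stabilizer V \<K>)"
  shows "\<phi> ` K \<in> invariant_subspaces W (stabilizer W ((`) \<phi> ` \<K>))"
proof -
  have KV: "K \<subseteq> carrier V" using K by (auto simp: invariant_subspaces_def subspace_real_iff)
  have "g ` \<phi> ` K \<subseteq> \<phi> ` K" if "g \<in> stabilizer W ((`) \<phi> ` \<K>)" for g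
  proof -
    have "g \<in> conj_by V W \<phi> ` stabilizer V \<K>"
      using that conj_by_stabilizer[OF \<phi> \<K>] by simp
    then obtain f where f: "f \<in> stabilizer V \<K>" "g = conj_by V W \<phi> f" by blast
    have "g (\<phi> x) = \<phi> (f x)" if "x \<in> K" for x
      using conj_by_apply[OF lin_isoD(3,4)[OF \<phi>]] that KV f(2) by blast
    moreover have "f ` K \<subseteq> K" using K f(1) by (simp add: invariant_subspaces_def)
    ultimately show ?thesis by auto
  qed
  then show ?thesis
    using subspace_lin_iso_image[OF \<phi>] K by (simp add: invariant_subspaces_def)
qed

lemma invariant_subspaces_lin_iso:
  assumes \<phi>: "lin_iso V W \<phi>" and \<K>: "\<And>K. K \<in> \<K> \<Longrightarrow> K \<subseteq> carrier V"
  shows "invariant_subspaces W (stabilizer W ((`) \<phi> ` \<K>)) = (`) \<phi> ` invariant_subspaces V (stabilizer V \<K>)"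
proof
  show "(`) \<phi> ` invariant_subspaces V (stabilizer V \<K>) \<subseteq> invariant_subspaces W (stabilizer W ((`) \<phi> ` \<K>))"
    using invariant_subspaces_lin_iso_subset[OF assms] by blast
next
  let ?\<psi> = "inv_into (carrier V) \<phi>"
  note \<phi>D = lin_isoD[OF \<phi>]
  have "?\<psi> ` \<phi> ` K = K" if "K \<in> \<K>" for K
    using \<K>[OF that] \<phi>D(3) by simp
  then have pre: "(`) ?\<psi> ` (`) \<phi> ` \<K> = \<K>" by (force simp: image_iff)
  show "invariant_subspaces W (stabilizer W ((`) \<phi> ` \<K>)) \<subseteq> (`) \<phi> ` invariant_subspaces V (stabilizer V \<K>)"
  proof
    fix K assume K: "K \<in> invariant_subspaces W (stabilizer W ((`) \<phi> ` \<K>))"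
    have "?\<psi> ` K \<in> invariant_subspaces V (stabilizer V ((`) ?\<psi> ` (`) \<phi> ` \<K>))"
      using \<K> \<phi>D(4) by (intro invariant_subspaces_lin_iso_subset[OF lin_iso_inv[OF \<phi>] _ K]) blast
    moreover have "\<phi> ` ?\<psi> ` K = K"
      using K \<phi>D(4) by (intro image_inv_into_cancel) (auto simp: invariant_subspaces_def subspace_real_iff)
    ultimately show "K \<in> (`) \<phi> ` invariant_subspaces V (stabilizer V \<K>)"
      unfolding pre by (metis imageI)
  qed
qed

section \<open>Coordinate spaces\<close>

lemma coord_space_simps:
  "carrier (coord_space H) = H \<rightarrow>\<^sub>E UNIV"
  "\<zero>\<^bsub>coord_space H\<^esub> = (\<lambda>i\<in>H. 0)"
  "x \<oplus>\<^bsub>coord_space H\<^esub> y = (\<lambda>i\<in>H. x i + y i)"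
  "c \<odot>\<^bsub>coord_space H\<^esub> x = (\<lambda>i\<in>H. c * x i)"
  by (simp_all add: class_ring.func_space_def)

lemma vectorspace_coord_space: "vectorspace real_ring (coord_space H)"
  unfolding vectorspace_def by (intro conjI class_cring.func_space_is_module class_field.field_axioms)

lemma finsum_coord_space:
  assumes "finite A" "f \<in> A \<rightarrow> carrier (coord_space H)"
  shows "finsum (coord_space H) f A = (\<lambda>i\<in>H. \<Sum>j\<in>A. f j i)"
proof -
  interpret V: vectorspace real_ring "coord_space H" by (rule vectorspace_coord_space)
  from assms show ?thesis
  proof (induction A)
    case empty
    then show ?case by (simp add: coord_space_simps(2))
  next
    case (insert j A)
    then show ?case
      by (subst V.M.finsum_insert) (auto simp: coord_space_simps(3) fun_eq_iff)
  qed
qed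

definition unit_vector :: "nat set \<Rightarrow> nat \<Rightarrow> nat \<Rightarrow> real" where
  "unit_vector H j = (\<lambda>i\<in>H. if i = j then 1 else 0)"

lemma unit_vector_carrier: "unit_vector H j \<in> carrier (coord_space H)"
  by (simp add: unit_vector_def coord_space_simps)

lemma coord_space_expansion:
  assumes "finite H" "x \<in> carrier (coord_space H)"
  shows "x = finsum (coord_space H) (\<lambda>j. x j \<odot>\<^bsub>coord_space H\<^esub> unit_vector H j) H"
proof -
  have "finsum (coord_space H) (\<lambda>j. x j \<odot>\<^bsub>coord_space H\<^esub> unit_vector H j) H
      = (\<lambda>i\<in>H. \<Sum>j\<in>H. (x j \<odot>\<^bsub>coord_space H\<^esub> unit_vector H j) i)"
    by (rule finsum_coord_space) (auto simp: assms coord_space_simps)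
  also have "\<dots> = (\<lambda>i\<in>H. \<Sum>j\<in>H. if i = j then x j else 0)"
    by (auto simp: fun_eq_iff coord_space_simps unit_vector_def if_distrib intro!: sum.cong)
  also have "\<dots> = x"
    using assms by (auto simp: fun_eq_iff coord_space_simps PiE_def extensional_def)
  finally show ?thesis by simp
qed

lemma linear_map_matrix:
  assumes "finite H" "linear_map real_ring (coord_space H) (coord_space H) T" "x \<in> carrier (coord_space H)"
  shows "T x = (\<lambda>i\<in>H. \<Sum>j\<in>H. T (unit_vector H j) i * x j)"
proof -
  interpret V: vectorspace real_ring "coord_space H" by (rule vectorspace_coord_space)
  note lin = linear_map_realD[OF assms(2)]
  note uc = unit_vector_carrier[of H]
  have "T x = T (finsum (coord_space H) (\<lambda>j. x j \<odot>\<^bsub>coord_space H\<^esub> unit_vector H j) H)"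
    using coord_space_expansion[OF assms(1,3)] by simp
  also have "\<dots> = finsum (coord_space H) (\<lambda>j. x j \<odot>\<^bsub>coord_space H\<^esub> T (unit_vector H j)) H"
  proof -
    have gen: "T (finsum (coord_space H) (\<lambda>j. x j \<odot>\<^bsub>coord_space H\<^esub> unit_vector H j) A)
      = finsum (coord_space H) (\<lambda>j. x j \<odot>\<^bsub>coord_space H\<^esub> T (unit_vector H j)) A" if "finite A" for A
      using that
    proof (induction A)
      case (insert j A)
      then show ?case
        using uc lin by (subst (1 2) V.M.finsum_insert) auto
    qed (simp add: lin)
    show ?thesis by (rule gen[OF assms(1)])
  qed
  also have "\<dots> = (\<lambda>i\<in>H. \<Sum>j\<in>H. (x j \<odot>\<^bsub>coord_space H\<^esub> T (unit_vector H j)) i)"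
    using uc lin(3) by (intro finsum_coord_space assms(1)) auto
  also have "\<dots> = (\<lambda>i\<in>H. \<Sum>j\<in>H. T (unit_vector H j) i * x j)"
    by (auto simp: fun_eq_iff coord_space_simps mult.commute intro!: sum.cong)
  finally show ?thesis .
qed

lemma coord_space_basis:
  assumes "finite H"
  shows "vectorspace.basis real_ring (coord_space H) (unit_vector H ` H)" "inj_on (unit_vector H) H"
proof -
  interpret V: vectorspace real_ring "coord_space H" by (rule vectorspace_coord_space)
  let ?e = "unit_vector H"
  show inj: "inj_on ?e H"
  proof (rule inj_onI)
    fix i j assume "i \<in> H" "j \<in> H" "?e i = ?e j"
    then have "?e i i = ?e j i" by simp
    then show "i = j" using \<open>i \<in> H\<close> by (simp add: unit_vector_def split: if_splits)
  qed
  have lc: "V.lincomb a (?e ` H) = (\<lambda>i\<in>H. a (?e i))" for a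
  proof -
    have "V.lincomb a (?e ` H) = finsum (coord_space H) (\<lambda>j. a (?e j) \<odot>\<^bsub>coord_space H\<^esub> ?e j) H"
      unfolding V.lincomb_def using inj unit_vector_carrier
      by (intro V.M.add.finprod_reindex) auto
    also have "\<dots> = (\<lambda>i\<in>H. \<Sum>j\<in>H. (a (?e j) \<odot>\<^bsub>coord_space H\<^esub> ?e j) i)"
      using unit_vector_carrier by (intro finsum_coord_space assms) auto
    also have "\<dots> = (\<lambda>i\<in>H. \<Sum>j\<in>H. if i = j then a (?e j) else 0)"
      by (auto simp: fun_eq_iff coord_space_simps unit_vector_def if_distrib intro!: sum.cong)
    also have "\<dots> = (\<lambda>i\<in>H. a (?e i))" using assms by (auto simp: fun_eq_iff)
    finally show ?thesis .
  qed
  show "V.basis (?e ` H)"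
  proof (subst V.basis_criterion, goal_cases)
    case 3
    show ?case
    proof (intro allI impI ex1I conjI)
      fix v assume v: "v \<in> carrier (coord_space H)"
      let ?a = "\<lambda>w\<in>?e ` H. v (inv_into H ?e w)"
      show "?a \<in> ?e ` H \<rightarrow>\<^sub>E carrier real_ring" by simp
      show "V.lincomb ?a (?e ` H) = v"
        using v inj by (auto simp: lc fun_eq_iff coord_space_simps PiE_def extensional_def)
      fix a assume a: "a \<in> ?e ` H \<rightarrow>\<^sub>E carrier real_ring \<and> V.lincomb a (?e ` H) = v"
      show "a = ?a"
      proof
        fix w show "a w = ?a w"
          using a inj unfolding lc by (auto simp: PiE_def extensional_def)
      qed
    qed
  qed (use assms unit_vector_carrier in auto)
qed

lemma fin_dim_coord_space:
  assumes "finite H"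
  shows "vectorspace.fin_dim real_ring (coord_space H)" "vectorspace.dim real_ring (coord_space H) = card H"
proof -
  interpret V: vectorspace real_ring "coord_space H" by (rule vectorspace_coord_space)
  note B = coord_space_basis[OF assms]
  show "V.fin_dim"
    unfolding V.fin_dim_def using B(1) assms by (intro exI[of _ "unit_vector H ` H"]) (simp add: V.basis_def)
  show "V.dim = card H" using V.dim_basis[OF _ B(1)] assms card_image[OF B(2)] by simp
qed

lemma lin_iso_coord_space_card_eq:
  assumes "finite H" "finite H'" "lin_iso (coord_space H) (coord_space H') \<phi>"
  shows "card H = card H'"
proof -
  interpret linear_map real_ring "coord_space H" "coord_space H'" \<phi>
    by (rule lin_isoD[OF assms(3)])
  show ?thesis
    using dim_eq[OF fin_dim_coord_space(1)[OF assms(1)] lin_isoD(3,4)[OF assms(3)]]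
      fin_dim_coord_space(2) assms(1,2) by simp
qed

text \<open>
  Coordinate subspaces.  Only \<open>S \<subseteq> H\<close> is meaningful: outside \<open>H\<close> the vectors take the value
  \<^const>\<open>undefined\<close>.
\<close>

definition vanishing :: "nat set \<Rightarrow> nat set \<Rightarrow> (nat \<Rightarrow> real) set" where
  "vanishing H S = {x \<in> carrier (coord_space H). \<forall>i\<in>S. x i = 0}"

text \<open>
  Since the unit vector \<open>e\<^sub>j\<close> lies in \<open>vanishing H S\<close> exactly for \<open>j \<notin> S\<close>, preserving this subspace
  means that the matrix entries with row in \<open>S\<close> and column outside \<open>S\<close> are zero.
\<close>

lemma stabilizer_vanishing:
  assumes "finite H" "\<Union>\<S> \<subseteq> H"
  shows "stabilizer (coord_space H) (vanishing H ` \<S>) =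
    {f \<in> extensional (carrier (coord_space H)). lin_iso (coord_space H) (coord_space H) f \<and>
       (\<exists>a :: nat \<Rightarrow> nat \<Rightarrow> real.
          (\<forall>x\<in>carrier (coord_space H). f x = (\<lambda>i\<in>H. \<Sum>j\<in>H. a i j * x j)) \<and>
          (\<forall>i\<in>H. \<forall>j\<in>H. (\<exists>S\<in>\<S>. i \<in> S \<and> j \<notin> S) \<longrightarrow> a i j = 0))}"
    (is "_ = ?R")
proof
  show "stabilizer (coord_space H) (vanishing H ` \<S>) \<subseteq> ?R"
  proof
    fix f assume f: "f \<in> stabilizer (coord_space H) (vanishing H ` \<S>)"
    then have lin: "linear_map real_ring (coord_space H) (coord_space H) f"
      by (auto simp: stabilizer_def lin_iso_def)
    have "f (unit_vector H j) i = 0" if "i \<in> H" "j \<in> H" "S \<in> \<S>" "i \<in> S" "j \<notin> S" for i j S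
    proof -
      have "unit_vector H j \<in> vanishing H S"
        using that assms(2) by (auto simp: vanishing_def unit_vector_carrier) (auto simp: unit_vector_def)
      then have "f (unit_vector H j) \<in> vanishing H S" using f that(3) by (auto simp: stabilizer_def)
      then show ?thesis using that(4) by (simp add: vanishing_def)
    qed
    then have zero: "\<forall>i\<in>H. \<forall>j\<in>H. (\<exists>S\<in>\<S>. i \<in> S \<and> j \<notin> S) \<longrightarrow> f (unit_vector H j) i = 0" by blast
    have "\<exists>a :: nat \<Rightarrow> nat \<Rightarrow> real.
          (\<forall>x\<in>carrier (coord_space H). f x = (\<lambda>i\<in>H. \<Sum>j\<in>H. a i j * x j)) \<and>
          (\<forall>i\<in>H. \<forall>j\<in>H. (\<exists>S\<in>\<S>. i \<in> S \<and> j \<notin> S) \<longrightarrow> a i j = 0)"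
      by (rule exI[of _ "\<lambda>i j. f (unit_vector H j) i"], rule conjI[OF _ zero], rule ballI)
        (rule linear_map_matrix[OF assms(1) lin])
    moreover have "f \<in> extensional (carrier (coord_space H))" "lin_iso (coord_space H) (coord_space H) f"
      using f by (simp_all add: stabilizer_def)
    ultimately show "f \<in> ?R" by (intro CollectI conjI)
  qed
next
  show "?R \<subseteq> stabilizer (coord_space H) (vanishing H ` \<S>)"
  proof
    fix f assume f: "f \<in> ?R"
    then obtain a :: "nat \<Rightarrow> nat \<Rightarrow> real" where
      a1: "\<forall>x\<in>carrier (coord_space H). f x = (\<lambda>i\<in>H. \<Sum>j\<in>H. a i j * x j)" and
      a2: "\<forall>i\<in>H. \<forall>j\<in>H. (\<exists>S\<in>\<S>. i \<in> S \<and> j \<notin> S) \<longrightarrow> a i j = 0"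
      by (elim CollectE conjE exE)
    have "f x \<in> vanishing H S" if "S \<in> \<S>" "x \<in> vanishing H S" for S x
    proof -
      have x: "x \<in> carrier (coord_space H)" "\<And>i. i \<in> S \<Longrightarrow> x i = 0"
        using that(2) by (auto simp: vanishing_def)
      have "(\<Sum>j\<in>H. a i j * x j) = 0" if "i \<in> S" for i
      proof (rule sum.neutral, rule ballI)
        fix j assume j: "j \<in> H"
        show "a i j * x j = 0"
          using a2 x(2)[of j] j that \<open>S \<in> \<S>\<close> assms(2) by (cases "j \<in> S") auto
      qed
      then show ?thesis using assms(2) that(1) x(1) by (auto simp: vanishing_def a1 coord_space_simps)
    qed
    then show "f \<in> stabilizer (coord_space H) (vanishing H ` \<S>)"
      using f unfolding stabilizer_def by blast
  qed
qed

text \<open>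
  Doubling a single coordinate preserves all coordinate subspaces, so a subspace invariant under
  their stabiliser contains the \<open>i\<close>-th component of each of its vectors.
\<close>

lemma invariant_subspace_vanishing:
  assumes H: "finite H" "\<Union>\<S> \<subseteq> H"
    and K: "K \<in> invariant_subspaces (coord_space H) (stabilizer (coord_space H) (vanishing H ` \<S>))"
  shows "\<exists>S\<subseteq>H. K = vanishing H S"
proof (intro exI conjI)
  interpret V: vectorspace real_ring "coord_space H" by (rule vectorspace_coord_space)
  let ?V = "coord_space H"
  let ?S = "{i \<in> H. \<forall>x\<in>K. x i = 0}"
  have Kc: "K \<subseteq> carrier ?V" and K0: "\<zero>\<^bsub>?V\<^esub> \<in> K"
    and Kadd: "\<And>x y. x \<in> K \<Longrightarrow> y \<in> K \<Longrightarrow> x \<oplus>\<^bsub>?V\<^esub> y \<in> K"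
    and Ks: "\<And>c x. x \<in> K \<Longrightarrow> c \<odot>\<^bsub>?V\<^esub> x \<in> K"
    and Kinv: "\<And>f. f \<in> stabilizer ?V (vanishing H ` \<S>) \<Longrightarrow> f ` K \<subseteq> K"
    using K by (auto simp: invariant_subspaces_def subspace_real_iff)
  show "?S \<subseteq> H" by auto
  have unit: "unit_vector H i \<in> K" if i: "i \<in> H" and y: "y \<in> K" "y i \<noteq> 0" for i y
  proof -
    let ?f = "\<lambda>x\<in>carrier ?V. \<lambda>k\<in>H. if k = i then 2 * x k else x k"
    have "?f \<in> stabilizer ?V (vanishing H ` \<S>)"
    proof -
      have "linear_map real_ring ?V ?V ?f"
        by (rule linear_map_realI)
          (auto simp: vectorspace_coord_space coord_space_simps fun_eq_iff algebra_simps)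
      moreover have "inj_on ?f (carrier ?V)"
      proof (rule inj_onI)
        fix x y assume xy: "x \<in> carrier ?V" "y \<in> carrier ?V" "?f x = ?f y"
        show "x = y"
        proof
          fix k show "x k = y k"
            using xy(1,2) fun_cong[OF xy(3), of k]
            by (cases "k \<in> H") (auto simp: coord_space_simps PiE_def extensional_def split: if_splits)
        qed
      qed
      moreover have "?f ` carrier ?V = carrier ?V"
      proof
        show "carrier ?V \<subseteq> ?f ` carrier ?V"
        proof
          fix x assume x: "x \<in> carrier ?V"
          have "?f (\<lambda>k\<in>H. if k = i then x k / 2 else x k) = x"
            using x by (auto simp: coord_space_simps fun_eq_iff PiE_def extensional_def)
          moreover have "(\<lambda>k\<in>H. if k = i then x k / 2 else x k) \<in> carrier ?V"
            by (simp add: coord_space_simps)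
          ultimately show "x \<in> ?f ` carrier ?V" by (rule image_eqI[OF sym])
        qed
      qed (auto simp: coord_space_simps)
      moreover have "?f ` vanishing H S \<subseteq> vanishing H S" if "S \<in> \<S>" for S
      proof -
        have "S \<subseteq> H" using that H(2) by blast
        then show ?thesis by (auto simp: vanishing_def coord_space_simps)
      qed
      ultimately show ?thesis by (auto simp: stabilizer_def intro!: lin_isoI)
    qed
    then have fy: "?f y \<in> K" using Kinv y(1) by blast
    \<comment> \<open>doubling the coordinate \<open>i\<close> changes \<open>y\<close> by \<open>y\<^sub>i e\<^sub>i\<close>\<close>
    have "unit_vector H i = (1 / y i) \<odot>\<^bsub>?V\<^esub> (?f y \<oplus>\<^bsub>?V\<^esub> (-1) \<odot>\<^bsub>?V\<^esub> y)"
      using y(2) subsetD[OF Kc y(1)] by (auto simp: fun_eq_iff unit_vector_def coord_space_simps)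
    then show ?thesis by (simp only:) (intro Ks Kadd fy y(1))
  qed
  show "K = vanishing H ?S"
  proof
    show "K \<subseteq> vanishing H ?S" using Kc by (auto simp: vanishing_def)
    show "vanishing H ?S \<subseteq> K"
    proof
      fix x assume x: "x \<in> vanishing H ?S"
      have xc: "x \<in> carrier ?V" using x by (simp add: vanishing_def)
      have component: "x j \<odot>\<^bsub>?V\<^esub> unit_vector H j \<in> K" if j: "j \<in> H" for j
      proof (cases "x j = 0")
        case True
        then show ?thesis using K0 by (simp add: coord_space_simps)
      next
        case False
        then obtain y where "y \<in> K" "y j \<noteq> 0" using x j by (auto simp: vanishing_def)
        then show ?thesis using unit[OF j] Ks by blast
      qed
      have "finsum ?V (\<lambda>j. x j \<odot>\<^bsub>?V\<^esub> unit_vector H j) A \<in> K" if "finite A" "A \<subseteq> H" for A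
        using that
      proof (induction A)
        case (insert j A)
        then show ?case
          using component Kc Kadd unit_vector_carrier by (subst V.M.finsum_insert) auto
      qed (simp add: K0)
      from this[OF H(1) subset_refl] show "x \<in> K"
        using coord_space_expansion[OF H(1) xc] by simp
    qed
  qed
qed

section \<open>Projective limits\<close>

text \<open>
  The kernel of the projection \<open>\<xi>\<^sub>\<alpha>\<close>, written out because \<open>mod_hom.ker\<close> unfolds only under the
  assumption that the map is a homomorphism.
\<close>

definition limit_kernel :: "('i, 'v) proj_system \<Rightarrow> 'i \<Rightarrow> ('i \<Rightarrow> 'v) set" where
  "limit_kernel X \<alpha> = {x \<in> carrier (proj_limit X). x \<alpha> = \<zero>\<^bsub>ps_space X \<alpha>\<^esub>}"

lemma proj_limit_simps:
  "\<zero>\<^bsub>proj_limit X\<^esub> = (\<lambda>\<alpha>\<in>ps_idx X. \<zero>\<^bsub>ps_space X \<alpha>\<^esub>)"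
  "x \<oplus>\<^bsub>proj_limit X\<^esub> y = (\<lambda>\<alpha>\<in>ps_idx X. x \<alpha> \<oplus>\<^bsub>ps_space X \<alpha>\<^esub> y \<alpha>)"
  "c \<odot>\<^bsub>proj_limit X\<^esub> x = (\<lambda>\<alpha>\<in>ps_idx X. c \<odot>\<^bsub>ps_space X \<alpha>\<^esub> x \<alpha>)"
  by (simp_all add: proj_limit_def)

lemma proj_limit_carrier:
  "x \<in> carrier (proj_limit X) \<longleftrightarrow>
    x \<in> extensional (ps_idx X) \<and> (\<forall>\<alpha>\<in>ps_idx X. x \<alpha> \<in> carrier (ps_space X \<alpha>)) \<and>
    (\<forall>(\<alpha>, \<beta>)\<in>ps_le X. ps_bond X \<alpha> \<beta> (x \<beta>) = x \<alpha>)"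
  by (auto simp: proj_limit_def PiE_def)

lemma proj_limit_eqI:
  assumes "x \<in> extensional (ps_idx X)" "y \<in> extensional (ps_idx X)"
    and "\<And>\<alpha>. \<alpha> \<in> ps_idx X \<Longrightarrow> x \<alpha> = y \<alpha>"
  shows "x = y"
  using assms by (rule extensionalityI)

text \<open>
  The definition of a projective system makes the limit a vector space only through its
  projections, hence not for an empty index set; so this is proved from the components.
\<close>

lemma vectorspace_proj_limit:
  assumes vs: "\<And>\<alpha>. \<alpha> \<in> ps_idx X \<Longrightarrow> vectorspace real_ring (ps_space X \<alpha>)"
    and le: "ps_le X \<subseteq> ps_idx X \<times> ps_idx X"
    and bond: "\<And>\<alpha> \<beta>. (\<alpha>, \<beta>) \<in> ps_le X \<Longrightarrow>
                 linear_map real_ring (ps_space X \<beta>) (ps_space X \<alpha>) (ps_bond X \<alpha> \<beta>)"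
  shows "vectorspace real_ring (proj_limit X)"
proof -
  let ?L = "proj_limit X"
  note r = vectorspace_real_rules[OF vs]
  have idx: "\<alpha> \<in> ps_idx X" "\<beta> \<in> ps_idx X" if "(\<alpha>, \<beta>) \<in> ps_le X" for \<alpha> \<beta> using that le by auto
  have coordinate: "x \<alpha> \<in> carrier (ps_space X \<alpha>)" if "x \<in> carrier ?L" "\<alpha> \<in> ps_idx X" for x \<alpha>
    using that by (simp add: proj_limit_carrier)
  have compatible: "ps_bond X \<alpha> \<beta> (x \<beta>) = x \<alpha>" if "x \<in> carrier ?L" "(\<alpha>, \<beta>) \<in> ps_le X" for x \<alpha> \<beta>
    using that by (auto simp: proj_limit_carrier)
  have ext: "x \<in> extensional (ps_idx X)" if "x \<in> carrier ?L" for x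
    using that by (simp add: proj_limit_carrier)
  have zero: "\<zero>\<^bsub>?L\<^esub> \<in> carrier ?L"
    unfolding proj_limit_carrier proj_limit_simps
    using r(1) linear_map_realD(6)[OF bond] idx by (auto intro!: restrict_extensional)
  have add: "x \<oplus>\<^bsub>?L\<^esub> y \<in> carrier ?L" if "x \<in> carrier ?L" "y \<in> carrier ?L" for x y
  proof -
    have "ps_bond X \<alpha> \<beta> (x \<beta> \<oplus>\<^bsub>ps_space X \<beta>\<^esub> y \<beta>) = x \<alpha> \<oplus>\<^bsub>ps_space X \<alpha>\<^esub> y \<alpha>" if le: "(\<alpha>, \<beta>) \<in> ps_le X" for \<alpha> \<beta>
      using linear_map_realD(4)[OF bond[OF le] coordinate coordinate] compatible le idx[OF le]
        \<open>x \<in> carrier ?L\<close> \<open>y \<in> carrier ?L\<close> by simp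
    then show ?thesis
      unfolding proj_limit_simps unfolding proj_limit_carrier
      using r(2) coordinate that idx by (auto intro!: restrict_extensional)
  qed
  have smult: "c \<odot>\<^bsub>?L\<^esub> x \<in> carrier ?L" if "x \<in> carrier ?L" for c x
  proof -
    have "ps_bond X \<alpha> \<beta> (c \<odot>\<^bsub>ps_space X \<beta>\<^esub> x \<beta>) = c \<odot>\<^bsub>ps_space X \<alpha>\<^esub> x \<alpha>" if le: "(\<alpha>, \<beta>) \<in> ps_le X" for \<alpha> \<beta>
      using linear_map_realD(5)[OF bond[OF le] coordinate] compatible le idx[OF le]
        \<open>x \<in> carrier ?L\<close> by simp
    then show ?thesis
      unfolding proj_limit_simps unfolding proj_limit_carrier
      using r(3) coordinate that idx by (auto intro!: restrict_extensional)
  qed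
  show ?thesis
  proof (rule vs_criteria)
    show "\<forall>v\<in>carrier ?L. \<exists>w\<in>carrier ?L. v \<oplus>\<^bsub>?L\<^esub> w = \<zero>\<^bsub>?L\<^esub>"
    proof
      fix v assume v: "v \<in> carrier ?L"
      have "v \<oplus>\<^bsub>?L\<^esub> (-1) \<odot>\<^bsub>?L\<^esub> v = \<zero>\<^bsub>?L\<^esub>"
        unfolding proj_limit_simps using r(6) coordinate[OF v] by (intro restrict_ext) simp
      then show "\<exists>w\<in>carrier ?L. v \<oplus>\<^bsub>?L\<^esub> w = \<zero>\<^bsub>?L\<^esub>" using smult[OF v] by blast
    qed
    show "\<forall>v w. v \<in> carrier ?L \<and> w \<in> carrier ?L \<longrightarrow> v \<oplus>\<^bsub>?L\<^esub> w = w \<oplus>\<^bsub>?L\<^esub> v"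
      unfolding proj_limit_simps using r(7) coordinate by (intro allI impI restrict_ext) blast
    show "\<forall>v w x. v \<in> carrier ?L \<and> w \<in> carrier ?L \<and> x \<in> carrier ?L \<longrightarrow>
            (v \<oplus>\<^bsub>?L\<^esub> w) \<oplus>\<^bsub>?L\<^esub> x = v \<oplus>\<^bsub>?L\<^esub> (w \<oplus>\<^bsub>?L\<^esub> x)"
      unfolding proj_limit_simps using r(8) coordinate by (intro allI impI restrict_ext) simp
    show "\<forall>v\<in>carrier ?L. v \<oplus>\<^bsub>?L\<^esub> \<zero>\<^bsub>?L\<^esub> = v"
      unfolding proj_limit_simps using r(4) coordinate ext
      by (intro ballI proj_limit_eqI[of _ X]) auto
    show "\<forall>a b v. a \<in> carrier real_ring \<and> b \<in> carrier real_ring \<and> v \<in> carrier ?L \<longrightarrow>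
            (a \<otimes>\<^bsub>real_ring\<^esub> b) \<odot>\<^bsub>?L\<^esub> v = a \<odot>\<^bsub>?L\<^esub> (b \<odot>\<^bsub>?L\<^esub> v)"
      unfolding proj_limit_simps using r(9) coordinate by (intro allI impI restrict_ext) simp
    show "\<forall>v\<in>carrier ?L. \<one>\<^bsub>real_ring\<^esub> \<odot>\<^bsub>?L\<^esub> v = v"
      unfolding proj_limit_simps using r(10) coordinate ext
      by (intro ballI proj_limit_eqI[of _ X]) auto
    show "\<forall>a b v. a \<in> carrier real_ring \<and> b \<in> carrier real_ring \<and> v \<in> carrier ?L \<longrightarrow>
            (a \<oplus>\<^bsub>real_ring\<^esub> b) \<odot>\<^bsub>?L\<^esub> v = a \<odot>\<^bsub>?L\<^esub> v \<oplus>\<^bsub>?L\<^esub> b \<odot>\<^bsub>?L\<^esub> v"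
      unfolding proj_limit_simps using r(11) coordinate by (intro allI impI restrict_ext) simp
    show "\<forall>a v w. a \<in> carrier real_ring \<and> v \<in> carrier ?L \<and> w \<in> carrier ?L \<longrightarrow>
            a \<odot>\<^bsub>?L\<^esub> (v \<oplus>\<^bsub>?L\<^esub> w) = a \<odot>\<^bsub>?L\<^esub> v \<oplus>\<^bsub>?L\<^esub> a \<odot>\<^bsub>?L\<^esub> w"
      unfolding proj_limit_simps using r(12) coordinate by (intro allI impI restrict_ext) simp
  qed (use zero add smult class_field.field_axioms in blast)+
qed

lemma is_proj_systemD:
  assumes "is_proj_system X"
  shows "partial_order_on (ps_idx X) (ps_le X)"
    and "\<alpha> \<in> ps_idx X \<Longrightarrow> vectorspace real_ring (ps_space X \<alpha>)"
    and "\<alpha> \<in> ps_idx X \<Longrightarrow> vectorspace.fin_dim real_ring (ps_space X \<alpha>)"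
    and "(\<alpha>, \<beta>) \<in> ps_le X \<Longrightarrow> linear_map real_ring (ps_space X \<beta>) (ps_space X \<alpha>) (ps_bond X \<alpha> \<beta>)"
    and "vectorspace.fin_dim real_ring (proj_limit X)"
    and "\<alpha> \<in> ps_idx X \<Longrightarrow> linear_map real_ring (proj_limit X) (ps_space X \<alpha>) (ps_proj \<alpha>)"
    and "\<alpha> \<in> ps_idx X \<Longrightarrow> ps_proj \<alpha> ` carrier (proj_limit X) = carrier (ps_space X \<alpha>)"
    and "ps_le X \<subseteq> ps_idx X \<times> ps_idx X"
    and "vectorspace real_ring (proj_limit X)"
proof -
  note X = assms[unfolded is_proj_system_def lin_epi_def]
  show po: "partial_order_on (ps_idx X) (ps_le X)" using X by (elim conjE)
  have spaces: "\<forall>\<alpha>\<in>ps_idx X. vectorspace real_ring (ps_space X \<alpha>) \<and> vectorspace.fin_dim real_ring (ps_space X \<alpha>)"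
    using X by (elim conjE)
  show vs: "vectorspace real_ring (ps_space X \<alpha>)" "vectorspace.fin_dim real_ring (ps_space X \<alpha>)" if "\<alpha> \<in> ps_idx X" for \<alpha>
    using bspec[OF spaces that] by simp_all
  have bonds: "\<forall>(\<alpha>, \<beta>)\<in>ps_le X. linear_map real_ring (ps_space X \<beta>) (ps_space X \<alpha>) (ps_bond X \<alpha> \<beta>) \<and>
      ps_bond X \<alpha> \<beta> ` carrier (ps_space X \<beta>) = carrier (ps_space X \<alpha>)"
    using X by (elim conjE)
  show bond: "linear_map real_ring (ps_space X \<beta>) (ps_space X \<alpha>) (ps_bond X \<alpha> \<beta>)" if "(\<alpha>, \<beta>) \<in> ps_le X" for \<alpha> \<beta>
    using bspec[OF bonds that] by simp
  show "vectorspace.fin_dim real_ring (proj_limit X)" using X by (elim conjE)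
  have projs: "\<forall>\<alpha>\<in>ps_idx X. linear_map real_ring (proj_limit X) (ps_space X \<alpha>) (ps_proj \<alpha>) \<and>
      ps_proj \<alpha> ` carrier (proj_limit X) = carrier (ps_space X \<alpha>)"
    using X by (elim conjE)
  show "linear_map real_ring (proj_limit X) (ps_space X \<alpha>) (ps_proj \<alpha>)"
    "ps_proj \<alpha> ` carrier (proj_limit X) = carrier (ps_space X \<alpha>)" if "\<alpha> \<in> ps_idx X" for \<alpha>
    using bspec[OF projs that] by simp_all
  show le: "ps_le X \<subseteq> ps_idx X \<times> ps_idx X" using partial_order_onD(4)[OF po] .
  show "vectorspace real_ring (proj_limit X)" by (rule vectorspace_proj_limit[OF vs(1) le bond])
qed

lemma ker_ps_proj:
  assumes "is_proj_system X" "\<alpha> \<in> ps_idx X"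
  shows "mod_hom.ker (proj_limit X) (ps_space X \<alpha>) (ps_proj \<alpha>) = limit_kernel X \<alpha>"
proof -
  interpret linear_map real_ring "proj_limit X" "ps_space X \<alpha>" "ps_proj \<alpha>"
    by (rule is_proj_systemD(6)[OF assms])
  show ?thesis by (auto simp: ker_def limit_kernel_def ps_proj_def)
qed

lemma subspace_limit_kernel:
  assumes "is_proj_system X" "\<alpha> \<in> ps_idx X"
  shows "VectorSpace.subspace real_ring (limit_kernel X \<alpha>) (proj_limit X)"
proof -
  interpret linear_map real_ring "proj_limit X" "ps_space X \<alpha>" "ps_proj \<alpha>"
    by (rule is_proj_systemD(6)[OF assms])
  show ?thesis using kerT_is_subspace ker_ps_proj[OF assms] by simp
qed

text \<open>
  An automorphism of the limit that preserves the kernel of \<open>\<xi>\<^sub>\<alpha>\<close> descends to a surjective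
  endomorphism of \<open>L\<^sub>\<alpha>\<close>, which is bijective because \<open>L\<^sub>\<alpha>\<close> has finite dimension.
\<close>

lemma GL_ps_eq_stabilizer:
  assumes X: "is_proj_system X"
  shows "GL_ps X = stabilizer (proj_limit X) (limit_kernel X ` ps_idx X)"
proof
  note XD = is_proj_systemD[OF X]
  show "GL_ps X \<subseteq> stabilizer (proj_limit X) (limit_kernel X ` ps_idx X)"
  proof
    fix f assume f: "f \<in> GL_ps X"
    then obtain h where h: "\<forall>\<alpha>\<in>ps_idx X. lin_iso (ps_space X \<alpha>) (ps_space X \<alpha>) (h \<alpha>)"
      "\<forall>x\<in>carrier (proj_limit X). f x = (\<lambda>\<alpha>\<in>ps_idx X. h \<alpha> (x \<alpha>))"
      unfolding GL_ps_def by blast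
    have fiso: "lin_iso (proj_limit X) (proj_limit X) f"
      and fext: "f \<in> extensional (carrier (proj_limit X))"
      using f by (simp_all add: GL_ps_def)
    have "f x \<in> limit_kernel X \<alpha>" if "\<alpha> \<in> ps_idx X" "x \<in> limit_kernel X \<alpha>" for \<alpha> x
    proof -
      have x: "x \<in> carrier (proj_limit X)" "x \<alpha> = \<zero>\<^bsub>ps_space X \<alpha>\<^esub>" using that(2) by (auto simp: limit_kernel_def)
      have "f x \<in> carrier (proj_limit X)" using linear_map_realD(3)[OF lin_isoD(1)[OF fiso] x(1)] .
      moreover have "h \<alpha> \<zero>\<^bsub>ps_space X \<alpha>\<^esub> = \<zero>\<^bsub>ps_space X \<alpha>\<^esub>"
        using h(1) that(1) by (intro linear_map_realD(6)[OF lin_isoD(1)]) blast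
      ultimately show ?thesis using h(2) x that(1) by (simp add: limit_kernel_def)
    qed
    then show "f \<in> stabilizer (proj_limit X) (limit_kernel X ` ps_idx X)"
      using fiso fext unfolding stabilizer_def by blast
  qed
  show "stabilizer (proj_limit X) (limit_kernel X ` ps_idx X) \<subseteq> GL_ps X"
  proof
    fix f assume f: "f \<in> stabilizer (proj_limit X) (limit_kernel X ` ps_idx X)"
    let ?L = "proj_limit X"
    have fiso: "lin_iso ?L ?L f" and fext: "f \<in> extensional (carrier ?L)"
      using f by (simp_all add: stabilizer_def)
    note lin = linear_map_realD[OF lin_isoD(1)[OF fiso]]
    note L = vectorspace_real_rules[OF XD(9)]
    \<comment> \<open>the induced endomorphism \<open>h \<alpha>\<close>: lift a vector of \<open>L\<^sub>\<alpha>\<close> to the limit, apply \<open>f\<close>, project\<close>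
    define lift where "lift \<alpha> u = (SOME x. x \<in> carrier ?L \<and> x \<alpha> = u)" for \<alpha> u
    have lift: "lift \<alpha> u \<in> carrier ?L" "lift \<alpha> u \<alpha> = u" if "\<alpha> \<in> ps_idx X" "u \<in> carrier (ps_space X \<alpha>)" for \<alpha> u
    proof -
      have "\<exists>x. x \<in> carrier ?L \<and> x \<alpha> = u" using XD(7)[OF that(1)] that(2) by (force simp: ps_proj_def)
      then show "lift \<alpha> u \<in> carrier ?L" "lift \<alpha> u \<alpha> = u"
        unfolding lift_def by (metis (mono_tags, lifting) someI_ex)+
    qed
    have coordinate: "x \<alpha> \<in> carrier (ps_space X \<alpha>)" if "x \<in> carrier ?L" "\<alpha> \<in> ps_idx X" for x \<alpha>
      using that by (simp add: proj_limit_carrier)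
    have cong: "f x \<alpha> = f y \<alpha>"
      if \<alpha>: "\<alpha> \<in> ps_idx X" and x: "x \<in> carrier ?L" and y: "y \<in> carrier ?L" and xy: "x \<alpha> = y \<alpha>" for \<alpha> x y
    proof -
      note r = vectorspace_real_rules[OF XD(2)[OF \<alpha>]]
      define d where "d = x \<oplus>\<^bsub>?L\<^esub> (-1) \<odot>\<^bsub>?L\<^esub> y"
      have d: "d \<in> carrier ?L" using L x y by (simp add: d_def)
      have "d \<alpha> = \<zero>\<^bsub>ps_space X \<alpha>\<^esub>" using \<alpha> xy r(6)[OF coordinate[OF y \<alpha>]] by (simp add: d_def proj_limit_simps)
      then have "d \<in> limit_kernel X \<alpha>" using d by (simp add: limit_kernel_def)
      then have "f d \<in> limit_kernel X \<alpha>" using f \<alpha> by (auto simp: stabilizer_def)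
      then have fd: "f d \<alpha> = \<zero>\<^bsub>ps_space X \<alpha>\<^esub>" by (simp add: limit_kernel_def)
      have "x = y \<oplus>\<^bsub>?L\<^esub> d"
      proof -
        have "y \<oplus>\<^bsub>?L\<^esub> d = d \<oplus>\<^bsub>?L\<^esub> y" using L(7) y d by blast
        also have "\<dots> = x \<oplus>\<^bsub>?L\<^esub> ((-1) \<odot>\<^bsub>?L\<^esub> y \<oplus>\<^bsub>?L\<^esub> y)" unfolding d_def using L x y by simp
        also have "(-1) \<odot>\<^bsub>?L\<^esub> y \<oplus>\<^bsub>?L\<^esub> y = \<zero>\<^bsub>?L\<^esub>" using L(6)[OF y] L(7)[OF y L(3)[OF y]] by simp
        finally show ?thesis using L(4)[OF x] by simp
      qed
      then have "f x \<alpha> = (f y \<oplus>\<^bsub>?L\<^esub> f d) \<alpha>" using lin(4) y d by simp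
      also have "\<dots> = f y \<alpha>"
        using \<alpha> fd r(4)[OF coordinate[OF lin(3)[OF y] \<alpha>]] by (simp add: proj_limit_simps)
      finally show ?thesis .
    qed
    define h where "h \<alpha> u = f (lift \<alpha> u) \<alpha>" for \<alpha> u
    have h: "h \<alpha> (x \<alpha>) = f x \<alpha>" if "\<alpha> \<in> ps_idx X" "x \<in> carrier ?L" for \<alpha> x
      unfolding h_def using that coordinate lift by (intro cong) auto
    have surj: "\<exists>x\<in>carrier ?L. x \<alpha> = u" if "\<alpha> \<in> ps_idx X" "u \<in> carrier (ps_space X \<alpha>)" for \<alpha> u
      using lift[OF that] by blast
    have hiso: "lin_iso (ps_space X \<alpha>) (ps_space X \<alpha>) (h \<alpha>)" if \<alpha>: "\<alpha> \<in> ps_idx X" for \<alpha>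
    proof -
      let ?V = "ps_space X \<alpha>"
      have hlin: "linear_map real_ring ?V ?V (h \<alpha>)"
      proof (rule linear_map_realI[OF XD(2)[OF \<alpha>] XD(2)[OF \<alpha>]])
        fix u assume "u \<in> carrier ?V"
        then obtain x where x: "x \<in> carrier ?L" "x \<alpha> = u" using surj[OF \<alpha>] by blast
        show "h \<alpha> u \<in> carrier ?V" using h[OF \<alpha> x(1)] x coordinate[OF lin(3)[OF x(1)] \<alpha>] by simp
        show "h \<alpha> (c \<odot>\<^bsub>?V\<^esub> u) = c \<odot>\<^bsub>?V\<^esub> h \<alpha> u" for c
          using h[OF \<alpha> x(1)] h[OF \<alpha> L(3)[OF x(1)], of c] lin(5)[OF x(1), of c] x(2) \<alpha>
          by (simp add: proj_limit_simps)
        fix v assume "v \<in> carrier ?V"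
        then obtain y where y: "y \<in> carrier ?L" "y \<alpha> = v" using surj[OF \<alpha>] by blast
        show "h \<alpha> (u \<oplus>\<^bsub>?V\<^esub> v) = h \<alpha> u \<oplus>\<^bsub>?V\<^esub> h \<alpha> v"
          using h[OF \<alpha> x(1)] h[OF \<alpha> y(1)] h[OF \<alpha> L(2)[OF x(1) y(1)]] lin(4)[OF x(1) y(1)] x(2) y(2) \<alpha>
          by (simp add: proj_limit_simps)
      qed
      have "carrier ?V \<subseteq> h \<alpha> ` carrier ?V"
      proof
        fix u assume "u \<in> carrier ?V"
        then obtain x where x: "x \<in> carrier ?L" "x \<alpha> = u" using surj[OF \<alpha>] by blast
        then obtain y where y: "y \<in> carrier ?L" "x = f y" using lin_isoD(4)[OF fiso] by blast
        then have "u = h \<alpha> (y \<alpha>)" using h[OF \<alpha> y(1)] x by simp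
        then show "u \<in> h \<alpha> ` carrier ?V" using coordinate[OF y(1) \<alpha>] by blast
      qed
      then have "h \<alpha> ` carrier ?V = carrier ?V" using linear_map_realD(3)[OF hlin] by blast
      then show ?thesis using lin_isoI[OF hlin surj_endomorphism_inj[OF hlin XD(3)[OF \<alpha>]]] by blast
    qed
    have hbond: "ps_bond X \<alpha> \<beta> (h \<beta> u) = h \<alpha> (ps_bond X \<alpha> \<beta> u)"
      if le: "(\<alpha>, \<beta>) \<in> ps_le X" and u: "u \<in> carrier (ps_space X \<beta>)" for \<alpha> \<beta> u
    proof -
      have i: "\<alpha> \<in> ps_idx X" "\<beta> \<in> ps_idx X" using le XD(8) by auto
      obtain x where x: "x \<in> carrier ?L" "x \<beta> = u" using surj[OF i(2) u] by blast
      have "ps_bond X \<alpha> \<beta> (f x \<beta>) = f x \<alpha>" "ps_bond X \<alpha> \<beta> (x \<beta>) = x \<alpha>"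
        using lin(3)[OF x(1)] x(1) le by (auto simp: proj_limit_carrier)
      then show ?thesis using h[OF i(1) x(1)] h[OF i(2) x(1)] x(2) by simp
    qed
    have hf: "f x = (\<lambda>\<alpha>\<in>ps_idx X. h \<alpha> (x \<alpha>))" if "x \<in> carrier ?L" for x
      using lin(3)[OF that] h[OF _ that]
      by (intro extensionalityI[of _ "ps_idx X"]) (auto simp: proj_limit_carrier)
    show "f \<in> GL_ps X"
      unfolding GL_ps_def
    proof (intro CollectI conjI exI[of _ h])
      show "\<forall>(\<alpha>, \<beta>)\<in>ps_le X. \<forall>x\<in>carrier (ps_space X \<beta>). ps_bond X \<alpha> \<beta> (h \<beta> x) = h \<alpha> (ps_bond X \<alpha> \<beta> x)"
        using hbond by blast
    qed (use fiso fext hiso hf in blast)+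
  qed
qed

section \<open>Quotient spaces and completions\<close>

lemma abelian_subgroup_subspace:
  assumes "VectorSpace.subspace real_ring K V"
  shows "abelian_subgroup K V"
proof -
  interpret V: vectorspace real_ring V using assms by (simp add: subspace_real_iff)
  have K: "K \<subseteq> carrier V" "\<zero>\<^bsub>V\<^esub> \<in> K" "\<And>x y. x \<in> K \<Longrightarrow> y \<in> K \<Longrightarrow> x \<oplus>\<^bsub>V\<^esub> y \<in> K"
    "\<And>c x. x \<in> K \<Longrightarrow> c \<odot>\<^bsub>V\<^esub> x \<in> K"
    using assms by (auto simp: subspace_real_iff)
  have "\<ominus>\<^bsub>V\<^esub> x \<in> K" if "x \<in> K" for x
    using K(4)[OF that, of "-1"] V.smult_minus_1[of x] that K(1) by (auto simp: class_ring_simps)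
  then have "additive_subgroup K V"
    using K by (intro additive_subgroup.intro V.M.add.subgroupI) (auto simp: a_inv_def)
  then show ?thesis using V.M.abelian_group_axioms by (rule abelian_subgroupI3)
qed

lemma coset_eq_iff:
  assumes K: "VectorSpace.subspace real_ring K V" and x: "x \<in> carrier V" and y: "y \<in> carrier V"
  shows "K +>\<^bsub>V\<^esub> x = K +>\<^bsub>V\<^esub> y \<longleftrightarrow> x \<oplus>\<^bsub>V\<^esub> (-1) \<odot>\<^bsub>V\<^esub> y \<in> K"
proof -
  interpret abelian_subgroup K V by (rule abelian_subgroup_subspace[OF K])
  have V: "vectorspace real_ring V" and KV: "K \<subseteq> carrier V" using K by (auto simp: subspace_real_iff)
  note r = vectorspace_real_rules[OF V]
  note sub = a_subgroup
  have canc: "(k \<oplus>\<^bsub>V\<^esub> y) \<oplus>\<^bsub>V\<^esub> (-1) \<odot>\<^bsub>V\<^esub> y = k" if "k \<in> carrier V" for k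
    using r(3,4,6,8) that y by simp
  have canc': "(x \<oplus>\<^bsub>V\<^esub> (-1) \<odot>\<^bsub>V\<^esub> y) \<oplus>\<^bsub>V\<^esub> y = x"
    using r(3,4,6,7,8) x y by (metis (no_types, lifting))
  show ?thesis
  proof
    assume "K +>\<^bsub>V\<^esub> x = K +>\<^bsub>V\<^esub> y"
    then have "x \<in> K +>\<^bsub>V\<^esub> y" using a_rcos_self[OF x] by simp
    then obtain k where "k \<in> K" "x = k \<oplus>\<^bsub>V\<^esub> y" by (auto simp: a_r_coset_def')
    then show "x \<oplus>\<^bsub>V\<^esub> (-1) \<odot>\<^bsub>V\<^esub> y \<in> K" using canc[of k] KV by auto
  next
    assume "x \<oplus>\<^bsub>V\<^esub> (-1) \<odot>\<^bsub>V\<^esub> y \<in> K"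
    then have "x \<in> K +>\<^bsub>V\<^esub> y" using canc' by (force simp: a_r_coset_def')
    then show "K +>\<^bsub>V\<^esub> x = K +>\<^bsub>V\<^esub> y" using a_repr_independence[OF _ y sub] by simp
  qed
qed

lemma coset_zero:
  assumes "VectorSpace.subspace real_ring K V"
  shows "K +>\<^bsub>V\<^esub> \<zero>\<^bsub>V\<^esub> = K"
proof -
  interpret abelian_subgroup K V by (rule abelian_subgroup_subspace[OF assms])
  show ?thesis using a_coset_add_zero[of K] assms by (simp add: subspace_real_iff)
qed

lemma set_add_coset:
  assumes A: "VectorSpace.subspace real_ring A V" and B: "VectorSpace.subspace real_ring B V"
    and sub: "B \<subseteq> A" and x: "x \<in> carrier V"
  shows "A <+>\<^bsub>V\<^esub> (B +>\<^bsub>V\<^esub> x) = A +>\<^bsub>V\<^esub> x"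
proof -
  have V: "vectorspace real_ring V" and AV: "A \<subseteq> carrier V" and Aadd: "\<And>x y. x \<in> A \<Longrightarrow> y \<in> A \<Longrightarrow> x \<oplus>\<^bsub>V\<^esub> y \<in> A"
    using A by (auto simp: subspace_real_iff)
  have B0: "\<zero>\<^bsub>V\<^esub> \<in> B" using B by (auto simp: subspace_real_iff)
  note r = vectorspace_real_rules[OF V]
  have "a \<oplus>\<^bsub>V\<^esub> (b \<oplus>\<^bsub>V\<^esub> x) \<in> A +>\<^bsub>V\<^esub> x" if "a \<in> A" "b \<in> B" for a b
  proof -
    have ab: "a \<in> carrier V" "b \<in> carrier V" "b \<in> A" using that AV sub by auto
    have "a \<oplus>\<^bsub>V\<^esub> (b \<oplus>\<^bsub>V\<^esub> x) = (a \<oplus>\<^bsub>V\<^esub> b) \<oplus>\<^bsub>V\<^esub> x" using r(8)[OF ab(1,2) x] by simp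
    then show ?thesis using Aadd[OF that(1) ab(3)] by (auto simp: a_r_coset_def')
  qed
  moreover have "a \<oplus>\<^bsub>V\<^esub> x \<in> A <+>\<^bsub>V\<^esub> (B +>\<^bsub>V\<^esub> x)" if "a \<in> A" for a
  proof -
    have "a \<oplus>\<^bsub>V\<^esub> x = a \<oplus>\<^bsub>V\<^esub> (\<zero>\<^bsub>V\<^esub> \<oplus>\<^bsub>V\<^esub> x)" using r(5)[OF x] by simp
    then show ?thesis using that B0 unfolding set_add_def' a_r_coset_def' by blast
  qed
  ultimately show ?thesis by (auto simp: set_add_def' a_r_coset_def')
qed

lemma set_add_smult_coset:
  assumes K: "VectorSpace.subspace real_ring K V" and x: "x \<in> carrier V"
  shows "K <+>\<^bsub>V\<^esub> ((\<lambda>x. c \<odot>\<^bsub>V\<^esub> x) ` (K +>\<^bsub>V\<^esub> x)) = K +>\<^bsub>V\<^esub> (c \<odot>\<^bsub>V\<^esub> x)"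
proof -
  have V: "vectorspace real_ring V" and KV: "K \<subseteq> carrier V" and K0: "\<zero>\<^bsub>V\<^esub> \<in> K"
    and Kadd: "\<And>x y. x \<in> K \<Longrightarrow> y \<in> K \<Longrightarrow> x \<oplus>\<^bsub>V\<^esub> y \<in> K"
    and Ks: "\<And>c x. x \<in> K \<Longrightarrow> c \<odot>\<^bsub>V\<^esub> x \<in> K"
    using K by (auto simp: subspace_real_iff)
  note r = vectorspace_real_rules[OF V]
  have "k \<oplus>\<^bsub>V\<^esub> c \<odot>\<^bsub>V\<^esub> (l \<oplus>\<^bsub>V\<^esub> x) \<in> K +>\<^bsub>V\<^esub> (c \<odot>\<^bsub>V\<^esub> x)" if "k \<in> K" "l \<in> K" for k l
  proof -
    have kl: "k \<in> carrier V" "l \<in> carrier V" using that KV by auto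
    have "k \<oplus>\<^bsub>V\<^esub> c \<odot>\<^bsub>V\<^esub> (l \<oplus>\<^bsub>V\<^esub> x) = (k \<oplus>\<^bsub>V\<^esub> c \<odot>\<^bsub>V\<^esub> l) \<oplus>\<^bsub>V\<^esub> c \<odot>\<^bsub>V\<^esub> x"
      using r(3,8,12) kl x by simp
    then show ?thesis using Kadd[OF that(1) Ks[OF that(2)]] unfolding a_r_coset_def' by blast
  qed
  moreover have "k \<oplus>\<^bsub>V\<^esub> c \<odot>\<^bsub>V\<^esub> x \<in> K <+>\<^bsub>V\<^esub> ((\<lambda>x. c \<odot>\<^bsub>V\<^esub> x) ` (K +>\<^bsub>V\<^esub> x))" if "k \<in> K" for k
  proof -
    have "k \<oplus>\<^bsub>V\<^esub> c \<odot>\<^bsub>V\<^esub> x = k \<oplus>\<^bsub>V\<^esub> c \<odot>\<^bsub>V\<^esub> (\<zero>\<^bsub>V\<^esub> \<oplus>\<^bsub>V\<^esub> x)" using r(5)[OF x] by simp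
    then show ?thesis using that K0 unfolding set_add_def' a_r_coset_def' by blast
  qed
  ultimately show ?thesis by (auto simp: set_add_def' a_r_coset_def')
qed

lemma quot_space_simps:
  assumes K: "VectorSpace.subspace real_ring K V"
  shows "carrier (quot_space V K) = (\<lambda>x. K +>\<^bsub>V\<^esub> x) ` carrier V"
    and "\<zero>\<^bsub>quot_space V K\<^esub> = K +>\<^bsub>V\<^esub> \<zero>\<^bsub>V\<^esub>"
    and "x \<in> carrier V \<Longrightarrow> y \<in> carrier V \<Longrightarrow>
           (K +>\<^bsub>V\<^esub> x) \<oplus>\<^bsub>quot_space V K\<^esub> (K +>\<^bsub>V\<^esub> y) = K +>\<^bsub>V\<^esub> (x \<oplus>\<^bsub>V\<^esub> y)"
    and "x \<in> carrier V \<Longrightarrow> c \<odot>\<^bsub>quot_space V K\<^esub> (K +>\<^bsub>V\<^esub> x) = K +>\<^bsub>V\<^esub> (c \<odot>\<^bsub>V\<^esub> x)"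
proof -
  interpret abelian_subgroup K V by (rule abelian_subgroup_subspace[OF K])
  show "carrier (quot_space V K) = (\<lambda>x. K +>\<^bsub>V\<^esub> x) ` carrier V"
    by (auto simp: quot_space_def A_RCOSETS_def')
  show "\<zero>\<^bsub>quot_space V K\<^esub> = K +>\<^bsub>V\<^esub> \<zero>\<^bsub>V\<^esub>" using coset_zero[OF K] by (simp add: quot_space_def)
  show "x \<in> carrier V \<Longrightarrow> y \<in> carrier V \<Longrightarrow>
           (K +>\<^bsub>V\<^esub> x) \<oplus>\<^bsub>quot_space V K\<^esub> (K +>\<^bsub>V\<^esub> y) = K +>\<^bsub>V\<^esub> (x \<oplus>\<^bsub>V\<^esub> y)"
    using a_rcos_sum by (simp add: quot_space_def)
  show "x \<in> carrier V \<Longrightarrow> c \<odot>\<^bsub>quot_space V K\<^esub> (K +>\<^bsub>V\<^esub> x) = K +>\<^bsub>V\<^esub> (c \<odot>\<^bsub>V\<^esub> x)"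
    using set_add_smult_coset[OF K] by (simp add: quot_space_def)
qed

lemma vectorspace_quot_space:
  assumes K: "VectorSpace.subspace real_ring K V"
  shows "vectorspace real_ring (quot_space V K)"
proof (rule vectorspace_image)
  show "vectorspace real_ring V" using K by (simp add: subspace_real_iff)
  show "carrier (quot_space V K) = (\<lambda>x. K +>\<^bsub>V\<^esub> x) ` carrier V" by (rule quot_space_simps(1)[OF K])
qed (simp_all add: quot_space_simps[OF K])

lemma linear_map_coset:
  assumes K: "VectorSpace.subspace real_ring K V"
  shows "linear_map real_ring V (quot_space V K) (\<lambda>x. K +>\<^bsub>V\<^esub> x)"
  using K vectorspace_quot_space[OF K]
  by (intro linear_map_realI) (auto simp: quot_space_simps[OF K] subspace_real_iff)

lemma fin_dim_quot_space:
  assumes K: "VectorSpace.subspace real_ring K V" and "vectorspace.fin_dim real_ring V"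
  shows "vectorspace.fin_dim real_ring (quot_space V K)"
proof -
  interpret linear_map real_ring V "quot_space V K" "\<lambda>x. K +>\<^bsub>V\<^esub> x" by (rule linear_map_coset[OF K])
  show ?thesis by (rule surj_fin_dim[OF assms(2)]) (simp add: quot_space_simps(1)[OF K])
qed

lemma fincodim_invariant_subspaces_eq:
  assumes X: "is_proj_system X"
  shows "fincodim_invariant_subspaces X = invariant_subspaces (proj_limit X) (GL_ps X)"
  using fin_dim_quot_space[OF _ is_proj_systemD(5)[OF X]]
  unfolding fincodim_invariant_subspaces_def invariant_subspaces_def by blast

lemma complete_ps_iff:
  assumes X: "is_proj_system X"
  shows "complete_ps X \<longleftrightarrow> invariant_subspaces (proj_limit X) (GL_ps X) \<subseteq> limit_kernel X ` ps_idx X"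
  unfolding complete_ps_def fincodim_invariant_subspaces_eq[OF X]
  using ker_ps_proj[OF X] by (auto simp: subset_iff image_iff)

definition completion_map :: "('i, 'v) proj_system \<Rightarrow> ('i \<Rightarrow> 'v) \<Rightarrow> ('i \<Rightarrow> 'v) set \<Rightarrow> ('i \<Rightarrow> 'v) set" where
  "completion_map X x = (\<lambda>K\<in>fincodim_invariant_subspaces X. K +>\<^bsub>proj_limit X\<^esub> x)"

lemma invariant_subspaceD:
  assumes "K \<in> fincodim_invariant_subspaces X"
  shows "VectorSpace.subspace real_ring K (proj_limit X)" "K \<subseteq> carrier (proj_limit X)"
  using assms by (auto simp: fincodim_invariant_subspaces_def subspace_real_iff)

text \<open>
  The index \<open>0\<close> of the completion is its greatest element, so the component at this index determines
  a point of the limit.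
\<close>

lemma zero_invariant_subspace:
  assumes X: "is_proj_system X"
  shows "{\<zero>\<^bsub>proj_limit X\<^esub>} \<in> fincodim_invariant_subspaces X"
proof -
  note r = vectorspace_real_rules[OF is_proj_systemD(9)[OF X]]
  have "VectorSpace.subspace real_ring {\<zero>\<^bsub>proj_limit X\<^esub>} (proj_limit X)"
    using is_proj_systemD(9)[OF X] r(1,4,13) by (auto simp: subspace_real_iff)
  moreover have "f \<zero>\<^bsub>proj_limit X\<^esub> = \<zero>\<^bsub>proj_limit X\<^esub>" if "f \<in> GL_ps X" for f
  proof -
    have "lin_iso (proj_limit X) (proj_limit X) f" using that by (simp add: GL_ps_def)
    then show ?thesis by (rule linear_map_realD(6)[OF lin_isoD(1)])
  qed
  ultimately show ?thesis
    by (simp add: fincodim_invariant_subspaces_eq[OF X] invariant_subspaces_def)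
qed

lemma completion_simps:
  "ps_idx (completion X) = fincodim_invariant_subspaces X"
  "(A, B) \<in> ps_le (completion X) \<longleftrightarrow>
     A \<in> fincodim_invariant_subspaces X \<and> B \<in> fincodim_invariant_subspaces X \<and> B \<subseteq> A"
  "ps_space (completion X) K = quot_space (proj_limit X) K"
  "ps_bond (completion X) A B = (\<lambda>C. A <+>\<^bsub>proj_limit X\<^esub> C)"
  by (simp_all add: completion_def)

lemma carrier_limit_completion:
  assumes X: "is_proj_system X"
  shows "carrier (proj_limit (completion X)) = completion_map X ` carrier (proj_limit X)"
proof
  let ?L = "proj_limit X" and ?I = "fincodim_invariant_subspaces X"
  note S = invariant_subspaceD(1)[of _ X]
  show "completion_map X ` carrier ?L \<subseteq> carrier (proj_limit (completion X))"
  proof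
    fix y assume "y \<in> completion_map X ` carrier ?L"
    then obtain x where x: "x \<in> carrier ?L" "y = completion_map X x" by blast
    then show "y \<in> carrier (proj_limit (completion X))"
      using set_add_coset[OF S S _ x(1)]
      by (auto simp: proj_limit_carrier completion_simps completion_map_def quot_space_simps(1)[OF S])
  qed
  show "carrier (proj_limit (completion X)) \<subseteq> completion_map X ` carrier ?L"
  proof
    fix y assume y: "y \<in> carrier (proj_limit (completion X))"
    let ?Z = "{\<zero>\<^bsub>?L\<^esub>}"
    note Z = zero_invariant_subspace[OF X]
    have "y ?Z \<in> (\<lambda>x. ?Z +>\<^bsub>?L\<^esub> x) ` carrier ?L"
      using y Z by (auto simp: proj_limit_carrier completion_simps quot_space_simps(1)[OF S[OF Z]])
    then obtain x where x: "x \<in> carrier ?L" "y ?Z = ?Z +>\<^bsub>?L\<^esub> x" by blast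
    have "y K = K +>\<^bsub>?L\<^esub> x" if K: "K \<in> ?I" for K
    proof -
      have sub: "?Z \<subseteq> K" using S[OF K] by (simp add: subspace_real_iff)
      then have "(K, ?Z) \<in> ps_le (completion X)" using K Z by (simp add: completion_simps)
      moreover have "\<forall>(A, B)\<in>ps_le (completion X). A <+>\<^bsub>?L\<^esub> y B = y A"
        using y by (simp add: proj_limit_carrier completion_simps)
      ultimately have "K <+>\<^bsub>?L\<^esub> y ?Z = y K" by blast
      then show ?thesis using set_add_coset[OF S[OF K] S[OF Z] sub x(1)] x(2) by simp
    qed
    then have "y = completion_map X x"
      using y by (intro extensionalityI[of _ ?I]) (auto simp: proj_limit_carrier completion_simps completion_map_def)
    then show "y \<in> completion_map X ` carrier ?L" using x(1) by blast
  qed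
qed

lemma completion_map_lin_iso:
  assumes X: "is_proj_system X"
  shows "lin_iso (proj_limit X) (proj_limit (completion X)) (completion_map X)"
proof (rule lin_isoI)
  let ?L = "proj_limit X" and ?C = "proj_limit (completion X)" and ?\<eta> = "completion_map X"
  note S = invariant_subspaceD(1)[of _ X]
  note Z = zero_invariant_subspace[OF X]
  note L = is_proj_systemD(9)[OF X]
  note r = vectorspace_real_rules[OF L]
  have add: "?\<eta> x \<oplus>\<^bsub>?C\<^esub> ?\<eta> y = ?\<eta> (x \<oplus>\<^bsub>?L\<^esub> y)" if "x \<in> carrier ?L" "y \<in> carrier ?L" for x y
    unfolding proj_limit_simps(2)[of "completion X"] completion_simps completion_map_def
    using quot_space_simps(3)[OF S] that by (intro restrict_ext) simp
  have smult: "c \<odot>\<^bsub>?C\<^esub> ?\<eta> x = ?\<eta> (c \<odot>\<^bsub>?L\<^esub> x)" if "x \<in> carrier ?L" for c x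
    unfolding proj_limit_simps(3)[of "completion X"] completion_simps completion_map_def
    using quot_space_simps(4)[OF S] that by (intro restrict_ext) simp
  have zero: "\<zero>\<^bsub>?C\<^esub> = ?\<eta> \<zero>\<^bsub>?L\<^esub>"
    unfolding proj_limit_simps(1)[of "completion X"] completion_simps completion_map_def
    using quot_space_simps(2)[OF S] by (intro restrict_ext) simp
  note car = carrier_limit_completion[OF X]
  have "vectorspace real_ring ?C"
    by (rule vectorspace_image[where T = ?\<eta> and V = ?L, OF L car zero]) (use add smult in auto)
  then show "linear_map real_ring ?L ?C ?\<eta>"
    using L car add smult by (intro linear_map_realI) auto
  show "?\<eta> ` carrier ?L = carrier ?C" by (rule car[symmetric])
  show "inj_on ?\<eta> (carrier ?L)"
  proof (rule inj_onI)
    fix x y assume x: "x \<in> carrier ?L" and y: "y \<in> carrier ?L" and eq: "?\<eta> x = ?\<eta> y"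
    have "{\<zero>\<^bsub>?L\<^esub>} +>\<^bsub>?L\<^esub> x = {\<zero>\<^bsub>?L\<^esub>} +>\<^bsub>?L\<^esub> y"
      using fun_cong[OF eq, of "{\<zero>\<^bsub>?L\<^esub>}"] Z by (simp add: completion_map_def)
    then show "x = y" using r(5) x y by (simp add: a_r_coset_def')
  qed
qed

lemma completion_map_image_kernel:
  assumes X: "is_proj_system X" and K: "K \<in> fincodim_invariant_subspaces X"
  shows "completion_map X ` K = limit_kernel (completion X) K"
proof -
  let ?L = "proj_limit X"
  note S = invariant_subspaceD[OF K]
  note r = vectorspace_real_rules[OF is_proj_systemD(9)[OF X]]
  have "K +>\<^bsub>?L\<^esub> x = K +>\<^bsub>?L\<^esub> \<zero>\<^bsub>?L\<^esub> \<longleftrightarrow> x \<in> K" if "x \<in> carrier ?L" for x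
    using coset_eq_iff[OF S(1) that r(1)] r(4)[OF that] r(13) by simp
  then have "completion_map X x K = \<zero>\<^bsub>quot_space ?L K\<^esub> \<longleftrightarrow> x \<in> K" if "x \<in> carrier ?L" for x
    using that K by (simp add: quot_space_simps(2)[OF S(1)] completion_map_def)
  then show ?thesis
    unfolding limit_kernel_def carrier_limit_completion[OF X] completion_simps
    using S(2) by blast
qed

text \<open>
  If the limit of a system is known up to an isomorphism \<open>\<eta>\<close>, a projection \<open>p\<close> may be recognised as
  an epimorphism by the map \<open>g\<close> that it induces on the known space.
\<close>

lemma lin_epi_compose_iso:
  assumes "lin_iso V V' \<eta>" "linear_map real_ring V W g" "g ` carrier V = carrier W"
    and "vectorspace real_ring W" "\<And>x. x \<in> carrier V \<Longrightarrow> p (\<eta> x) = g x"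
  shows "lin_epi V' W p"
proof -
  note \<eta> = lin_isoD[OF assms(1)] linear_map_realD[OF lin_isoD(1)[OF assms(1)]]
  note g = linear_map_realD[OF assms(2)]
  note V = vectorspace_real_rules[OF \<eta>(5)]
  have pre: "\<exists>x\<in>carrier V. y = \<eta> x" if "y \<in> carrier V'" for y using \<eta>(4) that by blast
  have "linear_map real_ring V' W p"
  proof (rule linear_map_realI[OF \<eta>(6) assms(4)])
    fix y assume "y \<in> carrier V'"
    then obtain x where x: "x \<in> carrier V" "y = \<eta> x" using pre by blast
    show "p y \<in> carrier W" using x assms(5) g(3) by simp
    show "p (c \<odot>\<^bsub>V'\<^esub> y) = c \<odot>\<^bsub>W\<^esub> p y" for c
      using x assms(5)[OF V(3)[OF x(1)], of c] assms(5)[OF x(1)] \<eta>(9)[OF x(1), of c] g(5)[OF x(1)] by simp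
    fix z assume "z \<in> carrier V'"
    then obtain w where w: "w \<in> carrier V" "z = \<eta> w" using pre by blast
    show "p (y \<oplus>\<^bsub>V'\<^esub> z) = p y \<oplus>\<^bsub>W\<^esub> p z"
      using x w assms(5)[OF V(2)[OF x(1) w(1)]] assms(5)[OF x(1)] assms(5)[OF w(1)]
        \<eta>(8)[OF x(1) w(1)] g(4)[OF x(1) w(1)] by simp
  qed
  moreover have "p ` carrier V' = carrier W"
    unfolding \<eta>(4)[symmetric] assms(3)[symmetric] image_image using assms(5) by (rule image_cong[OF refl])
  ultimately show ?thesis by (simp add: lin_epi_def)
qed

lemma completion_is_proj_system:
  assumes X: "is_proj_system X"
  shows "is_proj_system (completion X)"
proof -
  let ?L = "proj_limit X" and ?C = "completion X" and ?\<eta> = "completion_map X"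
  let ?I = "fincodim_invariant_subspaces X"
  note S = invariant_subspaceD(1)[of _ X]
  note L = is_proj_systemD(9)[OF X]
  note r = vectorspace_real_rules[OF L]
  note iso = completion_map_lin_iso[OF X]
  have "partial_order_on ?I (ps_le ?C)"
    unfolding partial_order_on_def preorder_on_def refl_on_def trans_def antisym_def
    by (auto simp: completion_def)
  moreover have "\<forall>K\<in>?I. vectorspace real_ring (quot_space ?L K) \<and> vectorspace.fin_dim real_ring (quot_space ?L K)"
    using vectorspace_quot_space S fin_dim_quot_space[OF _ is_proj_systemD(5)[OF X]] by blast
  moreover have "lin_epi (quot_space ?L B) (quot_space ?L A) (\<lambda>C. A <+>\<^bsub>?L\<^esub> C)"
    if "A \<in> ?I" "B \<in> ?I" "B \<subseteq> A" for A B
  proof -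
    have bond: "A <+>\<^bsub>?L\<^esub> (B +>\<^bsub>?L\<^esub> x) = A +>\<^bsub>?L\<^esub> x" if "x \<in> carrier ?L" for x
      using set_add_coset[OF S S _ that] \<open>A \<in> ?I\<close> \<open>B \<in> ?I\<close> \<open>B \<subseteq> A\<close> by blast
    note q = quot_space_simps[OF S[OF \<open>A \<in> ?I\<close>]] quot_space_simps[OF S[OF \<open>B \<in> ?I\<close>]]
    have "linear_map real_ring (quot_space ?L B) (quot_space ?L A) (\<lambda>C. A <+>\<^bsub>?L\<^esub> C)"
      using that r by (intro linear_map_realI vectorspace_quot_space S) (auto simp: q bond)
    moreover have "(\<lambda>C. A <+>\<^bsub>?L\<^esub> C) ` carrier (quot_space ?L B) = carrier (quot_space ?L A)"
      unfolding q image_image using bond by (rule image_cong[OF refl])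
    ultimately show ?thesis by (simp add: lin_epi_def)
  qed
  moreover have "\<forall>A\<in>?I. \<forall>x\<in>carrier (quot_space ?L A). A <+>\<^bsub>?L\<^esub> x = x"
    using set_add_coset[OF S S] by (auto simp: quot_space_simps(1)[OF S])
  moreover have "A <+>\<^bsub>?L\<^esub> (B <+>\<^bsub>?L\<^esub> y) = A <+>\<^bsub>?L\<^esub> y"
    if I: "A \<in> ?I" "B \<in> ?I" "D \<in> ?I" "B \<subseteq> A" "D \<subseteq> B" and y: "y \<in> carrier (quot_space ?L D)" for A B D y
  proof -
    obtain x where x: "x \<in> carrier ?L" "y = D +>\<^bsub>?L\<^esub> x"
      using y quot_space_simps(1)[OF S[OF I(3)]] by auto
    have "D \<subseteq> A" using I by blast
    then show ?thesis using set_add_coset[OF S S _ x(1)] I x(2) by simp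
  qed
  moreover have "vectorspace.fin_dim real_ring (proj_limit ?C)"
  proof -
    interpret linear_map real_ring ?L "proj_limit ?C" ?\<eta> by (rule lin_isoD(1)[OF iso])
    show ?thesis by (rule surj_fin_dim[OF is_proj_systemD(5)[OF X] lin_isoD(4)[OF iso]])
  qed
  moreover have "lin_epi (proj_limit ?C) (quot_space ?L K) (ps_proj K)" if K: "K \<in> ?I" for K
    by (rule lin_epi_compose_iso[OF iso linear_map_coset[OF S[OF K]] quot_space_simps(1)[OF S[OF K], symmetric]
        vectorspace_quot_space[OF S[OF K]]])
      (simp add: K ps_proj_def completion_map_def)
  ultimately show ?thesis
    unfolding is_proj_system_def by (auto simp: completion_simps)
qed

lemma GL_ps_completion:
  assumes X: "is_proj_system X"
  shows "GL_ps (completion X)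
    = stabilizer (proj_limit (completion X)) ((`) (completion_map X) ` fincodim_invariant_subspaces X)"
    and "GL_ps X = stabilizer (proj_limit X) (fincodim_invariant_subspaces X)"
proof -
  have "limit_kernel (completion X) ` fincodim_invariant_subspaces X
      = (`) (completion_map X) ` fincodim_invariant_subspaces X"
    using completion_map_image_kernel[OF X] by (intro image_cong) auto
  then show "GL_ps (completion X)
    = stabilizer (proj_limit (completion X)) ((`) (completion_map X) ` fincodim_invariant_subspaces X)"
    using GL_ps_eq_stabilizer[OF completion_is_proj_system[OF X]] by (simp add: completion_simps)
  show "GL_ps X = stabilizer (proj_limit X) (fincodim_invariant_subspaces X)"
    unfolding fincodim_invariant_subspaces_eq[OF X] GL_ps_eq_stabilizer[OF X]
    by (rule stabilizer_invariant_subspaces[symmetric]) (use subspace_limit_kernel[OF X] in auto)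
qed

lemma GL_ps_subset_Bij: "GL_ps X \<subseteq> Bij (carrier (proj_limit X))"
  by (auto simp: GL_ps_def Bij_def lin_iso_def)

lemma ps_equivalent_completion:
  assumes X: "is_proj_system X"
  shows "ps_equivalent X (completion X)"
  unfolding ps_equivalent_def GL_ps_completion[OF X]
  by (rule lin_conjugate_stabilizer[OF completion_map_lin_iso[OF X]]) (rule invariant_subspaceD(2))

lemma completion_complete:
  assumes X: "is_proj_system X"
  shows "complete_ps (completion X)"
proof -
  note C = completion_is_proj_system[OF X]
  have "invariant_subspaces (proj_limit (completion X)) (GL_ps (completion X))
      = (`) (completion_map X) ` invariant_subspaces (proj_limit X) (GL_ps X)"
    unfolding GL_ps_completion[OF X]
    by (rule invariant_subspaces_lin_iso[OF completion_map_lin_iso[OF X]]) (rule invariant_subspaceD(2))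
  also have "\<dots> = limit_kernel (completion X) ` ps_idx (completion X)"
    unfolding fincodim_invariant_subspaces_eq[OF X, symmetric] completion_simps
    using completion_map_image_kernel[OF X] by (intro image_cong) auto
  finally show ?thesis using complete_ps_iff[OF C] by simp
qed

lemma completion_finite_complete:
  assumes X: "is_proj_system X" and "finite (invariant_subspaces (proj_limit X) (GL_ps X))"
  shows "completion X \<in> finite_complete_systems"
  using assms completion_is_proj_system[OF X] completion_complete[OF X]
  by (simp add: finite_complete_systems_def completion_simps fincodim_invariant_subspaces_eq[OF X])

section \<open>The projective system of a multifoliate structure\<close>

lemma multifoliate_structuresD:
  assumes "M \<in> multifoliate_structures"
  shows "finite (mf_idx M)" "partial_order_on (mf_idx M) (mf_le M)" "mf_map M ` {1..mf_n M} = mf_idx M"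
    and "i \<in> {1..mf_n M} \<Longrightarrow> mf_map M i \<in> mf_idx M"
    and "\<alpha> \<in> mf_idx M \<Longrightarrow> (\<alpha>, \<alpha>) \<in> mf_le M"
    and "(\<alpha>, \<beta>) \<in> mf_le M \<Longrightarrow> (\<beta>, \<gamma>) \<in> mf_le M \<Longrightarrow> (\<alpha>, \<gamma>) \<in> mf_le M"
    and "(\<alpha>, \<beta>) \<in> mf_le M \<Longrightarrow> \<alpha> \<in> mf_idx M \<and> \<beta> \<in> mf_idx M"
proof -
  show "finite (mf_idx M)" and po: "partial_order_on (mf_idx M) (mf_le M)"
    and im: "mf_map M ` {1..mf_n M} = mf_idx M"
    using assms by (simp_all add: multifoliate_structures_def)
  show "i \<in> {1..mf_n M} \<Longrightarrow> mf_map M i \<in> mf_idx M" using im by blast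
  show "\<alpha> \<in> mf_idx M \<Longrightarrow> (\<alpha>, \<alpha>) \<in> mf_le M"
    using partial_order_onD(1)[OF po] by (simp add: refl_on_def)
  show "(\<alpha>, \<beta>) \<in> mf_le M \<Longrightarrow> (\<beta>, \<gamma>) \<in> mf_le M \<Longrightarrow> (\<alpha>, \<gamma>) \<in> mf_le M"
    using partial_order_onD(2)[OF po] by (rule transD)
  show "(\<alpha>, \<beta>) \<in> mf_le M \<Longrightarrow> \<alpha> \<in> mf_idx M \<and> \<beta> \<in> mf_idx M"
    using partial_order_onD(4)[OF po] by blast
qed

text \<open>
  The order on the values of \<open>p\<close> need only be known through a family of coordinate sets that are
  down-closed for it; this serves both the sets \<open>H\<^sub>\<alpha>\<close> and the converse construction of a structure from a family.
\<close>

lemma GL_mf_eq_stabilizer_order: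
  assumes "\<Union>\<S> \<subseteq> {1..mf_n M}"
    and "\<And>i j. i \<in> {1..mf_n M} \<Longrightarrow> j \<in> {1..mf_n M} \<Longrightarrow>
           (mf_map M j, mf_map M i) \<in> mf_le M \<longleftrightarrow> (\<forall>S\<in>\<S>. i \<in> S \<longrightarrow> j \<in> S)"
  shows "GL_mf M = stabilizer (coord_space {1..mf_n M}) (vanishing {1..mf_n M} ` \<S>)"
proof -
  have "(\<forall>i\<in>{1..mf_n M}. \<forall>j\<in>{1..mf_n M}. (mf_map M j, mf_map M i) \<notin> mf_le M \<longrightarrow> a i j = 0) \<longleftrightarrow>
      (\<forall>i\<in>{1..mf_n M}. \<forall>j\<in>{1..mf_n M}. (\<exists>S\<in>\<S>. i \<in> S \<and> j \<notin> S) \<longrightarrow> a i j = 0)"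
    for a :: "nat \<Rightarrow> nat \<Rightarrow> real"
    by (intro ball_cong refl) (simp only: assms(2), blast)
  then show ?thesis
    unfolding GL_mf_def stabilizer_vanishing[OF finite_atLeastAtMost assms(1)] by presburger
qed

lemma GL_mf_eq_stabilizer:
  assumes M: "M \<in> multifoliate_structures"
  shows "GL_mf M = stabilizer (coord_space {1..mf_n M}) (vanishing {1..mf_n M} ` mf_coords M ` mf_idx M)"
proof (rule GL_mf_eq_stabilizer_order)
  note D = multifoliate_structuresD[OF M]
  show "\<Union>(mf_coords M ` mf_idx M) \<subseteq> {1..mf_n M}" by (auto simp: mf_coords_def)
  fix i j assume i: "i \<in> {1..mf_n M}" and j: "j \<in> {1..mf_n M}"
  have "(\<forall>S\<in>mf_coords M ` mf_idx M. i \<in> S \<longrightarrow> j \<in> S) \<longleftrightarrow>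
      (\<forall>\<alpha>\<in>mf_idx M. (mf_map M i, \<alpha>) \<in> mf_le M \<longrightarrow> (mf_map M j, \<alpha>) \<in> mf_le M)"
    using i j by (simp add: mf_coords_def)
  also have "\<dots> \<longleftrightarrow> (mf_map M j, mf_map M i) \<in> mf_le M"
    using D(4)[OF i] D(5,6) by blast
  finally show "(mf_map M j, mf_map M i) \<in> mf_le M \<longleftrightarrow> (\<forall>S\<in>mf_coords M ` mf_idx M. i \<in> S \<longrightarrow> j \<in> S)" ..
qed

lemma linear_map_restrict_coords:
  assumes "A \<subseteq> B"
  shows "linear_map real_ring (coord_space B) (coord_space A) (\<lambda>x. restrict x A)"
    and "(\<lambda>x. restrict x A) ` carrier (coord_space B) = carrier (coord_space A)"
proof -
  show "linear_map real_ring (coord_space B) (coord_space A) (\<lambda>x. restrict x A)"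
    using assms by (intro linear_map_realI vectorspace_coord_space)
      (auto simp: coord_space_simps fun_eq_iff)
  have "x = restrict (\<lambda>i\<in>B. if i \<in> A then x i else 0) A" if "x \<in> carrier (coord_space A)" for x
    using that assms by (auto simp: coord_space_simps fun_eq_iff PiE_def extensional_def)
  then have "carrier (coord_space A) \<subseteq> (\<lambda>x. restrict x A) ` carrier (coord_space B)"
    by (rule_tac subsetI, rule_tac image_eqI) (assumption, simp add: coord_space_simps)
  then show "(\<lambda>x. restrict x A) ` carrier (coord_space B) = carrier (coord_space A)"
    by (auto simp: coord_space_simps)
qed

definition mf_limit_map :: "'l multifol \<Rightarrow> (nat \<Rightarrow> real) \<Rightarrow> 'l \<Rightarrow> nat \<Rightarrow> real" where
  "mf_limit_map M x = (\<lambda>\<alpha>\<in>mf_idx M. restrict x (mf_coords M \<alpha>))"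

lemma mf_coords_mono:
  assumes "M \<in> multifoliate_structures" "(\<alpha>, \<beta>) \<in> mf_le M"
  shows "mf_coords M \<alpha> \<subseteq> mf_coords M \<beta>"
  using multifoliate_structuresD(6)[OF assms(1) _ assms(2)] by (auto simp: mf_coords_def)

lemma mf_system_simps:
  "ps_idx (mf_system M) = mf_idx M" "ps_le (mf_system M) = mf_le M"
  "ps_space (mf_system M) \<alpha> = coord_space (mf_coords M \<alpha>)"
  "ps_bond (mf_system M) \<alpha> \<beta> = (\<lambda>x. restrict x (mf_coords M \<alpha>))"
  by (simp_all add: mf_system_def)

text \<open>
  A point \<open>y\<close> of the limit is the family of restrictions of \<open>i \<mapsto> y\<^bsub>p i\<^esub> i\<close>: for \<open>p i \<le> \<alpha>\<close> the
  connecting map from \<open>\<alpha>\<close> to \<open>p i\<close> keeps the coordinate \<open>i\<close>.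
\<close>

lemma carrier_limit_mf_system:
  assumes M: "M \<in> multifoliate_structures"
  shows "carrier (proj_limit (mf_system M)) = mf_limit_map M ` carrier (coord_space {1..mf_n M})"
proof
  note D = multifoliate_structuresD[OF M]
  let ?N = "{1..mf_n M}" and ?H = "mf_coords M" and ?p = "mf_map M"
  show "mf_limit_map M ` carrier (coord_space ?N) \<subseteq> carrier (proj_limit (mf_system M))"
  proof
    fix y assume "y \<in> mf_limit_map M ` carrier (coord_space ?N)"
    then obtain x where y: "y = mf_limit_map M x" by blast
    have "restrict (restrict x (?H \<beta>)) (?H \<alpha>) = restrict x (?H \<alpha>)" if "(\<alpha>, \<beta>) \<in> mf_le M" for \<alpha> \<beta>
      using mf_coords_mono[OF M that] by (auto simp: fun_eq_iff)
    then show "y \<in> carrier (proj_limit (mf_system M))"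
      using D(7) by (auto simp: y proj_limit_carrier mf_system_simps mf_limit_map_def coord_space_simps)
  qed
  show "carrier (proj_limit (mf_system M)) \<subseteq> mf_limit_map M ` carrier (coord_space ?N)"
  proof
    fix y assume y: "y \<in> carrier (proj_limit (mf_system M))"
    have ext: "y \<in> extensional (mf_idx M)" and ye: "\<And>\<alpha>. \<alpha> \<in> mf_idx M \<Longrightarrow> y \<alpha> \<in> extensional (?H \<alpha>)"
      and bond: "\<forall>(\<alpha>, \<beta>)\<in>mf_le M. restrict (y \<beta>) (?H \<alpha>) = y \<alpha>"
      using y by (simp_all add: proj_limit_carrier mf_system_simps coord_space_simps PiE_def)
    let ?x = "\<lambda>i\<in>?N. y (?p i) i"
    have "y \<alpha> i = y (?p i) i" if "\<alpha> \<in> mf_idx M" "i \<in> ?H \<alpha>" for \<alpha> i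
    proof -
      have i: "i \<in> ?N" "(?p i, \<alpha>) \<in> mf_le M" using that(2) by (auto simp: mf_coords_def)
      have "restrict (y \<alpha>) (?H (?p i)) = y (?p i)" using bond i(2) by blast
      moreover have "i \<in> ?H (?p i)" using i(1) D(4,5) by (simp add: mf_coords_def)
      ultimately show ?thesis by (metis restrict_apply')
    qed
    then have "y \<alpha> = restrict ?x (?H \<alpha>)" if "\<alpha> \<in> mf_idx M" for \<alpha>
      using that by (intro extensionalityI[OF ye[OF that]]) (auto simp: mf_coords_def)
    then have "y = mf_limit_map M ?x"
      by (intro extensionalityI[OF ext]) (auto simp: mf_limit_map_def)
    moreover have "?x \<in> carrier (coord_space ?N)" by (simp add: coord_space_simps)
    ultimately show "y \<in> mf_limit_map M ` carrier (coord_space ?N)" by blast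
  qed
qed

lemma mf_limit_map_lin_iso:
  assumes M: "M \<in> multifoliate_structures"
  shows "lin_iso (coord_space {1..mf_n M}) (proj_limit (mf_system M)) (mf_limit_map M)"
proof (rule lin_isoI)
  note D = multifoliate_structuresD[OF M]
  let ?N = "{1..mf_n M}" and ?H = "mf_coords M" and ?p = "mf_map M" and ?\<theta> = "mf_limit_map M"
  let ?V = "coord_space ?N" and ?L = "proj_limit (mf_system M)"
  have H: "i \<in> ?H \<alpha> \<Longrightarrow> i \<in> ?N" for i \<alpha> by (simp add: mf_coords_def)
  have add: "?\<theta> x \<oplus>\<^bsub>?L\<^esub> ?\<theta> y = ?\<theta> (x \<oplus>\<^bsub>?V\<^esub> y)" for x y
    unfolding proj_limit_simps mf_system_simps mf_limit_map_def
    using H by (intro restrict_ext) (auto simp: coord_space_simps fun_eq_iff)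
  have smult: "c \<odot>\<^bsub>?L\<^esub> ?\<theta> x = ?\<theta> (c \<odot>\<^bsub>?V\<^esub> x)" for c x
    unfolding proj_limit_simps mf_system_simps mf_limit_map_def
    using H by (intro restrict_ext) (auto simp: coord_space_simps fun_eq_iff)
  have zero: "\<zero>\<^bsub>?L\<^esub> = ?\<theta> \<zero>\<^bsub>?V\<^esub>"
    unfolding proj_limit_simps mf_system_simps mf_limit_map_def
    using H by (intro restrict_ext) (auto simp: coord_space_simps fun_eq_iff)
  note car = carrier_limit_mf_system[OF M]
  have "vectorspace real_ring ?L"
    by (rule vectorspace_image[where T = ?\<theta> and V = ?V, OF vectorspace_coord_space car zero add smult])
  then show "linear_map real_ring ?V ?L ?\<theta>"
    by (intro linear_map_realI vectorspace_coord_space) (simp_all add: car add smult)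
  show "?\<theta> ` carrier ?V = carrier ?L" by (rule car[symmetric])
  show "inj_on ?\<theta> (carrier ?V)"
  proof (rule inj_onI)
    fix x y assume xy: "x \<in> carrier ?V" "y \<in> carrier ?V" "?\<theta> x = ?\<theta> y"
    have "x i = y i" if i: "i \<in> ?N" for i
    proof -
      have "i \<in> ?H (?p i)" using i D(4,5) by (simp add: mf_coords_def)
      moreover have "?\<theta> x (?p i) i = ?\<theta> y (?p i) i" using xy(3) by simp
      ultimately show ?thesis using D(4)[OF i] by (simp add: mf_limit_map_def)
    qed
    then show "x = y" using xy by (intro extensionalityI[of _ ?N]) (auto simp: coord_space_simps PiE_def)
  qed
qed

lemma mf_limit_map_vanishing:
  assumes M: "M \<in> multifoliate_structures" and \<alpha>: "\<alpha> \<in> mf_idx M"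
  shows "mf_limit_map M ` vanishing {1..mf_n M} (mf_coords M \<alpha>) = limit_kernel (mf_system M) \<alpha>"
proof -
  have "mf_limit_map M x \<alpha> = \<zero>\<^bsub>ps_space (mf_system M) \<alpha>\<^esub> \<longleftrightarrow> (\<forall>i\<in>mf_coords M \<alpha>. x i = 0)" for x
    using \<alpha> by (auto simp: mf_limit_map_def mf_system_simps coord_space_simps fun_eq_iff)
  then show ?thesis
    unfolding limit_kernel_def carrier_limit_mf_system[OF M] vanishing_def by blast
qed

lemma mf_system_is_proj_system:
  assumes M: "M \<in> multifoliate_structures"
  shows "is_proj_system (mf_system M)"
proof -
  note D = multifoliate_structuresD[OF M]
  let ?N = "{1..mf_n M}" and ?H = "mf_coords M" and ?\<theta> = "mf_limit_map M"
  note iso = mf_limit_map_lin_iso[OF M]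
  have HN: "?H \<alpha> \<subseteq> ?N" for \<alpha> by (auto simp: mf_coords_def)
  then have fin: "finite (?H \<alpha>)" for \<alpha> by (rule finite_subset) simp
  have "lin_epi (coord_space (?H \<beta>)) (coord_space (?H \<alpha>)) (\<lambda>x. restrict x (?H \<alpha>))"
    if "(\<alpha>, \<beta>) \<in> mf_le M" for \<alpha> \<beta>
    using linear_map_restrict_coords[OF mf_coords_mono[OF M that]] by (simp add: lin_epi_def)
  moreover have "restrict x (?H \<alpha>) = x" if "x \<in> carrier (coord_space (?H \<alpha>))" for x \<alpha>
    using that by (auto simp: coord_space_simps PiE_def extensional_restrict)
  moreover have "restrict (restrict x (?H \<beta>)) (?H \<alpha>) = restrict x (?H \<alpha>)" if "(\<alpha>, \<beta>) \<in> mf_le M" for \<alpha> \<beta> x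
    using mf_coords_mono[OF M that] by (auto simp: fun_eq_iff)
  moreover have "vectorspace.fin_dim real_ring (proj_limit (mf_system M))"
  proof -
    interpret linear_map real_ring "coord_space ?N" "proj_limit (mf_system M)" ?\<theta> by (rule lin_isoD(1)[OF iso])
    show ?thesis by (rule surj_fin_dim[OF fin_dim_coord_space(1) lin_isoD(4)[OF iso]]) simp
  qed
  moreover have "lin_epi (proj_limit (mf_system M)) (coord_space (?H \<alpha>)) (ps_proj \<alpha>)" if "\<alpha> \<in> mf_idx M" for \<alpha>
    by (rule lin_epi_compose_iso[OF iso linear_map_restrict_coords[OF HN] vectorspace_coord_space])
      (simp add: ps_proj_def mf_limit_map_def that)
  ultimately show ?thesis
    using D(2) vectorspace_coord_space fin_dim_coord_space(1)[OF fin]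
    by (auto simp: is_proj_system_def mf_system_simps)
qed

lemma GL_ps_mf_system:
  assumes M: "M \<in> multifoliate_structures"
  shows "GL_ps (mf_system M) = stabilizer (proj_limit (mf_system M))
    ((`) (mf_limit_map M) ` vanishing {1..mf_n M} ` mf_coords M ` mf_idx M)"
proof -
  have "limit_kernel (mf_system M) ` mf_idx M = (`) (mf_limit_map M) ` vanishing {1..mf_n M} ` mf_coords M ` mf_idx M"
    unfolding image_image using mf_limit_map_vanishing[OF M] by (intro image_cong) auto
  then show ?thesis
    using GL_ps_eq_stabilizer[OF mf_system_is_proj_system[OF M]] by (simp add: mf_system_simps)
qed

lemma mf_system_conjugate:
  assumes M: "M \<in> multifoliate_structures"
  shows "lin_conjugate (coord_space {1..mf_n M}) (GL_mf M)
    (proj_limit (mf_system M)) (GL_ps (mf_system M))"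
  unfolding GL_mf_eq_stabilizer[OF M] GL_ps_mf_system[OF M]
  by (rule lin_conjugate_stabilizer[OF mf_limit_map_lin_iso[OF M]]) (auto simp: vanishing_def)

lemma finite_invariant_subspaces_mf_system:
  assumes M: "M \<in> multifoliate_structures"
  shows "finite (invariant_subspaces (proj_limit (mf_system M)) (GL_ps (mf_system M)))"
proof -
  let ?N = "{1..mf_n M}" and ?\<S> = "mf_coords M ` mf_idx M"
  have "invariant_subspaces (coord_space ?N) (stabilizer (coord_space ?N) (vanishing ?N ` ?\<S>)) \<subseteq> vanishing ?N ` Pow ?N"
    using invariant_subspace_vanishing[of ?N ?\<S>] by (force simp: mf_coords_def)
  then have fin: "finite (invariant_subspaces (coord_space ?N) (stabilizer (coord_space ?N) (vanishing ?N ` ?\<S>)))"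
    by (rule finite_subset) simp
  have "invariant_subspaces (proj_limit (mf_system M)) (GL_ps (mf_system M)) =
    (`) (mf_limit_map M) ` invariant_subspaces (coord_space ?N) (stabilizer (coord_space ?N) (vanishing ?N ` ?\<S>))"
    unfolding GL_ps_mf_system[OF M]
    by (rule invariant_subspaces_lin_iso[OF mf_limit_map_lin_iso[OF M]]) (auto simp: vanishing_def)
  then show ?thesis using fin by simp
qed

lemma GL_mf_subset_Bij:
  assumes "M \<in> multifoliate_structures"
  shows "GL_mf M \<subseteq> Bij (carrier (coord_space {1..mf_n M}))"
  unfolding GL_mf_eq_stabilizer[OF assms] by (rule stabilizer_subset_Bij)

lemma completion_mf_system:
  assumes M: "M \<in> multifoliate_structures"
  shows "completion (mf_system M) \<in> finite_complete_systems"
    and "lin_conjugate (coord_space {1..mf_n M}) (GL_mf M)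
      (proj_limit (completion (mf_system M))) (GL_ps (completion (mf_system M)))"
proof -
  note X = mf_system_is_proj_system[OF M]
  show "completion (mf_system M) \<in> finite_complete_systems"
    by (rule completion_finite_complete[OF X finite_invariant_subspaces_mf_system[OF M]])
  show "lin_conjugate (coord_space {1..mf_n M}) (GL_mf M)
      (proj_limit (completion (mf_system M))) (GL_ps (completion (mf_system M)))"
    using mf_system_conjugate[OF M] ps_equivalent_completion[OF X] unfolding ps_equivalent_def
    by (rule lin_conjugate_trans[OF GL_mf_subset_Bij[OF M] GL_ps_subset_Bij GL_ps_subset_Bij])
qed

text \<open>
  Any family \<open>\<S>\<close> of coordinate subsets is realised by a multifoliate structure: coordinates are
  identified when they lie in the same members of \<open>\<S>\<close>, and these types are ordered by reverse inclusion.
\<close>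

lemma exists_multifoliate_structure:
  assumes inf: "infinite (UNIV :: 'l set)" and \<S>: "\<Union>\<S> \<subseteq> {1..n}"
  shows "\<exists>M :: 'l multifol. M \<in> multifoliate_structures \<and> mf_n M = n \<and>
           GL_mf M = stabilizer (coord_space {1..n}) (vanishing {1..n} ` \<S>)"
proof -
  define q where "q i = {S \<in> \<S>. i \<in> S}" for i
  have finq: "finite (q ` {1..n})" by simp
  \<comment> \<open>the finitely many values of \<open>q\<close> are renamed by elements of \<open>'l\<close>\<close>
  obtain B :: "'l set" where B: "finite B" "card B = card (q ` {1..n})"
    using infinite_arbitrarily_large[OF inf] by blast
  obtain g where g: "bij_betw g (q ` {1..n}) B"
    using finite_same_card_bij[OF finq B(1)] B(2) by auto
  define p where "p i = g (q i)" for i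
  have peq: "q i = q j" if "p i = p j" "i \<in> {1..n}" "j \<in> {1..n}" for i j
    using g that unfolding p_def bij_betw_def inj_on_def by blast
  define R where "R = {(p j, p i) | i j. i \<in> {1..n} \<and> j \<in> {1..n} \<and> q i \<subseteq> q j}"
  have le: "(p j, p i) \<in> R \<longleftrightarrow> q i \<subseteq> q j" if "i \<in> {1..n}" "j \<in> {1..n}" for i j
  proof
    assume "(p j, p i) \<in> R"
    then obtain i' j' where *: "p j = p j'" "p i = p i'" "i' \<in> {1..n}" "j' \<in> {1..n}" "q i' \<subseteq> q j'"
      by (auto simp: R_def)
    then show "q i \<subseteq> q j" using peq[of i i'] peq[of j j'] that by simp
  qed (use that in \<open>auto simp: R_def\<close>)
  have sub: "R \<subseteq> p ` {1..n} \<times> p ` {1..n}" by (auto simp: R_def)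
  have "partial_order_on (p ` {1..n}) R"
    unfolding partial_order_on_def preorder_on_def
  proof (intro conjI sub)
    show "refl_on (p ` {1..n}) R" using le by (auto simp: refl_on_def)
    show "trans R"
    proof (rule transI)
      fix x y z assume xy: "(x, y) \<in> R" and yz: "(y, z) \<in> R"
      then obtain i j k where ijk: "i \<in> {1..n}" "j \<in> {1..n}" "k \<in> {1..n}" "x = p i" "y = p j" "z = p k"
        using sub by blast
      then show "(x, z) \<in> R"
        using xy yz le[of j i] le[of k j] le[of k i] by blast
    qed
    show "antisym R"
    proof (rule antisymI)
      fix x y assume xy: "(x, y) \<in> R" and yx: "(y, x) \<in> R"
      then obtain i j where ij: "i \<in> {1..n}" "j \<in> {1..n}" "x = p i" "y = p j"
        using sub by blast
      then have "q i = q j" using xy yx le[of j i] le[of i j] by blast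
      then show "x = y" using ij by (simp add: p_def)
    qed
  qed
  then have M: "\<lparr>mf_n = n, mf_idx = p ` {1..n}, mf_le = R, mf_map = p\<rparr> \<in> multifoliate_structures"
    (is "?M \<in> _") by (simp add: multifoliate_structures_def)
  have "GL_mf ?M = stabilizer (coord_space {1..mf_n ?M}) (vanishing {1..mf_n ?M} ` \<S>)"
  proof (rule GL_mf_eq_stabilizer_order)
    show "\<Union>\<S> \<subseteq> {1..mf_n ?M}" using \<S> by simp
    fix i j assume "i \<in> {1..mf_n ?M}" "j \<in> {1..mf_n ?M}"
    then have "(p j, p i) \<in> R \<longleftrightarrow> q i \<subseteq> q j" using le by simp
    also have "\<dots> \<longleftrightarrow> (\<forall>S\<in>\<S>. i \<in> S \<longrightarrow> j \<in> S)" by (auto simp: q_def)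
    finally show "(mf_map ?M j, mf_map ?M i) \<in> mf_le ?M \<longleftrightarrow> (\<forall>S\<in>\<S>. i \<in> S \<longrightarrow> j \<in> S)" by simp
  qed
  then show ?thesis using M by (intro exI[of _ ?M]) simp
qed

section \<open>Distributivity and adapted bases\<close>

text \<open>
  The image of \<open>{(a, b). a \<in> A, b \<in> B, a + b \<in> K}\<close> under \<open>(a, b) \<mapsto> a + c b\<close>.  For \<open>c = 1\<close> this is
  \<open>K \<inter> (A + B)\<close>; the other values of \<open>c\<close> give the one-parameter family that forces distributivity.
\<close>

definition skew_sum :: "(real, 'v) module \<Rightarrow> 'v set \<Rightarrow> 'v set \<Rightarrow> 'v set \<Rightarrow> real \<Rightarrow> 'v set" where
  "skew_sum V K A B c = {a \<oplus>\<^bsub>V\<^esub> c \<odot>\<^bsub>V\<^esub> b | a b. a \<in> A \<and> b \<in> B \<and> a \<oplus>\<^bsub>V\<^esub> b \<in> K}"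

lemma invariant_subspace_rules:
  assumes "K \<in> invariant_subspaces V G"
  shows "K \<subseteq> carrier V" "\<zero>\<^bsub>V\<^esub> \<in> K" "x \<in> K \<Longrightarrow> y \<in> K \<Longrightarrow> x \<oplus>\<^bsub>V\<^esub> y \<in> K"
    "x \<in> K \<Longrightarrow> c \<odot>\<^bsub>V\<^esub> x \<in> K" "f \<in> G \<Longrightarrow> x \<in> K \<Longrightarrow> f x \<in> K"
  using assms by (auto simp: invariant_subspaces_def subspace_real_iff image_subset_iff)

lemma invariant_subspacesI:
  assumes "vectorspace real_ring V" "K \<subseteq> carrier V" "\<zero>\<^bsub>V\<^esub> \<in> K"
    and "\<And>x y. x \<in> K \<Longrightarrow> y \<in> K \<Longrightarrow> x \<oplus>\<^bsub>V\<^esub> y \<in> K" "\<And>c x. x \<in> K \<Longrightarrow> c \<odot>\<^bsub>V\<^esub> x \<in> K"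
    and "\<And>f x. f \<in> G \<Longrightarrow> x \<in> K \<Longrightarrow> f x \<in> K"
  shows "K \<in> invariant_subspaces V G"
  using assms by (auto simp: invariant_subspaces_def subspace_real_iff)

locale finite_invariants =
  fixes V :: "(real, 'v) module" and G :: "('v \<Rightarrow> 'v) set"
  assumes vs: "vectorspace real_ring V"
    and linear: "\<And>f. f \<in> G \<Longrightarrow> linear_map real_ring V V f"
    and finite_Inv: "finite (invariant_subspaces V G)"
begin

abbreviation "Inv \<equiv> invariant_subspaces V G"

lemmas r = vectorspace_real_rules[OF vs]

lemma zero_Inv: "{\<zero>\<^bsub>V\<^esub>} \<in> Inv"
  using r(1,4,13) linear_map_realD(6)[OF linear] by (intro invariant_subspacesI vs) auto

lemma carrier_Inv: "carrier V \<in> Inv"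
  using r linear_map_realD(3)[OF linear] by (intro invariant_subspacesI vs) auto

lemma Int_Inv: "A \<in> Inv \<Longrightarrow> B \<in> Inv \<Longrightarrow> A \<inter> B \<in> Inv"
  by (intro invariant_subspacesI vs) (auto dest: invariant_subspace_rules)

lemma add_interchange:
  assumes "a \<in> carrier V" "b \<in> carrier V" "a' \<in> carrier V" "b' \<in> carrier V"
  shows "(a \<oplus>\<^bsub>V\<^esub> b) \<oplus>\<^bsub>V\<^esub> (a' \<oplus>\<^bsub>V\<^esub> b') = (a \<oplus>\<^bsub>V\<^esub> a') \<oplus>\<^bsub>V\<^esub> (b \<oplus>\<^bsub>V\<^esub> b')"
proof -
  have "b \<oplus>\<^bsub>V\<^esub> (a' \<oplus>\<^bsub>V\<^esub> b') = a' \<oplus>\<^bsub>V\<^esub> (b \<oplus>\<^bsub>V\<^esub> b')"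
    using r(7)[OF assms(2,3)] r(8)[OF assms(2,3,4)] r(8)[OF assms(3,2,4)] by simp
  then show ?thesis using assms r(2,8) by simp
qed

lemma skew_sum_Inv:
  assumes A: "A \<in> Inv" and B: "B \<in> Inv" and K: "K \<in> Inv"
  shows "skew_sum V K A B c \<in> Inv"
proof -
  note a = invariant_subspace_rules[OF A] and b = invariant_subspace_rules[OF B]
    and k = invariant_subspace_rules[OF K]
  show ?thesis
  proof (rule invariant_subspacesI[OF vs])
    show "skew_sum V K A B c \<subseteq> carrier V" using a(1) b(1) by (auto simp: skew_sum_def subset_iff intro!: r(2,3))
    show "\<zero>\<^bsub>V\<^esub> \<in> skew_sum V K A B c"
      unfolding skew_sum_def using a(2) b(2) k(2) r(1,4,13)
      by (intro CollectI exI[of _ "\<zero>\<^bsub>V\<^esub>"]) simp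
  next
    fix x y assume "x \<in> skew_sum V K A B c" "y \<in> skew_sum V K A B c"
    then obtain u v u' v' where *: "u \<in> A" "v \<in> B" "u \<oplus>\<^bsub>V\<^esub> v \<in> K" "x = u \<oplus>\<^bsub>V\<^esub> c \<odot>\<^bsub>V\<^esub> v"
      "u' \<in> A" "v' \<in> B" "u' \<oplus>\<^bsub>V\<^esub> v' \<in> K" "y = u' \<oplus>\<^bsub>V\<^esub> c \<odot>\<^bsub>V\<^esub> v'"
      by (auto simp: skew_sum_def)
    have car: "u \<in> carrier V" "v \<in> carrier V" "u' \<in> carrier V" "v' \<in> carrier V" using * a(1) b(1) by auto
    have "x \<oplus>\<^bsub>V\<^esub> y = (u \<oplus>\<^bsub>V\<^esub> u') \<oplus>\<^bsub>V\<^esub> c \<odot>\<^bsub>V\<^esub> (v \<oplus>\<^bsub>V\<^esub> v')"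
      unfolding *(4,8) using add_interchange[of u "c \<odot>\<^bsub>V\<^esub> v" u' "c \<odot>\<^bsub>V\<^esub> v'"] car r(3,12) by simp
    moreover have "(u \<oplus>\<^bsub>V\<^esub> u') \<oplus>\<^bsub>V\<^esub> (v \<oplus>\<^bsub>V\<^esub> v') \<in> K"
      using add_interchange[of u v u' v'] car k(3)[OF *(3,7)] by simp
    ultimately show "x \<oplus>\<^bsub>V\<^esub> y \<in> skew_sum V K A B c"
      using a(3)[OF *(1,5)] b(3)[OF *(2,6)] unfolding skew_sum_def by blast
  next
    fix d x assume "x \<in> skew_sum V K A B c"
    then obtain u v where *: "u \<in> A" "v \<in> B" "u \<oplus>\<^bsub>V\<^esub> v \<in> K" "x = u \<oplus>\<^bsub>V\<^esub> c \<odot>\<^bsub>V\<^esub> v"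
      by (auto simp: skew_sum_def)
    have car: "u \<in> carrier V" "v \<in> carrier V" using * a(1) b(1) by auto
    have "d \<odot>\<^bsub>V\<^esub> x = d \<odot>\<^bsub>V\<^esub> u \<oplus>\<^bsub>V\<^esub> c \<odot>\<^bsub>V\<^esub> (d \<odot>\<^bsub>V\<^esub> v)"
      unfolding *(4) using car r(3,12) r(9)[OF car(2), of d c] r(9)[OF car(2), of c d] by (simp add: mult.commute)
    moreover have "d \<odot>\<^bsub>V\<^esub> u \<oplus>\<^bsub>V\<^esub> d \<odot>\<^bsub>V\<^esub> v \<in> K"
      using k(4)[OF *(3), of d] r(12)[OF car, of d] by simp
    ultimately show "d \<odot>\<^bsub>V\<^esub> x \<in> skew_sum V K A B c"
      using a(4)[OF *(1)] b(4)[OF *(2)] unfolding skew_sum_def by blast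
  next
    fix f x assume f: "f \<in> G" and "x \<in> skew_sum V K A B c"
    then obtain u v where *: "u \<in> A" "v \<in> B" "u \<oplus>\<^bsub>V\<^esub> v \<in> K" "x = u \<oplus>\<^bsub>V\<^esub> c \<odot>\<^bsub>V\<^esub> v"
      by (auto simp: skew_sum_def)
    have car: "u \<in> carrier V" "v \<in> carrier V" using * a(1) b(1) by auto
    note lin = linear_map_realD[OF linear[OF f]]
    have "f x = f u \<oplus>\<^bsub>V\<^esub> c \<odot>\<^bsub>V\<^esub> f v" unfolding *(4) using lin(4,5) car r(3) by simp
    moreover have "f u \<oplus>\<^bsub>V\<^esub> f v \<in> K" using k(5)[OF f *(3)] lin(4)[OF car] by simp
    ultimately show "f x \<in> skew_sum V K A B c"
      using a(5)[OF f *(1)] b(5)[OF f *(2)] unfolding skew_sum_def by blast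
  qed
qed

text \<open>
  All the subspaces \<open>{a + c b | a + b \<in> K}\<close> are invariant, so two of them coincide for distinct
  nonzero \<open>c, d\<close>.  Writing \<open>a + c b = a' + d b'\<close> with \<open>a' + b' \<in> K\<close>, the vector
  \<open>(a + b) - (a' + b') = (1 - c) b + (d - 1) b'\<close> lies in \<open>K \<inter> B\<close>, and modulo
  \<open>A\<close>, where \<open>d b' = c b\<close>, it is the nonzero multiple \<open>(1 - c / d) b\<close> of \<open>b\<close>.
\<close>

lemma distributive:
  assumes A: "A \<in> Inv" and B: "B \<in> Inv" and K: "K \<in> Inv"
    and a: "a \<in> A" and b: "b \<in> B" and ab: "a \<oplus>\<^bsub>V\<^esub> b \<in> K"
  shows "\<exists>u w. u \<in> K \<inter> A \<and> w \<in> K \<inter> B \<and> a \<oplus>\<^bsub>V\<^esub> b = u \<oplus>\<^bsub>V\<^esub> w"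
proof -
  note AR = invariant_subspace_rules[OF A] and BR = invariant_subspace_rules[OF B]
    and KR = invariant_subspace_rules[OF K]
  have "\<not> inj_on (skew_sum V K A B) (UNIV - {0})"
  proof
    assume inj: "inj_on (skew_sum V K A B) (UNIV - {0})"
    have "skew_sum V K A B ` (UNIV - {0}) \<subseteq> Inv" using skew_sum_Inv[OF A B K] by blast
    then have "finite (skew_sum V K A B ` (UNIV - {0}))" using finite_Inv by (rule finite_subset)
    then have "finite (UNIV - {0 :: real})" using inj by (rule finite_imageD)
    then show False using infinite_UNIV_char_0[where 'a = real] by simp
  qed
  then obtain c d where cd: "c \<noteq> d" "d \<noteq> 0" and eq: "skew_sum V K A B c = skew_sum V K A B d"
    by (auto simp: inj_on_def)
  have "a \<oplus>\<^bsub>V\<^esub> c \<odot>\<^bsub>V\<^esub> b \<in> skew_sum V K A B d"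
    unfolding eq[symmetric] using a b ab by (auto simp: skew_sum_def)
  then obtain a' b' where a': "a' \<in> A" and b': "b' \<in> B" and K': "a' \<oplus>\<^bsub>V\<^esub> b' \<in> K"
    and rel: "a \<oplus>\<^bsub>V\<^esub> c \<odot>\<^bsub>V\<^esub> b = a' \<oplus>\<^bsub>V\<^esub> d \<odot>\<^bsub>V\<^esub> b'"
    by (auto simp: skew_sum_def)
  have car: "a \<in> carrier V" "b \<in> carrier V" "a' \<in> carrier V" "b' \<in> carrier V"
    using a b a' b' AR(1) BR(1) by auto
  \<comment> \<open>identities between combinations of \<open>a\<close>, \<open>b\<close>, \<open>b'\<close> are reduced to identities of their coefficients\<close>
  define L where "L p q s = p \<odot>\<^bsub>V\<^esub> a \<oplus>\<^bsub>V\<^esub> (q \<odot>\<^bsub>V\<^esub> b \<oplus>\<^bsub>V\<^esub> s \<odot>\<^bsub>V\<^esub> b')" for p q s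
  have L_add: "L p q s \<oplus>\<^bsub>V\<^esub> L p' q' s' = L (p + p') (q + q') (s + s')" for p q s p' q' s'
    unfolding L_def using car r(2,3) by (simp add: add_interchange r(11))
  have L_smult: "t \<odot>\<^bsub>V\<^esub> L p q s = L (t * p) (t * q) (t * s)" for t p q s
    unfolding L_def using car r(2,3) by (simp add: r(9,12))
  have L_a: "a = L 1 0 0" and L_b: "b = L 0 1 0" and L_b': "b' = L 0 0 1"
    unfolding L_def using car r(1,3,4,5,10,14) by simp_all
  have L_a': "a' = L 1 c (- d)"
  proof -
    have "a' = a' \<oplus>\<^bsub>V\<^esub> (d \<odot>\<^bsub>V\<^esub> b' \<oplus>\<^bsub>V\<^esub> (- d) \<odot>\<^bsub>V\<^esub> b')"
      using car r(4) r(11)[OF car(4), of d "- d"] r(14)[OF car(4)] by simp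
    also have "\<dots> = (a \<oplus>\<^bsub>V\<^esub> c \<odot>\<^bsub>V\<^esub> b) \<oplus>\<^bsub>V\<^esub> (- d) \<odot>\<^bsub>V\<^esub> b'"
      using car r(3,8) rel by simp
    also have "\<dots> = L 1 c (- d)" by (simp add: L_a L_b L_b' L_add L_smult)
    finally show ?thesis .
  qed
  \<comment> \<open>\<open>w\<close> is \<open>(a + b) - (a' + b')\<close>, rescaled so that \<open>b - w = s (a' - a) \<in> A\<close>; then \<open>u = (a + b) - w\<close>\<close>
  define s where "s = (d - 1) / (d - c)"
  define t where "t = d / (d - c)"
  have cd': "d - c \<noteq> 0" using cd by simp
  define w where "w = t \<odot>\<^bsub>V\<^esub> ((1 - c) \<odot>\<^bsub>V\<^esub> b \<oplus>\<^bsub>V\<^esub> (d - 1) \<odot>\<^bsub>V\<^esub> b')"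
  define u where "u = a \<oplus>\<^bsub>V\<^esub> s \<odot>\<^bsub>V\<^esub> (a' \<oplus>\<^bsub>V\<^esub> (- 1) \<odot>\<^bsub>V\<^esub> a)"
  have wB: "w \<in> B" unfolding w_def using b b' by (intro BR(3,4))
  have uA: "u \<in> A" unfolding u_def using a a' by (intro AR(3,4))
  have L_w: "w = L 0 (t * (1 - c)) (t * (d - 1))"
    unfolding w_def by (simp add: L_b L_b' L_add L_smult)
  have L_u: "u = L 1 (s * c) (- (s * d))"
    unfolding u_def L_a' by (simp add: L_a L_add L_smult)
  have x: "a \<oplus>\<^bsub>V\<^esub> b = L 1 1 0" by (simp add: L_a L_b L_add)
  have "w = t \<odot>\<^bsub>V\<^esub> ((a \<oplus>\<^bsub>V\<^esub> b) \<oplus>\<^bsub>V\<^esub> (- 1) \<odot>\<^bsub>V\<^esub> (a' \<oplus>\<^bsub>V\<^esub> b'))"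
    unfolding x L_w L_a' by (simp add: L_b' L_add L_smult algebra_simps)
  then have wK: "w \<in> K" using ab K' KR(3,4) by simp
  have "s * c + t * (1 - c) = ((d - 1) * c + d * (1 - c)) / (d - c)"
    by (simp add: s_def t_def add_divide_distrib)
  also have "(d - 1) * c + d * (1 - c) = d - c" by (simp add: algebra_simps)
  finally have sum1: "s * c + t * (1 - c) = 1" using cd' by simp
  have sum2: "- (s * d) + t * (d - 1) = 0" by (simp add: s_def t_def mult.commute)
  have sum: "a \<oplus>\<^bsub>V\<^esub> b = u \<oplus>\<^bsub>V\<^esub> w"
    unfolding x L_u L_w L_add using sum1 sum2 by simp
  have "u = (a \<oplus>\<^bsub>V\<^esub> b) \<oplus>\<^bsub>V\<^esub> (- 1) \<odot>\<^bsub>V\<^esub> w"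
  proof -
    have "s * c = 1 - t * (1 - c)" "- (s * d) = - (t * (d - 1))" using sum1 sum2 by linarith+
    then have "u = L 1 (1 - t * (1 - c)) (- (t * (d - 1)))" using L_u by (simp only:)
    then show ?thesis unfolding x L_w L_add L_smult by simp
  qed
  then have "u \<in> K" using ab wK KR(3,4) by simp
  then show ?thesis using sum uA wB wK by blast
qed

text \<open>
  By distributivity the invariant subspaces \<open>S\<close> with \<open>K \<inter> S \<subseteq> M\<close> are closed under sums.
\<close>

lemma exists_cover:
  assumes "finite F" "F \<subseteq> Inv" and K: "K \<in> Inv" and M: "\<zero>\<^bsub>V\<^esub> \<in> M"
    and Madd: "\<And>x y. x \<in> M \<Longrightarrow> y \<in> M \<Longrightarrow> x \<oplus>\<^bsub>V\<^esub> y \<in> M" and "\<And>A. A \<in> F \<Longrightarrow> K \<inter> A \<subseteq> M"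
  shows "\<exists>S\<in>Inv. \<Union>F \<subseteq> S \<and> K \<inter> S \<subseteq> M"
  using assms(1,2,6)
proof (induction F)
  case empty
  then show ?case using zero_Inv M by blast
next
  case (insert A F)
  then obtain S where S: "S \<in> Inv" "\<Union>F \<subseteq> S" "K \<inter> S \<subseteq> M" by auto
  have A: "A \<in> Inv" "K \<inter> A \<subseteq> M" using insert.prems by auto
  note SR = invariant_subspace_rules[OF S(1)] and AR = invariant_subspace_rules[OF A(1)]
  let ?T = "skew_sum V (carrier V) S A 1"
  have T: "?T = {x \<oplus>\<^bsub>V\<^esub> y | x y. x \<in> S \<and> y \<in> A}"
    unfolding skew_sum_def using SR(1) AR(1) r(2,10)
    by (intro Collect_cong) (metis subsetD)
  have "S \<subseteq> ?T"
  proof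
    fix x assume "x \<in> S"
    then show "x \<in> ?T" unfolding T using AR(2) r(4)[of x] SR(1) by force
  qed
  moreover have "A \<subseteq> ?T"
  proof
    fix x assume "x \<in> A"
    then show "x \<in> ?T" unfolding T using SR(2) r(5)[of x] AR(1) by force
  qed
  moreover have "x \<in> M" if "x \<in> K \<inter> ?T" for x
  proof -
    from that obtain p q where "x = p \<oplus>\<^bsub>V\<^esub> q" "p \<in> S" "q \<in> A" "x \<in> K" by (auto simp: T)
    then obtain u w where "u \<in> K \<inter> S" "w \<in> K \<inter> A" "x = u \<oplus>\<^bsub>V\<^esub> w"
      using distributive[OF S(1) A(1) K, of p q] by blast
    then show "x \<in> M" using S(3) A(2) Madd by blast
  qed
  moreover have "?T \<in> Inv" by (rule skew_sum_Inv[OF S(1) A(1) carrier_Inv])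
  ultimately show ?case using S(2) by (intro bexI[of _ ?T]) auto
qed

end

text \<open>
  The independent set \<open>B\<close> is required to lie in the union of the family in order that a bound on the
  members of the family bounds the span of \<open>B\<close> too.
\<close>

definition adapted :: "(real, 'v) module \<Rightarrow> 'v set set \<Rightarrow> 'v set \<Rightarrow> bool" where
  "adapted V F B \<longleftrightarrow> B \<subseteq> carrier V \<and> \<not> LinearCombinations.module.lin_dep real_ring V B \<and> B \<subseteq> \<Union>F \<and>
     (\<forall>K\<in>F. K \<subseteq> LinearCombinations.module.span real_ring V (B \<inter> K))"

text \<open>
  Induction removes a maximal member \<open>K\<close>, so that the rest of the family is still closed under
  intersections.  If \<open>B\<close> is adapted to the rest, then \<open>K \<inter> A\<close> lies in the span of \<open>B \<inter> K\<close> for each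
  remaining \<open>A\<close>, and so, by \<open>exists_cover\<close>, does \<open>K \<inter> span B\<close>.  Therefore \<open>B\<close> can be enlarged by
  vectors of \<open>K\<close> alone until \<open>K\<close> is spanned: in a maximal independent set \<open>C\<close> between \<open>B\<close> and
  \<open>B \<union> K\<close>, a vector of \<open>K\<close> is \<open>p + q\<close> with \<open>p \<in> span B\<close> and \<open>q \<in> span (C \<inter> K)\<close>, and then \<open>p \<in> K\<close>.
\<close>

lemma (in finite_invariants) exists_adapted:
  assumes fd: "vectorspace.fin_dim real_ring V"
    and "finite F" "F \<subseteq> Inv" "\<And>A B. A \<in> F \<Longrightarrow> B \<in> F \<Longrightarrow> A \<inter> B \<in> F"
  shows "\<exists>B. adapted V F B"
  using assms(2-)
proof (induction F rule: finite_psubset_induct)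
  case (psubset F)
  interpret V: vectorspace real_ring V by (rule vs)
  show ?case
  proof (cases "F = {}")
    case True
    then show ?thesis by (intro exI[of _ "{}"]) (simp add: adapted_def V.lin_dep_def)
  next
    case False
    obtain K where K: "K \<in> F" and max: "\<And>A. A \<in> F \<Longrightarrow> K \<subseteq> A \<Longrightarrow> A = K"
      using finite_has_maximal[OF psubset.hyps False] by metis
    let ?F = "F - {K}"
    have notsub: "\<not> K \<subseteq> A" if "A \<in> ?F" for A using max that by blast
    have "A \<inter> B \<in> ?F" if "A \<in> ?F" "B \<in> ?F" for A B
      using that psubset.prems(2)[of A B] notsub[OF that(1)] by blast
    then have "\<exists>B. adapted V ?F B"
      using K psubset.prems by (intro psubset.IH) auto
    then obtain B where B: "B \<subseteq> carrier V" "V.lin_indpt B" "B \<subseteq> \<Union>?F"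
      and BK: "\<And>A. A \<in> ?F \<Longrightarrow> A \<subseteq> V.span (B \<inter> A)"
      unfolding adapted_def by blast
    have KInv: "K \<in> Inv" using K psubset.prems(1) by blast
    note KR = invariant_subspace_rules[OF KInv]
    let ?M = "V.span (B \<inter> K)"
    have BKc: "B \<inter> K \<subseteq> carrier V" using B(1) by blast
    have M: "VectorSpace.subspace real_ring ?M V" by (rule V.span_is_subspace[OF BKc])
    have KA: "K \<inter> A \<subseteq> ?M" if A: "A \<in> ?F" for A
    proof -
      have "K \<inter> A \<in> ?F" using psubset.prems(2)[of K A] K A notsub[OF A] by blast
      then have "K \<inter> A \<subseteq> V.span (B \<inter> (K \<inter> A))" by (rule BK)
      also have "\<dots> \<subseteq> ?M" by (rule V.span_is_monotone) blast
      finally show ?thesis .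
    qed
    obtain S where S: "S \<in> Inv" "\<Union>?F \<subseteq> S" "K \<inter> S \<subseteq> ?M"
    proof -
      have F: "finite ?F" "?F \<subseteq> Inv" using psubset.hyps psubset.prems(1) by auto
      have "\<exists>S\<in>Inv. \<Union>?F \<subseteq> S \<and> K \<inter> S \<subseteq> ?M"
        by (rule exists_cover[OF F KInv]) (use M KA in \<open>auto simp: subspace_real_iff\<close>)
      then show ?thesis using that by blast
    qed
    have submod: "submodule real_ring A V" if "A \<in> Inv" for A
      using that by (auto simp: invariant_subspaces_def VectorSpace.subspace_def)
    have spanB: "V.span B \<subseteq> S"
      using B(3) S(2) by (intro V.span_is_subset submod S(1)) blast
    let ?P = "\<lambda>C. B \<subseteq> C \<and> C \<subseteq> B \<union> K \<and> V.lin_indpt C"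
    have "\<exists>C. finite C \<and> maximal C ?P"
    proof (rule maximal_exists)
      fix C assume C: "?P C"
      then have "C \<subseteq> carrier V" using B(1) KR(1) by auto
      with C show "finite C \<and> card C \<le> V.dim" using V.li_le_dim[OF fd, of C] by simp
    next
      show "?P B" using B(2) by simp
    qed
    then obtain C where PC: "?P C" and PD: "\<forall>D. C \<subseteq> D \<and> ?P D \<longrightarrow> D = C"
      unfolding maximal_def by auto
    have C: "B \<subseteq> C" "C \<subseteq> B \<union> K" "V.lin_indpt C" using PC by simp_all
    have Cmax: "D = C" if "C \<subseteq> D" "D \<subseteq> B \<union> K" "V.lin_indpt D" for D
      using PD that C(1) by simp
    have Cc: "C \<subseteq> carrier V" using C(2) B(1) KR(1) by blast
    have CKc: "C \<inter> K \<subseteq> carrier V" using Cc by blast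
    let ?N = "V.span (C \<inter> K)"
    have N: "VectorSpace.subspace real_ring ?N V" by (rule V.span_is_subspace[OF CKc])
    have MN: "?M \<subseteq> ?N" by (rule V.span_is_monotone) (use C(1) in blast)
    have NK: "?N \<subseteq> K" by (rule V.span_is_subset[OF _ submod[OF KInv]]) blast
    have "K \<subseteq> ?N"
    proof
      fix x assume x: "x \<in> K"
      then have xc: "x \<in> carrier V" using KR(1) by blast
      have "x \<in> V.span C"
      proof (cases "x \<in> C")
        case True
        then show ?thesis using V.in_own_span[OF Cc] by blast
      next
        case False
        have "V.lin_dep (C \<union> {x})"
        proof (rule ccontr)
          assume "\<not> V.lin_dep (C \<union> {x})"
          then have "C \<union> {x} = C" using C(2) x by (intro Cmax) auto
          then show False using False by blast
        qed
        then show ?thesis using V.lin_dep_iff_in_span[OF Cc C(3) xc False] by blast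
      qed
      also have "C = B \<union> C \<inter> K" using C by blast
      also have "V.span (B \<union> C \<inter> K) = V.submodule_sum (V.span B) ?N"
        by (rule V.span_union_is_sum[OF B(1) CKc])
      finally obtain p q where pq: "p \<in> V.span B" "q \<in> ?N" "x = p \<oplus>\<^bsub>V\<^esub> q"
        unfolding V.submodule_sum_def by auto
      have pc: "p \<in> carrier V" and qK: "q \<in> K" and qc: "q \<in> carrier V"
        using pq NK KR(1) V.span_is_subset2[OF B(1)] by auto
      have "p = x \<oplus>\<^bsub>V\<^esub> (-1) \<odot>\<^bsub>V\<^esub> q"
        unfolding pq(3) using r(3,4,6,8) pc qc by simp
      then have "p \<in> K" using KR(3)[OF x KR(4)[OF qK, of "-1"]] by simp
      then have "p \<in> ?N" using S(3) spanB pq(1) MN by blast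
      then show "x \<in> ?N" using pq(2,3) N by (simp add: subspace_real_iff)
    qed
    moreover have "A \<subseteq> V.span (C \<inter> A)" if "A \<in> ?F" for A
    proof -
      have "V.span (B \<inter> A) \<subseteq> V.span (C \<inter> A)" using C(1) by (intro V.span_is_monotone) auto
      then show ?thesis using BK[OF that] by simp
    qed
    ultimately have "\<forall>A\<in>F. A \<subseteq> V.span (C \<inter> A)" by auto
    moreover have "C \<subseteq> \<Union>F" using C(2) B(3) K by auto
    ultimately show ?thesis
      using Cc C(3) by (intro exI[of _ C]) (simp add: adapted_def)
  qed
qed

text \<open>
  Coordinates with respect to a basis adapted to all invariant subspaces.
\<close>

lemma (in finite_invariants) exists_coordinates:
  assumes fd: "vectorspace.fin_dim real_ring V"
  shows "\<exists>n \<phi>. lin_iso (coord_space {1..n}) V \<phi> \<and>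
    (\<forall>K\<in>Inv. \<exists>S\<subseteq>{1..n}. K = \<phi> ` vanishing {1..n} S)"
proof -
  interpret V: vectorspace real_ring V by (rule vs)
  obtain B where "adapted V Inv B"
    using exists_adapted[OF fd finite_Inv] Int_Inv by blast
  then have B: "B \<subseteq> carrier V" "V.lin_indpt B"
    and BK: "\<And>K. K \<in> Inv \<Longrightarrow> K \<subseteq> V.span (B \<inter> K)"
    unfolding adapted_def by blast+
  have finB: "finite B" by (rule V.li_le_dim(1)[OF fd B])
  have "carrier V \<subseteq> V.span B" using BK[OF carrier_Inv] B(1) by (simp add: Int_absorb2)
  then have basis: "V.basis B"
    using B V.span_is_subset2[OF B(1)] unfolding V.basis_def by blast
  define n where "n = card B"
  obtain b where b: "bij_betw b {1..n} B"
    using finite_same_card_bij[of "{1..n}" B] finB by (auto simp: n_def)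
  define \<iota> where "\<iota> = inv_into {1..n} b"
  have \<iota>: "\<iota> v \<in> {1..n}" "b (\<iota> v) = v" if "v \<in> B" for v
    using that b by (auto simp: \<iota>_def bij_betw_def f_inv_into_f intro: inv_into_into[of v b "{1..n}", simplified])
  have b\<iota>: "\<iota> (b i) = i" "b i \<in> B" if "i \<in> {1..n}" for i
    using that b by (auto simp: \<iota>_def bij_betw_def)
  let ?N = "coord_space {1..n}"
  define \<phi> where "\<phi> x = V.lincomb (\<lambda>v. x (\<iota> v)) B" for x :: "nat \<Rightarrow> real"
  have coeffs: "a \<in> A \<rightarrow> carrier real_ring" for a :: "'v \<Rightarrow> real" and A by simp
  have unique: "\<exists>!a. a \<in> B \<rightarrow>\<^sub>E carrier real_ring \<and> V.lincomb a B = v" if "v \<in> carrier V" for v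
    using V.basis_criterion[OF finB B(1)] basis that by blast
  have cong: "V.lincomb a B = V.lincomb a' B" if "\<And>v. v \<in> B \<Longrightarrow> a v = a' v" for a a' :: "'v \<Rightarrow> real"
    by (rule V.lincomb_cong[OF refl B(1)]) (use that in auto)
  have "lin_iso ?N V \<phi>"
  proof (rule lin_isoI)
    show "linear_map real_ring ?N V \<phi>"
    proof (rule linear_map_realI[OF vectorspace_coord_space vs])
      show "\<phi> x \<in> carrier V" for x unfolding \<phi>_def by (rule V.lincomb_closed[OF B(1) coeffs])
      show "\<phi> (x \<oplus>\<^bsub>?N\<^esub> y) = \<phi> x \<oplus>\<^bsub>V\<^esub> \<phi> y" for x y
      proof -
        have "\<phi> (x \<oplus>\<^bsub>?N\<^esub> y) = V.lincomb (\<lambda>v. x (\<iota> v) \<oplus>\<^bsub>real_ring\<^esub> y (\<iota> v)) B"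
          unfolding \<phi>_def using \<iota>(1) by (intro cong) (simp add: coord_space_simps)
        also have "\<dots> = \<phi> x \<oplus>\<^bsub>V\<^esub> \<phi> y"
          unfolding \<phi>_def by (rule V.lincomb_sum[OF finB B(1) coeffs coeffs])
        finally show ?thesis .
      qed
      show "\<phi> (c \<odot>\<^bsub>?N\<^esub> x) = c \<odot>\<^bsub>V\<^esub> \<phi> x" for c x
      proof -
        have "\<phi> (c \<odot>\<^bsub>?N\<^esub> x) = V.lincomb (\<lambda>v. c \<otimes>\<^bsub>real_ring\<^esub> x (\<iota> v)) B"
          unfolding \<phi>_def using \<iota>(1) by (intro cong) (simp add: coord_space_simps)
        also have "\<dots> = c \<odot>\<^bsub>V\<^esub> \<phi> x"
          unfolding \<phi>_def by (rule V.lincomb_smult[OF B(1) coeffs]) simp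
        finally show ?thesis .
      qed
    qed
    show "inj_on \<phi> (carrier ?N)"
    proof (rule inj_onI)
      fix x y assume xy: "x \<in> carrier ?N" "y \<in> carrier ?N" "\<phi> x = \<phi> y"
      have ext: "V.lincomb (\<lambda>v\<in>B. z (\<iota> v)) B = \<phi> z" for z :: "nat \<Rightarrow> real"
        unfolding \<phi>_def by (rule cong) simp
      have "V.lincomb (\<lambda>v\<in>B. x (\<iota> v)) B = \<phi> x" "V.lincomb (\<lambda>v\<in>B. y (\<iota> v)) B = \<phi> x"
        using ext xy(3) by simp_all
      moreover have "\<phi> x \<in> carrier V" unfolding \<phi>_def by (rule V.lincomb_closed[OF B(1) coeffs])
      ultimately have "(\<lambda>v\<in>B. x (\<iota> v)) = (\<lambda>v\<in>B. y (\<iota> v))" using unique[of "\<phi> x"] by auto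
      then have "x i = y i" if "i \<in> {1..n}" for i
        using b\<iota>[OF that] by (metis restrict_apply')
      then show "x = y" using xy(1,2) by (intro extensionalityI[of _ "{1..n}"]) (auto simp: coord_space_simps PiE_def)
    qed
    have "v \<in> \<phi> ` carrier ?N" if v: "v \<in> carrier V" for v
    proof -
      obtain a where a: "V.lincomb a B = v" using unique[OF v] by blast
      have "\<phi> (\<lambda>i\<in>{1..n}. a (b i)) = V.lincomb a B"
        unfolding \<phi>_def using \<iota> by (intro cong) simp
      moreover have "(\<lambda>i\<in>{1..n}. a (b i)) \<in> carrier ?N" by (simp add: coord_space_simps)
      ultimately show ?thesis using a by (metis imageI)
    qed
    moreover have "\<phi> x \<in> carrier V" for x unfolding \<phi>_def by (rule V.lincomb_closed[OF B(1) coeffs])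
    ultimately show "\<phi> ` carrier ?N = carrier V" by blast
  qed
  moreover have "\<exists>S\<subseteq>{1..n}. K = \<phi> ` vanishing {1..n} S" if K: "K \<in> Inv" for K
  proof (intro exI conjI)
    let ?S = "{i \<in> {1..n}. b i \<notin> K}"
    have submod: "submodule real_ring K V"
      using K by (auto simp: invariant_subspaces_def VectorSpace.subspace_def)
    have BKf: "finite (B \<inter> K)" "B \<inter> K \<subseteq> carrier V" using finB B(1) by auto
    have restr: "V.lincomb a B = V.lincomb a (B \<inter> K)" if "\<And>v. v \<in> B - K \<Longrightarrow> a v = 0" for a :: "'v \<Rightarrow> real"
    proof -
      have "V.lincomb a ((B \<inter> K) \<union> (B - K)) = V.lincomb a (B \<inter> K) \<oplus>\<^bsub>V\<^esub> V.lincomb a (B - K)"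
        using finB B(1) by (intro V.lincomb_union coeffs) auto
      also have "V.lincomb a (B - K) = \<zero>\<^bsub>V\<^esub>"
        using that B(1) r(14) unfolding V.lincomb_def by (intro V.M.add.finprod_one_eqI) auto
      also have "(B \<inter> K) \<union> (B - K) = B" by blast
      finally show ?thesis using r(4) V.lincomb_closed[OF BKf(2) coeffs] by simp
    qed
    show "?S \<subseteq> {1..n}" by blast
    show "K = \<phi> ` vanishing {1..n} ?S"
    proof
      show "\<phi> ` vanishing {1..n} ?S \<subseteq> K"
      proof
        fix y assume "y \<in> \<phi> ` vanishing {1..n} ?S"
        then obtain x where x: "x \<in> vanishing {1..n} ?S" "y = \<phi> x" by blast
        have "y = V.lincomb (\<lambda>v. x (\<iota> v)) (B \<inter> K)"
          unfolding x(2) \<phi>_def using x(1) \<iota> by (intro restr) (auto simp: vanishing_def)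
        then have "y \<in> V.span (B \<inter> K)"
          unfolding V.span_def using BKf by (auto intro!: exI[of _ "\<lambda>v. x (\<iota> v)"] exI[of _ "B \<inter> K"])
        moreover have "V.span (B \<inter> K) \<subseteq> K" by (rule V.span_is_subset[OF _ submod]) blast
        ultimately show "y \<in> K" by blast
      qed
      show "K \<subseteq> \<phi> ` vanishing {1..n} ?S"
      proof
        fix y assume "y \<in> K"
        then obtain a where a: "V.lincomb a (B \<inter> K) = y"
          using BK[OF K] V.finite_in_span[OF BKf] by blast
        let ?a = "\<lambda>v. if v \<in> K then a v else 0"
        let ?x = "\<lambda>i\<in>{1..n}. ?a (b i)"
        have "\<phi> ?x = V.lincomb ?a B" unfolding \<phi>_def using \<iota> by (intro cong) simp
        also have "\<dots> = V.lincomb ?a (B \<inter> K)" by (rule restr) simp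
        also have "\<dots> = V.lincomb a (B \<inter> K)" by (rule V.lincomb_cong[OF refl BKf(2)]) auto
        finally have "y = \<phi> ?x" using a by simp
        moreover have "?x \<in> vanishing {1..n} ?S" by (simp add: vanishing_def coord_space_simps)
        ultimately show "y \<in> \<phi> ` vanishing {1..n} ?S" by blast
      qed
    qed
  qed
  ultimately show ?thesis by blast
qed

section \<open>The correspondence\<close>

lemma finite_complete_multifoliate:
  fixes X :: "('i, 'v) proj_system"
  assumes inf: "infinite (UNIV :: 'l set)" and X: "X \<in> finite_complete_systems"
  shows "\<exists>M\<in>(multifoliate_structures :: 'l multifol set).
    lin_conjugate (coord_space {1..mf_n M}) (GL_mf M) (proj_limit X) (GL_ps X)"
proof -
  have ps: "is_proj_system X" and fin: "finite (ps_idx X)" and com: "complete_ps X"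
    using X by (auto simp: finite_complete_systems_def)
  note D = is_proj_systemD[OF ps]
  let ?L = "proj_limit X"
  interpret finite_invariants ?L "GL_ps X"
  proof (rule finite_invariants.intro)
    show "vectorspace real_ring ?L" by (rule D(9))
    show "linear_map real_ring ?L ?L f" if "f \<in> GL_ps X" for f
      using that by (simp add: GL_ps_def lin_iso_def)
    show "finite (invariant_subspaces ?L (GL_ps X))"
      using com[unfolded complete_ps_iff[OF ps]] finite_imageI[OF fin] by (rule finite_subset)
  qed
  obtain n \<phi> where \<phi>: "lin_iso (coord_space {1..n}) ?L \<phi>"
    and ex: "\<forall>K\<in>Inv. \<exists>S\<subseteq>{1..n}. K = \<phi> ` vanishing {1..n} S"
    using exists_coordinates[OF D(5)] by (elim exE conjE)
  define \<S> where "\<S> = {S. S \<subseteq> {1..n} \<and> \<phi> ` vanishing {1..n} S \<in> Inv}"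
  have "(`) \<phi> ` vanishing {1..n} ` \<S> = Inv"
  proof
    show "(`) \<phi> ` vanishing {1..n} ` \<S> \<subseteq> Inv" by (auto simp: \<S>_def)
    show "Inv \<subseteq> (`) \<phi> ` vanishing {1..n} ` \<S>"
    proof
      fix K assume K: "K \<in> Inv"
      then obtain S where "S \<subseteq> {1..n}" "K = \<phi> ` vanishing {1..n} S" using ex by (elim ballE exE conjE) auto
      then show "K \<in> (`) \<phi> ` vanishing {1..n} ` \<S>" using K by (simp add: \<S>_def)
    qed
  qed
  then have "fincodim_invariant_subspaces X = (`) \<phi> ` vanishing {1..n} ` \<S>"
    unfolding fincodim_invariant_subspaces_eq[OF ps] by (rule sym)
  from GL_ps_completion(2)[OF ps, unfolded this]
  have GL: "GL_ps X = stabilizer ?L ((`) \<phi> ` vanishing {1..n} ` \<S>)" .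
  have "\<Union>\<S> \<subseteq> {1..n}" by (auto simp: \<S>_def)
  from exists_multifoliate_structure[OF inf this] obtain M :: "'l multifol" where
    M: "M \<in> multifoliate_structures" "mf_n M = n"
    "GL_mf M = stabilizer (coord_space {1..n}) (vanishing {1..n} ` \<S>)"
    by (elim exE conjE)
  have "lin_conjugate (coord_space {1..n}) (GL_mf M) ?L (GL_ps X)"
    unfolding GL M(3) by (rule lin_conjugate_stabilizer[OF \<phi>]) (auto simp: vanishing_def)
  then show ?thesis using M(1,2) by (intro bexI[of _ M]) simp_all
qed

lemma bij_betw_quotients:
  assumes R: "equiv A R" and S: "equiv B S" and f: "\<And>x. x \<in> A \<Longrightarrow> f x \<in> B"
    and iff: "\<And>x y. x \<in> A \<Longrightarrow> y \<in> A \<Longrightarrow> (f x, f y) \<in> S \<longleftrightarrow> (x, y) \<in> R"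
    and surj: "\<And>y. y \<in> B \<Longrightarrow> \<exists>x\<in>A. (f x, y) \<in> S"
  shows "\<exists>F. bij_betw F (A // R) (B // S) \<and> (\<forall>x\<in>A. F (R `` {x}) = S `` {f x})"
proof (intro exI conjI ballI)
  let ?F = "\<lambda>C. S `` {f (SOME x. x \<in> C)}"
  show F: "?F (R `` {x}) = S `` {f x}" if x: "x \<in> A" for x
  proof -
    have "x \<in> R `` {x}" using equiv_class_self[OF R x] .
    then have "(SOME y. y \<in> R `` {x}) \<in> R `` {x}" by (rule someI)
    then have *: "(x, SOME y. y \<in> R `` {x}) \<in> R" by blast
    then have "(SOME y. y \<in> R `` {x}) \<in> A" using equiv_type[OF R] by blast
    then have "(f x, f (SOME y. y \<in> R `` {x})) \<in> S" using iff[OF x] * by blast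
    then show ?thesis using equiv_class_eq[OF S] by metis
  qed
  show "bij_betw ?F (A // R) (B // S)"
    unfolding bij_betw_def
  proof
    show "inj_on ?F (A // R)"
    proof (rule inj_onI)
      fix C D assume "C \<in> A // R" "D \<in> A // R" and eq: "?F C = ?F D"
      then obtain x y where xy: "x \<in> A" "C = R `` {x}" "y \<in> A" "D = R `` {y}" by (auto elim!: quotientE)
      then have "S `` {f x} = S `` {f y}" using eq F by simp
      then have "(f x, f y) \<in> S" using eq_equiv_class_iff[OF S f f] xy(1,3) by blast
      then show "C = D" using iff xy equiv_class_eq[OF R] by blast
    qed
    show "?F ` (A // R) = B // S"
    proof
      show "?F ` (A // R) \<subseteq> B // S"
      proof
        fix D assume "D \<in> ?F ` (A // R)"
        then obtain x where x: "x \<in> A" "D = ?F (R `` {x})" by (auto elim!: quotientE)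
        then show "D \<in> B // S" using F[OF x(1)] f[OF x(1)] by (simp add: quotientI)
      qed
      show "B // S \<subseteq> ?F ` (A // R)"
      proof
        fix D assume "D \<in> B // S"
        then obtain y where y: "y \<in> B" "D = S `` {y}" by (auto elim!: quotientE)
        then obtain x where x: "x \<in> A" "(f x, y) \<in> S" using surj by blast
        then have "D = ?F (R `` {x})" using F[OF x(1)] equiv_class_eq[OF S x(2)] y(2) by simp
        then show "D \<in> ?F ` (A // R)" using x(1) by (blast intro: quotientI)
      qed
    qed
  qed
qed

lemma equiv_mf_equiv: "equiv multifoliate_structures mf_equiv"
proof (rule equivI)
  show "mf_equiv \<subseteq> multifoliate_structures \<times> multifoliate_structures" by (auto simp: mf_equiv_def)
  show "refl_on multifoliate_structures mf_equiv"
    using lin_conjugate_refl[OF vectorspace_coord_space GL_mf_subset_Bij] by (auto simp: refl_on_def mf_equiv_def)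
  show "sym mf_equiv"
    using lin_conjugate_sym[OF GL_mf_subset_Bij GL_mf_subset_Bij] unfolding mf_equiv_def sym_def
    by fastforce
  show "trans mf_equiv"
    using lin_conjugate_trans[OF GL_mf_subset_Bij GL_mf_subset_Bij GL_mf_subset_Bij]
    unfolding mf_equiv_def trans_def by fastforce
qed

lemma equiv_fc_equiv: "equiv finite_complete_systems fc_equiv"
proof (rule equivI)
  show "fc_equiv \<subseteq> finite_complete_systems \<times> finite_complete_systems" by (auto simp: fc_equiv_def)
  show "refl_on finite_complete_systems fc_equiv"
    using lin_conjugate_refl[OF is_proj_systemD(9) GL_ps_subset_Bij]
    by (auto simp: refl_on_def fc_equiv_def finite_complete_systems_def ps_equivalent_def)
  show "sym fc_equiv"
    using lin_conjugate_sym[OF GL_ps_subset_Bij GL_ps_subset_Bij]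
    unfolding fc_equiv_def sym_def ps_equivalent_def by blast
  show "trans fc_equiv"
    using lin_conjugate_trans[OF GL_ps_subset_Bij GL_ps_subset_Bij GL_ps_subset_Bij]
    unfolding fc_equiv_def trans_def ps_equivalent_def by blast
qed

text \<open>
  The groups of \<open>M\<close> and \<open>N\<close> are conjugate to those of the completions, so only the equality of the
  numbers of coordinates remains; it follows by comparing dimensions.
\<close>

lemma completion_equiv_iff:
  assumes M: "M \<in> multifoliate_structures" and N: "N \<in> multifoliate_structures"
  shows "(completion (mf_system M), completion (mf_system N)) \<in> fc_equiv \<longleftrightarrow> (M, N) \<in> mf_equiv"
proof -
  let ?m = "{1..mf_n M}" and ?n = "{1..mf_n N}"
  let ?C = "completion (mf_system M)" and ?D = "completion (mf_system N)"
  note b = GL_mf_subset_Bij[OF M] GL_mf_subset_Bij[OF N] GL_ps_subset_Bij[of ?C] GL_ps_subset_Bij[of ?D]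
  note cM = completion_mf_system[OF M] and cN = completion_mf_system[OF N]
  note cM' = lin_conjugate_sym[OF b(1,3) cM(2)] and cN' = lin_conjugate_sym[OF b(2,4) cN(2)]
  have "mf_n M = mf_n N" if "lin_conjugate (coord_space ?m) (GL_mf M) (coord_space ?n) (GL_mf N)"
    using that lin_iso_coord_space_card_eq[of ?m ?n] by (auto simp: lin_conjugate_def)
  then have "(M, N) \<in> mf_equiv \<longleftrightarrow> lin_conjugate (coord_space ?m) (GL_mf M) (coord_space ?n) (GL_mf N)"
    using M N by (auto simp: mf_equiv_def)
  also have "\<dots> \<longleftrightarrow> lin_conjugate (proj_limit ?C) (GL_ps ?C) (proj_limit ?D) (GL_ps ?D)"
  proof
    assume "lin_conjugate (coord_space ?m) (GL_mf M) (coord_space ?n) (GL_mf N)"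
    from lin_conjugate_trans[OF b(3,1,2) cM' this]
    show "lin_conjugate (proj_limit ?C) (GL_ps ?C) (proj_limit ?D) (GL_ps ?D)"
      by (rule lin_conjugate_trans[OF b(3,2,4) _ cN(2)])
  next
    assume "lin_conjugate (proj_limit ?C) (GL_ps ?C) (proj_limit ?D) (GL_ps ?D)"
    from lin_conjugate_trans[OF b(1,3,4) cM(2) this]
    show "lin_conjugate (coord_space ?m) (GL_mf M) (coord_space ?n) (GL_mf N)"
      by (rule lin_conjugate_trans[OF b(1,4,2) _ cN'])
  qed
  also have "\<dots> \<longleftrightarrow> (?C, ?D) \<in> fc_equiv"
    using cM(1) cN(1) by (simp add: fc_equiv_def ps_equivalent_def)
  finally show ?thesis ..
qed

lemma completion_mf_system_surj:
  fixes X :: "('i, 'v) proj_system"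
  assumes inf: "infinite (UNIV :: 'l set)" and X: "X \<in> finite_complete_systems"
  shows "\<exists>M\<in>(multifoliate_structures :: 'l multifol set). ps_equivalent (completion (mf_system M)) X"
proof -
  obtain M :: "'l multifol" where M: "M \<in> multifoliate_structures"
    "lin_conjugate (coord_space {1..mf_n M}) (GL_mf M) (proj_limit X) (GL_ps X)"
    using finite_complete_multifoliate[OF assms] by blast
  note b = GL_mf_subset_Bij[OF M(1)] GL_ps_subset_Bij[of "completion (mf_system M)"] GL_ps_subset_Bij[of X]
  have "ps_equivalent (completion (mf_system M)) X"
    unfolding ps_equivalent_def
    by (rule lin_conjugate_trans[OF b(2,1,3) lin_conjugate_sym[OF b(1,2) completion_mf_system(2)[OF M(1)]] M(2)])
  then show ?thesis using M(1) by blast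
qed

theorem theorem2p1:
  assumes "infinite (UNIV :: 'l set)"
  shows
    "(\<exists>F. bij_betw F
            ((multifoliate_structures :: 'l multifol set) // mf_equiv)
            ((finite_complete_systems :: 'l mf_completion_system set) // fc_equiv) \<and>
          (\<forall>M\<in>multifoliate_structures.
             F (mf_equiv `` {M}) = fc_equiv `` {completion (mf_system M)})) \<and>
     (\<forall>X\<in>(finite_complete_systems :: ('i, 'v) proj_system set).
        \<exists>M\<in>(multifoliate_structures :: 'l multifol set).
          ps_equivalent (completion (mf_system M)) X)"
proof
  show "\<exists>F. bij_betw F
            ((multifoliate_structures :: 'l multifol set) // mf_equiv)
            ((finite_complete_systems :: 'l mf_completion_system set) // fc_equiv) \<and>
          (\<forall>M\<in>multifoliate_structures.
             F (mf_equiv `` {M}) = fc_equiv `` {completion (mf_system M)})"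
  proof (rule bij_betw_quotients[OF equiv_mf_equiv equiv_fc_equiv completion_mf_system(1) completion_equiv_iff])
    fix X :: "'l mf_completion_system" assume X: "X \<in> finite_complete_systems"
    then obtain M :: "'l multifol" where "M \<in> multifoliate_structures" "ps_equivalent (completion (mf_system M)) X"
      using completion_mf_system_surj[OF assms] by blast
    then show "\<exists>M\<in>(multifoliate_structures :: 'l multifol set). (completion (mf_system M), X) \<in> fc_equiv"
      using X completion_mf_system(1) by (auto simp: fc_equiv_def)
  qed
  show "\<forall>X\<in>(finite_complete_systems :: ('i, 'v) proj_system set).
        \<exists>M\<in>(multifoliate_structures :: 'l multifol set). ps_equivalent (completion (mf_system M)) X"
    using completion_mf_system_surj[OF assms] by blast
qed

end
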